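(* For any initial position $(t,x)\in[0,T]\times\mathbb R^n$, there exists some Nash equilibrium payoff at the position $(t,x)$.
   Context: Dynamics. $T>0$; $U,V$ are compact metric spaces; $f:\mathbb R^n\times U\times V\to\mathbb R^n$ is bounded, continuous in $(u,v)$ and Lipschitz in $x$ uniformly in $(u,v)$ (no Isaacs condition is assumed); $g_1,g_2:\mathbb R^n\to\mathbb R$ are bounded and Lipschitz. $\mathcal U_{t,T}$ (resp. $\mathcal V_{t,T}$) is the set of Lebesgue measurable functions $[t,T]\to U$ (resp. $[t,T]\to V$), a.e. equal functions being identified, with the Borel $\sigma$-field of convergence in Lebesgue measure. $X^{t,x,u,v}$ is the unique solution of $X_s=x+\int_t^sf(X_r,u_r,v_r)dr$, $s\in[t,T]$ (pathwise for random controls). Probability space. $(\Omega,\mathcal F,P)$ is the canonical Wiener space of continuous functions $[0,T]\to\mathbb R^2$ with coordinate Brownian motion $B=(B^1,B^2)$. For a partition $\pi=\{0=t_0<\dots<t_N=T\}$, $|\pi|=\max_j(t_j-t_{j-1})$, put $\zeta^\pi_{i,j}=\Phi_{0,1}\big((B^i_{t_j}-B^i_{t_{j-1}})/\sqrt{t_j-t_{j-1}}\big)$, $i=1,2$, $1\le j\le N$, with $\Phi_{0,1}$ the standard normal distribution function, and $\zeta^\pi_j=(\zeta^\pi_{1,j},\zeta^\pi_{2,j})$. Convention for index $0$: $\Omega$ is enlarged to carry two further variables $\zeta^\pi_{1,0},\zeta^\pi_{2,0}$ (the same for all $\pi$), uniform on $[0,1]$, independent of each other and of $B$. Strategies. Let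 $t\in[t_{k-1},t_k)$. $\mathcal A_1^\pi(t,T)$ is the set of maps $\alpha:\Omega\times[t,T]\times\mathcal V_{t,T}\to U$ (so that $\alpha(\omega,v)\in\mathcal U_{t,T}$) of the form $\alpha(\omega,v)(s)=\sum_{l=k}^N\alpha_l((\zeta^\pi_{k-1},\dots,\zeta^\pi_{l-2},\zeta^\pi_{1,l-1})(\omega),v)(s)\,I_{[t\vee t_{l-1},t_l)}(s)$ (for $l=k$ the first argument is $\zeta^\pi_{1,k-1}$), where $\alpha_l(y,v)(s)$ is Borel measurable in $(y,s,v)\in\mathbb R^{2(l-k)+1}\times[t\vee t_{l-1},t_l]\times\mathcal V_{t,T}$ and, for $k\le l\le N$, if $v=v'$ a.e. on $[t,t_{l-1}]$ then for all $y$, $\alpha_l(y,v)=\alpha_l(y,v')$ a.e. on $[t\vee t_{l-1},t_l]$ (so $\alpha_k$ does not depend on $v$). $\mathcal B_1^\pi(t,T)$ is defined symmetrically: maps $\beta:\Omega\times[t,T]\times\mathcal U_{t,T}\to V$ with $\zeta^\pi_{2,l-1}$ in place of $\zeta^\pi_{1,l-1}$. For each $(\alpha,\beta)\in\mathcal A_1^\pi(t,T)\times\mathcal B_1^\pi(t,T)$ there is a unique measurable $\omega\mapsto(u_\omega,v_\omega)\in\mathcal U_{t,T}\times\mathcal V_{t,T}$ with $\alpha(\omega,v_\omega)=u_\omega$, $\beta(\omega,u_\omega)=v_\omega$ a.e. on $[t,T]$; put $J_m(t,x,\alpha,\beta)=E[g_m(X_T^{t,x,u,v})]$, $m=1,2$.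 At $t=T$ the strategy sets are trivial and $J_m=g_m(x)$. Player I maximizes $J_1$, Player II maximizes $J_2$. Nash equilibrium payoff. $(e_1,e_2)\in\mathbb R^2$ is a Nash equilibrium payoff at $(t,x)$ if for any $\epsilon>0$ there exists $\delta_\epsilon>0$ such that for any partition $\pi$ of $[0,T]$ with $|\pi|\le\delta_\epsilon$ there exist $(\alpha^\epsilon,\beta^\epsilon)\in\mathcal A_1^\pi(t,T)\times\mathcal B_1^\pi(t,T)$ such that for all $(\alpha,\beta)\in\mathcal A_1^\pi(t,T)\times\mathcal B_1^\pi(t,T)$: $J_1(t,x,\alpha^\epsilon,\beta^\epsilon)\ge J_1(t,x,\alpha,\beta^\epsilon)-\epsilon$, $J_2(t,x,\alpha^\epsilon,\beta^\epsilon)\ge J_2(t,x,\alpha^\epsilon,\beta)-\epsilon$, and $|J_m(t,x,\alpha^\epsilon,\beta^\epsilon)-e_m|\le\epsilon$ for $m=1,2$. *)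

theory Defs
  imports "HOL-Probability.Probability"
begin

section \<open>Controls\<close>

text \<open>
  Controls are handled through representatives: an element of \<open>controls t T\<close> is a function on the
  reals of which only the restriction to \<open>[t, T]\<close>, up to null sets, is relevant.  The sigma-algebra
  is the Borel one of convergence in Lebesgue measure.  As that topology is (pseudo)metrizable, its
  closed sets are the sequentially closed ones.  All measurable sets are saturated with respect to
  a.e. equality (lemma below), so that measurable maps out of \<open>control_algebra t T\<close> into a metric
  space are precisely the measurable maps on the quotient by a.e. equality.
\<close>

definition controls :: "real \<Rightarrow> real \<Rightarrow> (real \<Rightarrow> 'a::metric_space) set" where
  "controls t T = borel_measurable (lebesgue_on {t..T})"

definition tendsto_in_measure ::
  "real \<Rightarrow> real \<Rightarrow> (nat \<Rightarrow> real \<Rightarrow> 'a::metric_space) \<Rightarrow> (real \<Rightarrow> 'a) \<Rightarrow> bool" where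
  "tendsto_in_measure t T w v \<longleftrightarrow>
     (\<forall>\<epsilon>>0. (\<lambda>n. measure lebesgue {s \<in> {t..T}. dist (w n s) (v s) > \<epsilon>}) \<longlonglongrightarrow> 0)"

definition closed_control_set :: "real \<Rightarrow> real \<Rightarrow> (real \<Rightarrow> 'a::metric_space) set \<Rightarrow> bool" where
  "closed_control_set t T C \<longleftrightarrow> C \<subseteq> controls t T \<and>
     (\<forall>w v. (\<forall>n. w n \<in> C) \<and> v \<in> controls t T \<and> tendsto_in_measure t T w v \<longrightarrow> v \<in> C)"

definition control_algebra :: "real \<Rightarrow> real \<Rightarrow> (real \<Rightarrow> 'a::metric_space) measure" where
  "control_algebra t T = sigma (controls t T) (Collect (closed_control_set t T))"

lemma space_control_algebra: "space (control_algebra t T) = controls t T"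
  unfolding control_algebra_def
  by (rule space_measure_of) (auto simp: closed_control_set_def)

lemma sets_control_algebra:
  "sets (control_algebra t T) = sigma_sets (controls t T) (Collect (closed_control_set t T))"
  unfolding control_algebra_def
  by (rule sets_measure_of) (auto simp: closed_control_set_def)

lemma tendsto_in_measure_AE_eq:
  assumes "AE s in lebesgue_on {t..T}. v s = v' s"
  shows "tendsto_in_measure t T (\<lambda>_. v) v'"
proof -
  have "measure lebesgue {s \<in> {t..T}. dist (v s) (v' s) > \<epsilon>} = 0" if "\<epsilon> > 0" for \<epsilon>
  proof -
    have "AE s in lebesgue. s \<in> {t..T} \<longrightarrow> v s = v' s"
      using assms by (subst (asm) AE_restrict_space_iff) auto
    then obtain N where N: "N \<in> null_sets lebesgue" "{s. \<not> (s \<in> {t..T} \<longrightarrow> v s = v' s)} \<subseteq> N"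
      unfolding eventually_ae_filter by auto
    have "{s \<in> {t..T}. dist (v s) (v' s) > \<epsilon>} \<subseteq> N"
      using N(2) that by auto
    then have "{s \<in> {t..T}. dist (v s) (v' s) > \<epsilon>} \<in> null_sets lebesgue"
      using N(1) by (meson null_sets_completion_subset)
    then show ?thesis
      by (simp add: measure_def null_sets_def)
  qed
  then show ?thesis
    by (simp add: tendsto_in_measure_def)
qed

lemma control_algebra_saturated:
  assumes "A \<in> sets (control_algebra t T)" "v \<in> controls t T" "v' \<in> controls t T"
    and "AE s in lebesgue_on {t..T}. v s = v' s"
  shows "v \<in> A \<longleftrightarrow> v' \<in> A"
  using assms(1) unfolding sets_control_algebra
proof (induction rule: sigma_sets.induct)
  case (Basic C)
  then have C: "w \<in> C"
    if "v \<in> C" "w \<in> controls t T" "tendsto_in_measure t T (\<lambda>_. v) w" for v w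
    using that unfolding mem_Collect_eq closed_control_set_def
    by (elim conjE allE[where x = "\<lambda>_. v"] allE[where x = w]) simp
  have "AE s in lebesgue_on {t..T}. v' s = v s"
    using assms(4) by (auto elim: AE_mp)
  then have "tendsto_in_measure t T (\<lambda>_. v) v'" "tendsto_in_measure t T (\<lambda>_. v') v"
    using assms(4) by (auto intro: tendsto_in_measure_AE_eq)
  then show ?case
    using C assms(2,3) by blast
qed (use assms(2,3) in auto)

section \<open>Dynamics\<close>

definition trajectory ::
  "(real^'n \<Rightarrow> 'u::metric_space \<Rightarrow> 'v::metric_space \<Rightarrow> real^'n) \<Rightarrow> real \<Rightarrow> real \<Rightarrow> real^'n
    \<Rightarrow> (real \<Rightarrow> 'u) \<Rightarrow> (real \<Rightarrow> 'v) \<Rightarrow> real \<Rightarrow> real^'n" where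
  "trajectory f T t x u v = (THE X. X \<in> extensional {t..T} \<and>
     set_integrable lebesgue {t..T} (\<lambda>r. f (X r) (u r) (v r)) \<and>
     (\<forall>s\<in>{t..T}. X s = x + (LINT r:{t..s}|lebesgue. f (X r) (u r) (v r))))"

section \<open>Probability space\<close>

text \<open>
  The law of a standard two-dimensional Brownian motion on the space of continuous paths
  \<open>[0, T] \<rightarrow> \<real>\<^sup>2\<close> (extensional functions), with the sigma-algebra generated by the coordinates.
  The index type \<open>2\<close> has the two elements \<open>1\<close> and \<open>2\<close>.
\<close>

definition wiener_measure :: "real \<Rightarrow> (real \<Rightarrow> real^2) measure \<Rightarrow> bool" where
  "wiener_measure T W \<longleftrightarrow>
     prob_space W \<and>
     sets W = sets (restrict_space (PiM {0..T} (\<lambda>_. borel)) {B. continuous_on {0..T} B}) \<and>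
     (AE B in W. B 0 = 0) \<and>
     (\<forall>i r s. 0 \<le> r \<and> r < s \<and> s \<le> T \<longrightarrow>
        distributed W lborel (\<lambda>B. B s $ i - B r $ i) (normal_density 0 (sqrt (s - r)))) \<and>
     (\<forall>ts. sorted_wrt (<) ts \<and> set ts \<subseteq> {0..T} \<longrightarrow>
        prob_space.indep_vars W (\<lambda>_. borel)
          (\<lambda>(i, j) B. B (ts ! Suc j) $ i - B (ts ! j) $ i) (UNIV \<times> {j. Suc j < length ts}))"

text \<open>The second component of a sample point carries the two extra uniform variables.\<close>

type_synonym sample = "(real \<Rightarrow> real^2) \<times> (2 \<Rightarrow> real)"

definition enlarged :: "(real \<Rightarrow> real^2) measure \<Rightarrow> sample measure" where
  "enlarged W = W \<Otimes>\<^sub>M PiM UNIV (\<lambda>_. uniform_measure lborel {0..1})"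

text \<open>A partition \<open>0 = t\<^sub>0 < \<dots> < t\<^sub>N = T\<close> is the list of its \<open>N + 1\<close> points.\<close>

definition is_partition :: "real \<Rightarrow> real list \<Rightarrow> bool" where
  "is_partition T \<pi> \<longleftrightarrow> \<pi> \<noteq> [] \<and> hd \<pi> = 0 \<and> last \<pi> = T \<and> sorted_wrt (<) \<pi>"

definition mesh :: "real list \<Rightarrow> real" where
  "mesh \<pi> = Max ((\<lambda>j. \<pi> ! j - \<pi> ! (j - 1)) ` {1..<length \<pi>})"

definition \<zeta> :: "real list \<Rightarrow> 2 \<Rightarrow> nat \<Rightarrow> sample \<Rightarrow> real" where
  "\<zeta> \<pi> i j \<omega> =
     (if j = 0 then snd \<omega> i
      else cdf std_normal_distribution
        ((fst \<omega> (\<pi> ! j) $ i - fst \<omega> (\<pi> ! (j - 1)) $ i) / sqrt (\<pi> ! j - \<pi> ! (j - 1))))"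

section \<open>Strategies\<close>

text \<open>
  Indices of the variables \<open>\<zeta>\<^sub>k\<^sub>-\<^sub>1, \<dots>, \<zeta>\<^sub>l\<^sub>-\<^sub>2\<close> (both components) and \<open>\<zeta>\<^sub>p\<^sub>,\<^sub>l\<^sub>-\<^sub>1\<close> on which the action
  of player \<open>p\<close> on the \<open>l\<close>-th interval may depend.  The space \<open>\<real>\<close> to the power \<open>2 (l - k) + 1\<close> is
  rendered as the product over this index set.
\<close>

definition info :: "2 \<Rightarrow> nat \<Rightarrow> nat \<Rightarrow> (2 \<times> nat) set" where
  "info p k l = UNIV \<times> {k - 1..<l - 1} \<union> {(p, l - 1)}"

text \<open>
  Strategies of player \<open>p\<close> with actions in \<open>'a\<close> against controls with values in \<open>'b\<close>.  For \<open>t < T\<close>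
  there is exactly one \<open>k\<close> with \<open>t \<in> [t\<^sub>k\<^sub>-\<^sub>1, t\<^sub>k)\<close>.  The value at time \<open>T\<close>, which
  the representation by the functions \<open>a l\<close> leaves open, is arbitrary.  For \<open>t = T\<close> no \<open>k\<close> exists and
  there is no constraint (all maps agree up to a.e. equality on \<open>[T, T]\<close>).
\<close>

definition strategies ::
  "2 \<Rightarrow> sample measure \<Rightarrow> real \<Rightarrow> real list \<Rightarrow> real
    \<Rightarrow> (sample \<Rightarrow> (real \<Rightarrow> 'b::metric_space) \<Rightarrow> (real \<Rightarrow> 'a::metric_space)) set" where
  "strategies p M T \<pi> t = {\<alpha>. \<forall>k\<in>{1..<length \<pi>}. t \<in> {\<pi> ! (k - 1)..<\<pi> ! k} \<longrightarrow>
     (\<exists>a. \<forall>l\<in>{k..<length \<pi>}.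
        (\<lambda>(y, s, v). a l y v s) \<in> borel_measurable
          (PiM (info p k l) (\<lambda>_. borel) \<Otimes>\<^sub>M
           restrict_space borel {max t (\<pi> ! (l - 1))..\<pi> ! l} \<Otimes>\<^sub>M control_algebra t T) \<and>
        (\<forall>v\<in>controls t T. \<forall>v'\<in>controls t T.
           (AE s in lebesgue_on {t..\<pi> ! (l - 1)}. v s = v' s) \<longrightarrow>
           (\<forall>y\<in>space (PiM (info p k l) (\<lambda>_. borel)).
              AE s in lebesgue_on {max t (\<pi> ! (l - 1))..\<pi> ! l}. a l y v s = a l y v' s)) \<and>
        (\<forall>\<omega>\<in>space M. \<forall>v\<in>controls t T. \<forall>s\<in>{max t (\<pi> ! (l - 1))..<\<pi> ! l}.
           \<alpha> \<omega> v s = a l (\<lambda>(i, j)\<in>info p k l. \<zeta> \<pi> i j \<omega>) v s))}"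

section \<open>Payoffs and Nash equilibrium payoffs\<close>

text \<open>
  The measurable control pair determined by two strategies; it is unique up to a.e. equality on
  \<open>[t, T]\<close> for every \<open>\<omega>\<close>, and the choice does not affect the payoffs.
\<close>

definition outcome ::
  "sample measure \<Rightarrow> real \<Rightarrow> real
    \<Rightarrow> (sample \<Rightarrow> (real \<Rightarrow> 'v::metric_space) \<Rightarrow> (real \<Rightarrow> 'u::metric_space))
    \<Rightarrow> (sample \<Rightarrow> (real \<Rightarrow> 'u) \<Rightarrow> (real \<Rightarrow> 'v))
    \<Rightarrow> sample \<Rightarrow> (real \<Rightarrow> 'u) \<times> (real \<Rightarrow> 'v)" where
  "outcome M T t \<alpha> \<beta> =
     (SOME uv. uv \<in> measurable M (control_algebra t T \<Otimes>\<^sub>M control_algebra t T) \<and>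
        (\<forall>\<omega>\<in>space M.
           (AE s in lebesgue_on {t..T}. \<alpha> \<omega> (snd (uv \<omega>)) s = fst (uv \<omega>) s) \<and>
           (AE s in lebesgue_on {t..T}. \<beta> \<omega> (fst (uv \<omega>)) s = snd (uv \<omega>) s)))"

definition payoff ::
  "(real^'n \<Rightarrow> 'u::metric_space \<Rightarrow> 'v::metric_space \<Rightarrow> real^'n) \<Rightarrow> (real^'n \<Rightarrow> real)
    \<Rightarrow> sample measure \<Rightarrow> real \<Rightarrow> real \<Rightarrow> real^'n
    \<Rightarrow> (sample \<Rightarrow> (real \<Rightarrow> 'v) \<Rightarrow> (real \<Rightarrow> 'u))
    \<Rightarrow> (sample \<Rightarrow> (real \<Rightarrow> 'u) \<Rightarrow> (real \<Rightarrow> 'v)) \<Rightarrow> real" where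
  "payoff f g M T t x \<alpha> \<beta> =
     (if t = T then g x
      else \<integral>\<omega>. g (trajectory f T t x
             (fst (outcome M T t \<alpha> \<beta> \<omega>)) (snd (outcome M T t \<alpha> \<beta> \<omega>)) T) \<partial>M)"

definition nash_payoff ::
  "(real^'n \<Rightarrow> 'u::metric_space \<Rightarrow> 'v::metric_space \<Rightarrow> real^'n)
    \<Rightarrow> (real^'n \<Rightarrow> real) \<Rightarrow> (real^'n \<Rightarrow> real)
    \<Rightarrow> sample measure \<Rightarrow> real \<Rightarrow> real \<Rightarrow> real^'n \<Rightarrow> real \<times> real \<Rightarrow> bool" where
  "nash_payoff f g\<^sub>1 g\<^sub>2 M T t x e \<longleftrightarrow>
     (\<forall>\<epsilon>>0. \<exists>\<delta>>0. \<forall>\<pi>. is_partition T \<pi> \<and> mesh \<pi> \<le> \<delta> \<longrightarrow>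
        (\<exists>\<alpha>\<^sub>\<epsilon> \<in> strategies 1 M T \<pi> t. \<exists>\<beta>\<^sub>\<epsilon> \<in> strategies 2 M T \<pi> t.
           (\<forall>\<alpha> \<in> strategies 1 M T \<pi> t. \<forall>\<beta> \<in> strategies 2 M T \<pi> t.
              payoff f g\<^sub>1 M T t x \<alpha>\<^sub>\<epsilon> \<beta>\<^sub>\<epsilon> \<ge> payoff f g\<^sub>1 M T t x \<alpha> \<beta>\<^sub>\<epsilon> - \<epsilon> \<and>
              payoff f g\<^sub>2 M T t x \<alpha>\<^sub>\<epsilon> \<beta>\<^sub>\<epsilon> \<ge> payoff f g\<^sub>2 M T t x \<alpha>\<^sub>\<epsilon> \<beta> - \<epsilon>) \<and>
           \<bar>payoff f g\<^sub>1 M T t x \<alpha>\<^sub>\<epsilon> \<beta>\<^sub>\<epsilon> - fst e\<bar> \<le> \<epsilon> \<and>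
           \<bar>payoff f g\<^sub>2 M T t x \<alpha>\<^sub>\<epsilon> \<beta>\<^sub>\<epsilon> - snd e\<bar> \<le> \<epsilon>))"

end

theory Submission imports Defs begin

text \<open>
  The equilibrium consists of a plan and of mutual threats. Fix a time step \<open>h\<close>. The
  plan is a deterministic pair of controls. Each player follows it as long as the other one does;
  when a deviation has been noticed at a multiple of \<open>h\<close>, the remaining player holds
  down the payoff of the deviator until the end. Up to its detection a deviation moves the state
  at most by order \<open>h\<close>. Therefore such strategies are in equilibrium up to a small
  error as soon as, at each step, the final payoff of the plan for either player is at least what
  this player can be held down to from the current position.

  Without the Isaacs condition, what a player can be held down to is the value of a game with
  relaxed (mixed) actions. Its discrete version \<open>guide_value\<close> is a supremum over
  relaxed actions of the player and then an infimum over answers of the punisher. Two properties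
  suffice. Every relaxed action has an answer under which the value does not increase
  (\<open>guide_value_stable\<close>), and some relaxed action ensures against all answers that it
  does not decrease (\<open>guide_value_secure\<close>), up to errors of order
  \<open>h\<^sup>2\<close> per step. The plan lets both players use actions of the second kind
  with respect to their own payoffs; then both guide values are nondecreasing along the plan and
  hence bounded by its final payoffs (\<open>plan_exists\<close>). Rapid alternation between pure
  actions realizes the relaxed actions of the plan deterministically
  (\<open>plan_trajectory\<close>).

  The deviator does not announce a relaxed action to which the punisher could respond, so the
  punishment uses a guide in the sense of Krasovskii and Subbotin, a fictitious position
  \<open>b\<close> that accompanies an estimate \<open>a\<close> of the true position. An
  approximate saddle point of \<open>(a - b) \<bullet> f a u v\<close> in relaxed actions
  (\<open>approximate_saddle\<close>) consists of an action of the punisher and one of the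
  deviator. The guide moves as if the latter were played and answered so that the guide value does
  not increase, while the punisher draws an action from the former independently on each partition
  interval. The strategy of the deviator on an interval cannot depend on the signal drawn there,
  so the saddle property makes the expected squared distance between \<open>a\<close> and
  \<open>b\<close> grow only through terms that Gronwall's inequality controls
  (\<open>independent_stage\<close>, \<open>expected_gap_step\<close>). This expectation is of
  order \<open>h\<close>, so the expected payoff of the deviator exceeds the one of the plan at
  most by order \<open>sqrt h\<close> (\<open>punishment_payoff\<close>).

  These estimates are uniform over all partitions of mesh at most \<open>h\<^sup>2\<close>,
  whereas the plan depends only on \<open>h\<close>. Hence every cluster point, as
  \<open>h\<close> tends to 0, of the pairs of payoffs of the plans is a Nash equilibrium payoff.

  To evaluate payoffs, the outcome of two strategies is constructed interval by interval as a
  function of the signals (\<open>play\<close>); it is unique up to null sets, and the signals are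
  independent and uniform, so that payoffs are integrals over a product space
  (\<open>payoff_eq\<close>). Measurability of strategies that react to controls rests on two
  facts about the algebra of controls: jointly measurable functions of parameter and time are
  measurable maps into it (\<open>measurable_into_control_algebra\<close>), and integral
  functionals are measurable on it (\<open>measurable_control_integral\<close>).
\<close>

section \<open>Measurable functions with values in separable metric spaces\<close>

text \<open>
  The control spaces are compact metric spaces that need not belong to the type class of second
  countable spaces, so the separability used in measurability proofs is carried by an explicit
  sequence.
\<close>
definition dense_seq :: "(nat \<Rightarrow> 'a::metric_space) \<Rightarrow> bool" where
  "dense_seq d \<longleftrightarrow> (\<forall>x. \<forall>e>0. \<exists>k. dist x (d k) < e)"

definition near :: "(nat \<Rightarrow> 'a::metric_space) \<Rightarrow> real \<Rightarrow> 'a \<Rightarrow> nat" where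
  "near d e x = (LEAST k. dist x (d k) < e)"

lemma dist_near: "dense_seq d \<Longrightarrow> e > 0 \<Longrightarrow> dist x (d (near d e x)) < e"
  unfolding near_def dense_seq_def by (rule LeastI_ex) auto

lemma measurable_near[measurable]: "near d e \<in> measurable borel (count_space UNIV)"
  unfolding near_def
proof (rule measurable_Least)
  fix i
  have "{x. dist x (d i) < e} \<in> sets borel"
    by (intro borel_open open_Collect_less continuous_intros)
  then show "Measurable.pred borel (\<lambda>x. dist x (d i) < e)"
    by (simp add: pred_def)
qed

lemma compact_dense_seq:
  assumes "compact (UNIV :: 'a::metric_space set)"
  shows "\<exists>d :: nat \<Rightarrow> 'a. dense_seq d"
proof -
  have "\<exists>K. finite K \<and> (UNIV :: 'a set) \<subseteq> (\<Union>x\<in>K. ball x (1 / real (Suc n)))" for n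
    using seq_compact_imp_totally_bounded[of "UNIV :: 'a set"] assms
    by (metis compact_imp_seq_compact of_nat_0_less_iff zero_less_Suc zero_less_divide_1_iff)
  then obtain K :: "nat \<Rightarrow> 'a set" where K: "\<And>n. finite (K n)" "\<And>n. UNIV \<subseteq> (\<Union>x\<in>K n. ball x (1 / real (Suc n)))"
    by metis
  have ne: "(\<Union>n. K n) \<noteq> {}" using K(2)[of 0] by blast
  have "dense_seq (from_nat_into (\<Union>n. K n))"
    unfolding dense_seq_def
  proof (intro allI impI)
    fix x :: 'a and e :: real assume "e > 0"
    then obtain n where n: "1 / real (Suc n) < e" using nat_approx_posE by blast
    have "x \<in> (\<Union>x\<in>K n. ball x (1 / real (Suc n)))" using K(2)[of n] by blast
    then obtain y where "y \<in> K n" "dist y x < 1 / real (Suc n)" by (auto simp del: of_nat_Suc)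
    moreover obtain k where "from_nat_into (\<Union>n. K n) k = y"
      using from_nat_into_surj[of "\<Union>n. K n" y] \<open>y \<in> K n\<close> K(1) by (auto simp: countable_finite)
    ultimately show "\<exists>k. dist x (from_nat_into (\<Union>n. K n) k) < e"
      using n by (intro exI[of _ k]) (simp add: dist_commute)
  qed
  then show ?thesis by blast
qed

lemma second_countable_dense_seq:
  "\<exists>d :: nat \<Rightarrow> 'a::{metric_space, second_countable_topology}. dense_seq d"
proof -
  obtain D :: "'a set" where D: "countable D" "\<And>X. open X \<Longrightarrow> X \<noteq> {} \<Longrightarrow> \<exists>d\<in>D. d \<in> X"
    using countable_dense_exists by blast
  have ne: "D \<noteq> {}" using D(2)[of UNIV] by auto
  have "dense_seq (from_nat_into D)"
    unfolding dense_seq_def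
  proof (intro allI impI)
    fix x :: 'a and e :: real assume "e > 0"
    then obtain y where "y \<in> D" "dist x y < e" using D(2)[of "ball x e"] by auto
    then show "\<exists>k. dist x (from_nat_into D k) < e"
      using from_nat_into_surj[OF D(1)] by metis
  qed
  then show ?thesis by blast
qed

text \<open>
  Replacing \<open>w r\<close> by a nearest point of a dense sequence makes it countably valued,
  which reduces the claim to the measurability of the sections; continuity passes to the limit.
\<close>
lemma measurable_caratheodory:
  fixes \<phi> :: "'b \<Rightarrow> 'a::metric_space \<Rightarrow> 'c::metric_space"
  assumes d: "dense_seq (d :: nat \<Rightarrow> 'a)"
    and w: "w \<in> borel_measurable M"
    and meas: "\<And>c. (\<lambda>r. \<phi> r c) \<in> borel_measurable M"
    and cont: "\<And>r. r \<in> space M \<Longrightarrow> continuous_on UNIV (\<phi> r)"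
  shows "(\<lambda>r. \<phi> r (w r)) \<in> borel_measurable M"
proof (rule borel_measurable_LIMSEQ_metric)
  fix n :: nat
  have "(\<lambda>r. near d (1 / real (Suc n)) (w r)) \<in> measurable M (count_space UNIV)"
    using w by measurable
  from measurable_compose_countable[OF meas this]
  show "(\<lambda>r. \<phi> r (d (near d (1 / real (Suc n)) (w r)))) \<in> borel_measurable M" .
next
  fix r assume "r \<in> space M"
  have "(\<lambda>n. d (near d (1 / real (Suc n)) (w r))) \<longlonglongrightarrow> w r"
  proof (rule metric_LIMSEQ_I)
    fix e :: real assume "e > 0"
    then obtain N where N: "1 / real (Suc N) < e" using nat_approx_posE by blast
    have "dist (d (near d (1 / real (Suc n)) (w r))) (w r) < e" if "n \<ge> N" for n
    proof -
      have "dist (w r) (d (near d (1 / real (Suc n)) (w r))) < 1 / real (Suc n)" by (rule dist_near[OF d]) simp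
      also have "\<dots> \<le> 1 / real (Suc N)" using that by (simp add: frac_le)
      finally show ?thesis using N by (simp add: dist_commute)
    qed
    then show "\<exists>N. \<forall>n\<ge>N. dist (d (near d (1 / real (Suc n)) (w r))) (w r) < e" by blast
  qed
  then show "(\<lambda>n. \<phi> r (d (near d (1 / real (Suc n)) (w r)))) \<longlonglongrightarrow> \<phi> r (w r)"
    by (rule continuous_on_tendsto_compose[OF cont[OF \<open>r \<in> space M\<close>]]) auto
qed

text \<open>
  Without second countability of the type, the product of two copies of its Borel algebra is not
  known to contain the open sets of the product; the Caratheodory argument avoids the product.
\<close>
lemma measurable_dist_dense:
  fixes v w :: "'b \<Rightarrow> 'a::metric_space"
  assumes d: "dense_seq (d :: nat \<Rightarrow> 'a)"
    and "v \<in> borel_measurable M" "w \<in> borel_measurable M"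
  shows "(\<lambda>r. dist (v r) (w r)) \<in> borel_measurable M"
proof (rule measurable_caratheodory[OF d assms(3)])
  show "(\<lambda>r. dist (v r) c) \<in> borel_measurable M" for c
    by (rule borel_measurable_continuous_on[OF _ assms(2)]) (intro continuous_intros)
qed (intro continuous_intros)

section \<open>Measurability with respect to the algebra of controls\<close>
text \<open>
  A countable family of sets that approximates every bounded Lebesgue set in measure. It is what
  makes the controls separable in the sense of convergence in measure.
\<close>
definition open_unions :: "real set set" where
  "open_unions = \<Union> ` {F. finite F \<and> F \<subseteq> (SOME B. countable B \<and> topological_basis B)}"

lemma countable_open_unions: "countable open_unions"
  and open_open_unions: "K \<in> open_unions \<Longrightarrow> open K"
  and approx_open_unions: "S \<in> sets lebesgue \<Longrightarrow> bounded S \<Longrightarrow> e > 0 \<Longrightarrow>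
    \<exists>K\<in>open_unions. \<exists>N\<in>lmeasurable. measure lebesgue N < e \<and> (K - S) \<union> (S - K) \<subseteq> N"
proof -
  define B :: "real set set" where "B = (SOME B. countable B \<and> topological_basis B)"
  have "countable B \<and> topological_basis B"
    unfolding B_def by (rule someI_ex) (rule ex_countable_basis)
  then have B: "countable B" "topological_basis B" by auto
  have eq: "open_unions = \<Union> ` {F. finite F \<and> F \<subseteq> B}"
    by (simp add: open_unions_def B_def)
  show "countable open_unions"
    unfolding eq using countable_Collect_finite_subset[OF B(1)] by (intro countable_image)
  show "open K" if K: "K \<in> open_unions"
  proof -
    obtain F where F: "K = \<Union>F" "F \<subseteq> B" using K unfolding eq by blast
    have "open b" if "b \<in> F" for b
      using F(2) that by (intro topological_basis_open[OF B(2)]) (rule subsetD)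
    then show ?thesis unfolding F(1) by (intro open_Union ballI)
  qed
  assume S: "S \<in> sets lebesgue" "bounded S" and e: "e > 0"
  \<comment> \<open>Squeeze S between a compact and an open set; a finite union of basic sets that lies between the
    two then differs from S only on their difference.\<close>
  obtain U where U: "open U" "S \<subseteq> U" "U - S \<in> lmeasurable" "emeasure lebesgue (U - S) < ennreal (e/2)"
    using sets_lebesgue_outer_open[OF S(1), of "e/2"] e by auto
  obtain C where C: "closed C" "C \<subseteq> S" "S - C \<in> lmeasurable" "emeasure lebesgue (S - C) < ennreal (e/2)"
    using sets_lebesgue_inner_closed[OF S(1), of "e/2"] e by auto
  have "compact C" using C S(2) by (meson bounded_subset compact_eq_bounded_closed)
  have "\<exists>B'\<subseteq>B. \<Union>B' = U" using B(2) U(1) by (simp add: topological_basis_def)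
  then obtain B' where B': "B' \<subseteq> B" "\<Union>B' = U" by blast
  have "C \<subseteq> \<Union>B'" using B' U C by blast
  moreover have "open b" if "b \<in> B'" for b
    using topological_basis_open[OF B(2)] B'(1) that by blast
  ultimately obtain F where F: "F \<subseteq> B'" "finite F" "C \<subseteq> \<Union>F"
    by (rule compactE[OF \<open>compact C\<close>])
  let ?N = "(U - S) \<union> (S - C)"
  have N: "?N \<in> lmeasurable" using U C by (intro fmeasurable.Un)
  have "measure lebesgue ?N \<le> measure lebesgue (U - S) + measure lebesgue (S - C)"
    using U C by (intro measure_Un_le) auto
  also have "\<dots> < e/2 + e/2"
  proof (rule add_strict_mono)
    show "measure lebesgue (U - S) < e / 2" "measure lebesgue (S - C) < e / 2"
      using U(4) C(4)
      unfolding emeasure_eq_ennreal_measure[OF fmeasurableD2[OF U(3)]] emeasure_eq_ennreal_measure[OF fmeasurableD2[OF C(3)]]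
      by (simp_all add: ennreal_less_iff)
  qed
  finally have "measure lebesgue ?N < e" by simp
  moreover have "(\<Union>F - S) \<union> (S - \<Union>F) \<subseteq> ?N" using F B' by blast
  moreover have "\<Union>F \<in> open_unions" using F B' unfolding eq by blast
  ultimately show "\<exists>K\<in>open_unions. \<exists>N\<in>lmeasurable. measure lebesgue N < e \<and> (K - S) \<union> (S - K) \<subseteq> N"
    using N by blast
qed

text \<open>
  The first set of the list that contains the time \<open>s\<close>; beyond the list the condition
  is void, so that the index never exceeds the length. Together with a dense sequence, a list of
  basic open sets hence encodes a step function, and there are only countably many such codes.
\<close>
definition step_index :: "real set list \<Rightarrow> real \<Rightarrow> nat" where
  "step_index Ks s = (LEAST k. k < length Ks \<longrightarrow> s \<in> Ks ! k)"

lemma measurable_step_index: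
  assumes "Ks \<in> lists open_unions"
  shows "step_index Ks \<in> measurable borel (count_space UNIV)"
  unfolding step_index_def
proof (rule measurable_Least)
  fix k
  have "{s. k < length Ks \<longrightarrow> s \<in> Ks ! k} \<in> sets borel"
  proof (cases "k < length Ks")
    case True
    then have "Ks ! k \<in> open_unions" using assms nth_mem[OF True] unfolding in_lists_conv_set by blast
    then have "open (Ks ! k)" by (rule open_open_unions)
    then show ?thesis using True by simp
  qed simp
  then show "Measurable.pred borel (\<lambda>s. k < length Ks \<longrightarrow> s \<in> Ks ! k)"
    unfolding pred_def space_borel by (simp only: UNIV_I simp_thms)
qed

text \<open>
  By compactness finitely many points of the dense sequence suffice to approximate
  \<open>w\<close> uniformly, and the level sets of this approximation are replaced by sets of the
  countable family.
\<close>
lemma approx_by_steps: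
  fixes w :: "real \<Rightarrow> 'a::metric_space"
  assumes d: "dense_seq d" and comp: "compact (UNIV :: 'a set)"
    and w: "w \<in> controls t T" and e: "e > 0"
  shows "\<exists>Ks\<in>lists open_unions. \<exists>N\<in>lmeasurable. measure lebesgue N < e \<and>
    {s\<in>{t..T}. \<not> dist (w s) (d (step_index Ks s)) < e} \<subseteq> N"
proof -
  have "UNIV \<subseteq> (\<Union>k. ball (d k) e)"
    using d e by (auto simp: dense_seq_def dist_commute)
  then obtain A where A: "finite A" "UNIV \<subseteq> (\<Union>k\<in>A. ball (d k) e)"
    using compactE_image[OF comp, of UNIV "\<lambda>k. ball (d k) e"] by auto
  obtain p where p: "\<And>k. k \<in> A \<Longrightarrow> k < p" using finite_nat_bounded[OF A(1)] by blast
  have idx: "near d e x < p" for x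
  proof -
    obtain k where "k \<in> A" "x \<in> ball (d k) e" using A(2) by blast
    then have "near d e x \<le> k" unfolding near_def by (intro Least_le) (simp add: dist_commute)
    then show ?thesis using p[OF \<open>k \<in> A\<close>] by simp
  qed
  define S where "S k = {s\<in>{t..T}. near d e (w s) = k}" for k
  have S: "S k \<in> sets lebesgue" "bounded (S k)" for k
  proof -
    have "(\<lambda>s. near d e (w s)) \<in> measurable (lebesgue_on {t..T}) (count_space UNIV)"
      using w unfolding controls_def by (rule measurable_compose) measurable
    then have "(\<lambda>s. near d e (w s)) -` {k} \<inter> space (lebesgue_on {t..T}) \<in> sets (lebesgue_on {t..T})"
      by (rule measurable_sets) simp
    moreover have "(\<lambda>s. near d e (w s)) -` {k} \<inter> space (lebesgue_on {t..T}) = S k"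
      by (auto simp: S_def)
    ultimately show "S k \<in> sets lebesgue" by (simp add: sets_restrict_space_iff)
    show "bounded (S k)" by (rule bounded_subset[of "{t..T}"]) (auto simp: S_def)
  qed
  \<comment> \<open>An error below e / (p + 1) for each of the p level sets adds up to less than e.\<close>
  have "\<forall>k. \<exists>KN. fst KN \<in> open_unions \<and> snd KN \<in> lmeasurable \<and>
      measure lebesgue (snd KN) < e / real (Suc p) \<and> (fst KN - S k) \<union> (S k - fst KN) \<subseteq> snd KN"
  proof
    fix k
    have "e / real (Suc p) > 0" using e by simp
    from approx_open_unions[OF S(1)[of k] S(2)[of k] this] obtain K N where
      "K \<in> open_unions" "N \<in> lmeasurable" "measure lebesgue N < e / real (Suc p)" "(K - S k) \<union> (S k - K) \<subseteq> N"
      by blast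
    then show "\<exists>KN. fst KN \<in> open_unions \<and> snd KN \<in> lmeasurable \<and>
      measure lebesgue (snd KN) < e / real (Suc p) \<and> (fst KN - S k) \<union> (S k - fst KN) \<subseteq> snd KN"
      by (intro exI[of _ "(K, N)"]) simp
  qed
  then obtain KN where KN: "\<forall>k. fst (KN k) \<in> open_unions \<and> snd (KN k) \<in> lmeasurable \<and>
      measure lebesgue (snd (KN k)) < e / real (Suc p) \<and> (fst (KN k) - S k) \<union> (S k - fst (KN k)) \<subseteq> snd (KN k)"
    by (rule choice[THEN exE])
  define K N where "K k = fst (KN k)" and "N k = snd (KN k)" for k
  have K: "\<And>k. K k \<in> open_unions" and N: "\<And>k. N k \<in> lmeasurable"
    "\<And>k. measure lebesgue (N k) < e / real (Suc p)" "\<And>k. (K k - S k) \<union> (S k - K k) \<subseteq> N k"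
    using KN unfolding K_def N_def by blast+
  let ?Ks = "map K [0..<p]" and ?N = "\<Union>k<p. N k"
  have "measure lebesgue ?N \<le> (\<Sum>k<p. measure lebesgue (N k))"
    using N(1) by (intro measure_UNION_le) auto
  also have "\<dots> \<le> (\<Sum>k<p. e / real (Suc p))"
    by (intro sum_mono less_imp_le N(2))
  also have "\<dots> < e" using e by (simp add: field_simps)
  finally have mN: "measure lebesgue ?N < e" .
  have "{s\<in>{t..T}. \<not> dist (w s) (d (step_index ?Ks s)) < e} \<subseteq> ?N"
  proof safe
    fix s assume s: "s \<in> {t..T}" "\<not> dist (w s) (d (step_index ?Ks s)) < e"
    show "s \<in> ?N"
    proof (rule ccontr)
      assume "s \<notin> ?N"
      then have iff: "s \<in> K k \<longleftrightarrow> near d e (w s) = k" if "k < p" for k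
        using N(3)[of k] that s(1) by (auto simp: S_def)
      have "step_index ?Ks s = near d e (w s)"
        unfolding step_index_def
      proof (rule Least_equality)
        fix k assume "k < length ?Ks \<longrightarrow> s \<in> ?Ks ! k"
        then show "near d e (w s) \<le> k" using iff[of k] idx[of "w s"] by (cases "k < p") auto
      qed (use iff idx[of "w s"] in auto)
      then show False using s(2) dist_near[OF d e] by simp
    qed
  qed
  moreover have "?N \<in> lmeasurable" using N(1) by (intro fmeasurable.finite_UN) auto
  moreover have "?Ks \<in> lists open_unions" using K by auto
  ultimately show ?thesis using mN by blast
qed

lemma set_integrable_bounded:
  fixes f :: "real \<Rightarrow> 'b::euclidean_space"
  assumes f: "f \<in> borel_measurable (lebesgue_on {t..T})"
    and K: "\<And>s. s \<in> {t..T} \<Longrightarrow> norm (f s) \<le> K" and ab: "{a..b} \<subseteq> {t..T}"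
  shows "set_integrable lebesgue {a..b} f"
proof -
  have "f \<in> borel_measurable (lebesgue_on {a..b})"
    using f ab by (rule measurable_restrict_mono)
  then have m: "(\<lambda>s. indicator {a..b} s *\<^sub>R f s) \<in> borel_measurable lebesgue"
    by (subst (asm) borel_measurable_restrict_space_iff) auto
  show ?thesis
    unfolding set_integrable_def
  proof (rule Bochner_Integration.integrable_bound[OF _ m])
    show "integrable lebesgue (\<lambda>s. K * indicator {a..b} s)"
      by (intro integrable_mult_right integrable_real_indicator) (auto simp: emeasure_lborel_Icc_eq)
    have "norm (indicator {a..b} s *\<^sub>R f s) \<le> norm (K * indicator {a..b} s)" for s
      using K[of s] ab by (cases "s \<in> {a..b}") (auto intro: order_trans)
    then show "AE s in lebesgue. norm (indicator {a..b} s *\<^sub>R f s) \<le> norm (K * indicator {a..b} s)"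
      by simp
  qed
qed

lemma set_integral_const: "a \<le> b \<Longrightarrow> (LINT s:{a..b}|lebesgue. (c::'b::euclidean_space)) = (b - a) *\<^sub>R c"
  by (simp add: set_lebesgue_integral_def)

lemma norm_set_integral_le:
  fixes f :: "real \<Rightarrow> 'b::euclidean_space"
  assumes "a \<le> b" and K: "\<And>s. s \<in> {a..b} \<Longrightarrow> norm (f s) \<le> K"
  shows "norm (LINT s:{a..b}|lebesgue. f s) \<le> (b - a) * K"
proof -
  have K0: "0 \<le> K" using K[of a] assms(1) norm_ge_zero[of "f a"] by (auto intro: order_trans simp del: norm_ge_zero)
  have "norm (LINT s:{a..b}|lebesgue. f s) \<le> (LINT s:{a..b}|lebesgue. K)"
  proof (cases "set_integrable lebesgue {a..b} f")
    case True
    show ?thesis unfolding set_lebesgue_integral_def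
    proof (rule Bochner_Integration.integral_norm_bound_integral)
      show "integrable lebesgue (\<lambda>x. indicator {a..b} x *\<^sub>R K)"
        by (intro integrable_scaleR_left integrable_real_indicator) (auto simp: emeasure_lborel_Icc_eq)
    qed (use K True in \<open>auto simp: indicator_def set_integrable_def\<close>)
  next
    case False
    then have "(LINT s:{a..b}|lebesgue. f s) = 0"
      by (simp add: set_lebesgue_integral_def set_integrable_def not_integrable_integral_eq)
    then show ?thesis using K0 assms(1) set_integral_const[OF assms(1), of K] by simp
  qed
  then show ?thesis using assms(1) by (simp add: set_integral_const)
qed

lemma id_measurable_lebesgue_on: "(\<lambda>s. s) \<in> measurable (lebesgue_on S) (restrict_space borel S)"
  by (rule measurable_restrict_space3) (auto intro: measurable_completion)

text \<open>
  The preimage of a closed set \<open>C\<close> of controls has to be measurable although only a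
  joint measurability in \<open>(\<omega>, s)\<close> is known. A control belongs to
  \<open>C\<close> iff, for every accuracy, some step function with a code from the countable
  family is close in measure both to the control and to an element of \<open>C\<close>. For a
  fixed step function, closeness in measure to \<open>\<phi> \<omega>\<close> is a measurable
  condition on \<open>\<omega>\<close>, by Fubini.
\<close>
lemma measurable_into_control_algebra:
  fixes \<phi> :: "'w \<Rightarrow> real \<Rightarrow> 'a::metric_space"
  assumes comp: "compact (UNIV :: 'a set)"
    and \<phi>: "(\<lambda>(\<omega>, s). \<phi> \<omega> s) \<in> borel_measurable (M \<Otimes>\<^sub>M restrict_space borel {t..T})"
  shows "\<phi> \<in> measurable M (control_algebra t T)"
proof -
  obtain d :: "nat \<Rightarrow> 'a" where d: "dense_seq d" using compact_dense_seq[OF comp] by blast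
  have ctrl: "\<phi> \<omega> \<in> controls t T" if "\<omega> \<in> space M" for \<omega>
  proof -
    have "(\<lambda>s. (\<lambda>(\<omega>, s). \<phi> \<omega> s) (\<omega>, s)) \<in> borel_measurable (restrict_space borel {t..T})"
      using \<phi> that by (intro measurable_compose[OF measurable_Pair1' \<phi>])
    from measurable_compose[OF id_measurable_lebesgue_on this]
    show ?thesis by (simp add: controls_def)
  qed
  let ?N = "restrict_space lborel {t..T}"
  interpret N: finite_measure ?N
    by (rule finite_measureI) (simp add: emeasure_restrict_space emeasure_lborel_Icc_eq)
  have sN: "sets ?N = sets (restrict_space borel {t..T})" by (simp add: sets_restrict_space)
  define A where "A m K \<omega> = {s\<in>{t..T}. \<not> dist (\<phi> \<omega> s) (d (step_index K s)) < 1 / real (Suc m)}" for m K \<omega>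
  have A: "A m K \<omega> \<in> lmeasurable" "{\<omega>\<in>space M. measure lebesgue (A m K \<omega>) < c} \<in> sets M"
    if K: "K \<in> lists open_unions" and \<omega>: "\<omega> \<in> space M" for m K \<omega> c
  proof -
    have idx: "(\<lambda>z. step_index K (snd z)) \<in> measurable (M \<Otimes>\<^sub>M ?N) (count_space UNIV)"
      by (rule measurable_compose[OF _ measurable_step_index[OF K]])
        (rule measurable_compose[OF measurable_snd], rule measurable_restrict_space1, simp)
    have \<phi>': "(\<lambda>z. \<phi> (fst z) (snd z)) \<in> borel_measurable (M \<Otimes>\<^sub>M ?N)"
      using \<phi> unfolding measurable_cong_sets[OF sets_pair_measure_cong[OF refl sN] refl]
      by (simp add: case_prod_unfold)
    have "(\<lambda>z. dist (\<phi> (fst z) (snd z)) (d (step_index K (snd z)))) \<in> borel_measurable (M \<Otimes>\<^sub>M ?N)"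
      by (rule measurable_dist_dense[OF d \<phi>']) (rule measurable_compose[OF idx], simp)
    then have Q: "{z \<in> space (M \<Otimes>\<^sub>M ?N). 1 / real (Suc m) \<le> dist (\<phi> (fst z) (snd z)) (d (step_index K (snd z)))}
        \<in> sets (M \<Otimes>\<^sub>M ?N)" (is "?Q \<in> _")
      by (rule borel_measurable_le[OF borel_measurable_const])
    have eq: "Pair \<omega> -` ?Q = A m K \<omega>" if "\<omega> \<in> space M" for \<omega>
      using that by (auto simp: A_def space_pair_measure not_less)
    have s: "A m K \<omega> \<in> sets ?N" if "\<omega> \<in> space M" for \<omega>
      using sets_Pair1[OF Q, of \<omega>] eq[OF that] by simp
    have s2: "A m K \<omega> \<in> sets lborel" if "\<omega> \<in> space M" for \<omega>
      using s[OF that] by (subst (asm) sets_restrict_space_iff) auto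
    have lm: "A m K \<omega> \<in> lmeasurable" if "\<omega> \<in> space M" for \<omega>
    proof (rule bounded_set_imp_lmeasurable)
      show "bounded (A m K \<omega>)" by (rule bounded_subset[OF bounded_closed_interval]) (auto simp: A_def)
      show "A m K \<omega> \<in> sets lebesgue" using s2[OF that] by (rule sets_completionI_sets)
    qed
    show "A m K \<omega> \<in> lmeasurable" using lm \<omega> .
    have em: "emeasure ?N (A m K \<omega>) = ennreal (measure lebesgue (A m K \<omega>))" if "\<omega> \<in> space M" for \<omega>
    proof -
      have "emeasure ?N (A m K \<omega>) = emeasure lborel (A m K \<omega>)"
        by (rule emeasure_restrict_space) (auto simp: A_def)
      also have "\<dots> = emeasure lebesgue (A m K \<omega>)" using s2[OF that] by simp
      also have "\<dots> = ennreal (measure lebesgue (A m K \<omega>))"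
        by (rule emeasure_eq_ennreal_measure[OF fmeasurableD2[OF lm[OF that]]])
      finally show ?thesis .
    qed
    have "(\<lambda>\<omega>. emeasure ?N (Pair \<omega> -` ?Q)) \<in> borel_measurable M"
      by (rule N.measurable_emeasure_Pair[OF Q])
    then have "(\<lambda>\<omega>. enn2real (emeasure ?N (Pair \<omega> -` ?Q))) \<in> borel_measurable M"
      by simp
    also have "?this \<longleftrightarrow> (\<lambda>\<omega>. measure lebesgue (A m K \<omega>)) \<in> borel_measurable M"
      by (intro measurable_cong) (simp only: eq em enn2real_ennreal[OF measure_nonneg])
    finally show "{\<omega>\<in>space M. measure lebesgue (A m K \<omega>) < c} \<in> sets M"
      by (rule borel_measurable_less) simp
  qed
  show ?thesis
  proof (rule measurable_sigma_sets[OF sets_control_algebra])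
    show "Collect (closed_control_set t T) \<subseteq> Pow (controls t T :: (real \<Rightarrow> 'a) set)"
      by (auto simp: closed_control_set_def)
    show "\<phi> \<in> space M \<rightarrow> controls t T" using ctrl by auto
    fix C :: "(real \<Rightarrow> 'a) set" assume "C \<in> Collect (closed_control_set t T)"
    then have C: "C \<subseteq> controls t T"
      "\<And>w v. (\<forall>n. w n \<in> C) \<Longrightarrow> v \<in> controls t T \<Longrightarrow> tendsto_in_measure t T w v \<Longrightarrow> v \<in> C"
      by (auto simp: closed_control_set_def)
    \<comment> \<open>The codes of the step functions that are close in measure to some element of C.\<close>
    define good where "good m = {K \<in> lists open_unions. \<exists>w\<in>C. \<exists>N\<in>lmeasurable. measure lebesgue N < 1 / real (Suc m) \<and>
        {s\<in>{t..T}. \<not> dist (w s) (d (step_index K s)) < 1 / real (Suc m)} \<subseteq> N}" for m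
    have cg: "countable (good m)" for m
      by (rule countable_subset[OF _ countable_lists[OF countable_open_unions]]) (auto simp: good_def)
    have eq: "\<phi> -` C \<inter> space M = (\<Inter>m. \<Union>K\<in>good m. {\<omega>\<in>space M. measure lebesgue (A m K \<omega>) < 1 / real (Suc m)})"
    proof (intro set_eqI iffI)
      fix \<omega> assume \<omega>: "\<omega> \<in> \<phi> -` C \<inter> space M"
      show "\<omega> \<in> (\<Inter>m. \<Union>K\<in>good m. {\<omega>\<in>space M. measure lebesgue (A m K \<omega>) < 1 / real (Suc m)})"
      proof (rule INT_I)
        fix m
        obtain K N where K: "K \<in> lists open_unions" "N \<in> lmeasurable" "measure lebesgue N < 1 / real (Suc m)"
          "{s\<in>{t..T}. \<not> dist (\<phi> \<omega> s) (d (step_index K s)) < 1 / real (Suc m)} \<subseteq> N"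
          using approx_by_steps[OF d comp ctrl[of \<omega>], of "1 / real (Suc m)"] \<omega> by auto
        have "K \<in> good m" unfolding good_def using K \<omega> by blast
        moreover have "measure lebesgue (A m K \<omega>) \<le> measure lebesgue N"
          using K(4) A(1)[OF K(1)] \<omega> K(2) by (intro measure_mono_fmeasurable) (auto simp: A_def)
        ultimately show "\<omega> \<in> (\<Union>K\<in>good m. {\<omega>\<in>space M. measure lebesgue (A m K \<omega>) < 1 / real (Suc m)})"
          using K(3) \<omega> by (intro UN_I[of K]) simp_all
      qed
    next
      fix \<omega> assume \<omega>: "\<omega> \<in> (\<Inter>m. \<Union>K\<in>good m. {\<omega>\<in>space M. measure lebesgue (A m K \<omega>) < 1 / real (Suc m)})"
      then have \<omega>M: "\<omega> \<in> space M" by blast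
      \<comment> \<open>An element of C and the control itself are both close to one step function, hence to each other.\<close>
      have "\<exists>w. w \<in> C \<and> (\<exists>N\<in>lmeasurable. measure lebesgue N < 2 / real (Suc m) \<and>
        {s\<in>{t..T}. dist (w s) (\<phi> \<omega> s) > 2 / real (Suc m)} \<subseteq> N)" for m
      proof -
        obtain K where K: "K \<in> good m" "measure lebesgue (A m K \<omega>) < 1 / real (Suc m)"
          using \<omega> by blast
        then obtain w N where wN: "w \<in> C" "N \<in> lmeasurable" "measure lebesgue N < 1 / real (Suc m)"
          "{s\<in>{t..T}. \<not> dist (w s) (d (step_index K s)) < 1 / real (Suc m)} \<subseteq> N"
          and KL: "K \<in> lists open_unions"
          unfolding good_def by blast
        note Am = A(1)[OF KL \<omega>M, of m]
        have "measure lebesgue (N \<union> A m K \<omega>) \<le> measure lebesgue N + measure lebesgue (A m K \<omega>)"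
          using wN(2) Am by (intro measure_Un_le) auto
        also have "\<dots> < 2 / real (Suc m)" using wN(3) K(2) by simp
        finally have "measure lebesgue (N \<union> A m K \<omega>) < 2 / real (Suc m)" .
        moreover have "{s\<in>{t..T}. dist (w s) (\<phi> \<omega> s) > 2 / real (Suc m)} \<subseteq> N \<union> A m K \<omega>"
        proof (safe, rule ccontr)
          fix s assume s: "s \<in> {t..T}" "dist (w s) (\<phi> \<omega> s) > 2 / real (Suc m)" "s \<notin> A m K \<omega>" "s \<notin> N"
          then have "dist (w s) (d (step_index K s)) < 1 / real (Suc m)"
            "dist (\<phi> \<omega> s) (d (step_index K s)) < 1 / real (Suc m)"
            using wN(4) by (auto simp: A_def)
          then show False using s(2) dist_triangle2[of "w s" "\<phi> \<omega> s" "d (step_index K s)"] by simp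
        qed
        ultimately show ?thesis using wN Am by blast
      qed
      then have "\<forall>m. \<exists>w. w \<in> C \<and> (\<exists>N\<in>lmeasurable. measure lebesgue N < 2 / real (Suc m) \<and>
        {s\<in>{t..T}. dist (w s) (\<phi> \<omega> s) > 2 / real (Suc m)} \<subseteq> N)" by (rule allI)
      from choice[OF this] obtain w where "\<forall>m. w m \<in> C \<and> (\<exists>N\<in>lmeasurable. measure lebesgue N < 2 / real (Suc m) \<and>
        {s\<in>{t..T}. dist (w m s) (\<phi> \<omega> s) > 2 / real (Suc m)} \<subseteq> N)" by (elim exE)
      then have w: "\<And>m. w m \<in> C" and wN: "\<And>m. \<exists>N\<in>lmeasurable. measure lebesgue N < 2 / real (Suc m) \<and>
        {s\<in>{t..T}. dist (w m s) (\<phi> \<omega> s) > 2 / real (Suc m)} \<subseteq> N" by (simp_all only:)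
      have "tendsto_in_measure t T w (\<phi> \<omega>)"
        unfolding tendsto_in_measure_def
      proof (intro allI impI)
        fix \<epsilon> :: real assume "\<epsilon> > 0"
        then obtain m0 where m0: "1 / real (Suc m0) < \<epsilon> / 2" using nat_approx_posE[of "\<epsilon> / 2"] by auto
        show "(\<lambda>n. measure lebesgue {s\<in>{t..T}. dist (w n s) (\<phi> \<omega> s) > \<epsilon>}) \<longlonglongrightarrow> 0"
        proof (rule tendsto_sandwich[OF _ _ tendsto_const])
          show "(\<lambda>n. 2 / real (Suc n)) \<longlonglongrightarrow> 0"
            using LIMSEQ_Suc[OF lim_const_over_n[of 2]] .
          show "\<forall>\<^sub>F n in sequentially. 0 \<le> measure lebesgue {s\<in>{t..T}. dist (w n s) (\<phi> \<omega> s) > \<epsilon>}" by simp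
          show "\<forall>\<^sub>F n in sequentially. measure lebesgue {s\<in>{t..T}. dist (w n s) (\<phi> \<omega> s) > \<epsilon>} \<le> 2 / real (Suc n)"
            using eventually_ge_at_top[of m0]
          proof eventually_elim
            case (elim n)
            obtain N where N: "N \<in> lmeasurable" "measure lebesgue N < 2 / real (Suc n)"
              "{s\<in>{t..T}. dist (w n s) (\<phi> \<omega> s) > 2 / real (Suc n)} \<subseteq> N" using wN[of n] by blast
            have "1 / real (Suc n) \<le> 1 / real (Suc m0)" using elim by (simp add: frac_le)
            then have "2 / real (Suc n) < \<epsilon>" using m0 by simp
            then have sub: "{s\<in>{t..T}. dist (w n s) (\<phi> \<omega> s) > \<epsilon>} \<subseteq> N" (is "?S \<subseteq> N")
              using N(3) by auto
            show ?case
            proof (cases "?S \<in> sets lebesgue")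
              case True
              then have "measure lebesgue ?S \<le> measure lebesgue N"
                using sub N(1) by (intro measure_mono_fmeasurable)
              then show ?thesis using N(2) by simp
            qed (simp add: measure_notin_sets)
          qed
        qed
      qed
      then have "\<phi> \<omega> \<in> C" using C(2)[of w "\<phi> \<omega>"] w ctrl[OF \<omega>M] by blast
      then show "\<omega> \<in> \<phi> -` C \<inter> space M" using \<omega>M by blast
    qed
    show "\<phi> -` C \<inter> space M \<in> sets M"
    proof (cases "space M = {}")
      case False
      then obtain \<omega>0 where \<omega>0: "\<omega>0 \<in> space M" by blast
      show ?thesis unfolding eq
      proof (intro sets.countable_INT' image_subsetI sets.countable_UN' cg)
        fix m K assume "K \<in> good m"
        then show "{\<omega>\<in>space M. measure lebesgue (A m K \<omega>) < 1 / real (Suc m)} \<in> sets M"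
          using A(2)[OF _ \<omega>0] by (simp add: good_def)
      qed auto
    qed simp
  qed
qed

text \<open>
  Convergence in measure, together with boundedness and an equicontinuous integrand, implies
  convergence of the integrals; hence the sublevel sets of the functional are closed sets of
  controls. Integral functionals are the only observations of the opponent's control that the
  strategies below make.
\<close>
lemma measurable_control_integral:
  fixes \<phi> :: "real \<Rightarrow> 'a::metric_space \<Rightarrow> real"
  assumes comp: "compact (UNIV :: 'a set)"
    and bound: "\<And>r v. \<bar>\<phi> r v\<bar> \<le> K"
    and equi: "\<And>e. e > 0 \<Longrightarrow> \<exists>\<delta>>0. \<forall>r v v'. dist v v' < \<delta> \<longrightarrow> \<bar>\<phi> r v - \<phi> r v'\<bar> \<le> e"
    and meas: "\<And>v. v \<in> controls t T \<Longrightarrow> (\<lambda>r. \<phi> r (v r)) \<in> borel_measurable (lebesgue_on {t..T})"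
    and ab: "{a..b} \<subseteq> {t..T}"
  shows "(\<lambda>v. LINT r:{a..b}|lebesgue. \<phi> r (v r)) \<in> borel_measurable (control_algebra t T)"
proof (cases "a \<le> b")
  case True
  define I where "I v = (LINT r:{a..b}|lebesgue. \<phi> r (v r))" for v
  obtain d :: "nat \<Rightarrow> 'a" where d: "dense_seq d" using compact_dense_seq[OF comp] by blast
  have K0: "0 \<le> K" using bound[of 0 undefined] by linarith
  have int: "set_integrable lebesgue {a..b} (\<lambda>r. \<phi> r (v r))" if "v \<in> controls t T" for v
    using meas[OF that] bound ab by (intro set_integrable_bounded) auto
  have lim: "(\<lambda>n. I (w n)) \<longlonglongrightarrow> I v"
    if w: "\<And>n. w n \<in> controls t T" and v: "v \<in> controls t T" and wv: "tendsto_in_measure t T w v" for w v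
  proof (rule LIMSEQ_I)
    fix e :: real assume e: "e > 0"
    \<comment> \<open>Split the interval into the set where the controls differ by more than \<delta>/2, which has small
      measure, and its complement, where the integrands differ by at most ?e.\<close>
    let ?e = "e / (2 * (b - a + 1))"
    have "?e > 0" using e True by simp
    from equi[OF this] obtain \<delta> where \<delta>: "\<delta> > 0" "\<And>r v v'. dist v v' < \<delta> \<Longrightarrow> \<bar>\<phi> r v - \<phi> r v'\<bar> \<le> ?e"
      by blast
    define S where "S n = {s\<in>{t..T}. dist (w n s) (v s) > \<delta> / 2}" for n
    have S: "S n \<in> lmeasurable" for n
    proof -
      have "(\<lambda>s. dist (w n s) (v s)) \<in> borel_measurable (lebesgue_on {t..T})"
        using w v by (intro measurable_dist_dense[OF d]) (simp_all add: controls_def)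
      from borel_measurable_less[OF borel_measurable_const this, of "\<delta> / 2"]
      have "S n \<in> sets (lebesgue_on {t..T})" by (simp add: S_def)
      then have "S n \<in> sets lebesgue" by (simp add: sets_restrict_space_iff)
      moreover have "bounded (S n)" by (rule bounded_subset[OF bounded_closed_interval]) (auto simp: S_def)
      ultimately show ?thesis by (rule bounded_set_imp_lmeasurable[rotated])
    qed
    have "(\<lambda>n. measure lebesgue (S n)) \<longlonglongrightarrow> 0"
      using wv \<delta>(1) unfolding tendsto_in_measure_def S_def by (elim allE[of _ "\<delta> / 2"]) simp
    moreover have "e / (2 * (2 * K + 1)) > 0" using e K0 by simp
    ultimately obtain n0 where n0: "\<And>n. n \<ge> n0 \<Longrightarrow> norm (measure lebesgue (S n) - 0) < e / (2 * (2 * K + 1))"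
      by (rule LIMSEQ_D[THEN exE]) auto
    have "norm (I (w n) - I v) < e" if n: "n \<ge> n0" for n
    proof -
      have "I (w n) - I v = (LINT r:{a..b}|lebesgue. \<phi> r (w n r) - \<phi> r (v r))"
        unfolding I_def by (rule set_integral_diff(2)[symmetric]) (intro int w v)+
      also have "norm \<dots> \<le> (LINT r|lebesgue. ?e * indicator {a..b} r + 2 * K * indicator (S n) r)"
        unfolding set_lebesgue_integral_def
      proof (rule Bochner_Integration.integral_norm_bound_integral)
        show "integrable lebesgue (\<lambda>x. indicator {a..b} x *\<^sub>R (\<phi> x (w n x) - \<phi> x (v x)))"
          using set_integral_diff(1)[OF int[OF w[of n]] int[OF v]] by (simp add: set_integrable_def)
        show "integrable lebesgue (\<lambda>r. ?e * indicator {a..b} r + 2 * K * indicator (S n) r)"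
          using S[of n] by (intro Bochner_Integration.integrable_add integrable_mult_right integrable_real_indicator)
            (auto simp: emeasure_lborel_Icc_eq fmeasurable_def)
        fix r
        show "norm (indicator {a..b} r *\<^sub>R (\<phi> r (w n r) - \<phi> r (v r)))
          \<le> ?e * indicator {a..b} r + 2 * K * indicator (S n) r"
        proof (cases "r \<in> {a..b}")
          case r: True
          show ?thesis
          proof (cases "r \<in> S n")
            case True
            have "\<bar>\<phi> r (w n r) - \<phi> r (v r)\<bar> \<le> 2 * K" using bound[of r "w n r"] bound[of r "v r"] by linarith
            then show ?thesis using r True \<open>?e > 0\<close> by simp
          next
            case False
            then have "dist (w n r) (v r) < \<delta>" using r ab \<delta>(1) by (auto simp: S_def)
            then show ?thesis using \<delta>(2)[of "w n r" "v r" r] r False by simp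
          qed
        qed (use K0 in simp)
      qed
      also have "\<dots> = ?e * (b - a) + 2 * K * measure lebesgue (S n)"
        using S[of n] True
        by (subst Bochner_Integration.integral_add)
          (auto intro!: integrable_mult_right integrable_real_indicator simp: emeasure_lborel_Icc_eq fmeasurable_def)
      also have "\<dots> \<le> e / 2 + 2 * K * (e / (2 * (2 * K + 1)))"
      proof (rule add_mono)
        show "?e * (b - a) \<le> e / 2" using e True by (simp add: field_simps)
        show "2 * K * measure lebesgue (S n) \<le> 2 * K * (e / (2 * (2 * K + 1)))"
          using n0[OF n] K0 by (intro mult_left_mono) auto
      qed
      also have "\<dots> < e" using e K0 by (simp add: field_simps)
      finally show ?thesis .
    qed
    then show "\<exists>n0. \<forall>n\<ge>n0. norm (I (w n) - I v) < e" by blast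
  qed
  have "I \<in> borel_measurable (control_algebra t T)"
  proof (rule borel_measurableI_le)
    fix c
    have "closed_control_set t T {v \<in> controls t T. I v \<le> c}"
      unfolding closed_control_set_def
    proof (intro conjI allI impI)
      fix w v assume *: "(\<forall>n. w n \<in> {v \<in> controls t T. I v \<le> c}) \<and> v \<in> controls t T \<and> tendsto_in_measure t T w v"
      then have "(\<lambda>n. I (w n)) \<longlonglongrightarrow> I v" by (intro lim) auto
      then have "I v \<le> c" by (rule Lim_bounded[of _ _ 0]) (use * in auto)
      then show "v \<in> {v \<in> controls t T. I v \<le> c}" using * by simp
    qed auto
    then show "{v \<in> space (control_algebra t T). I v \<le> c} \<in> sets (control_algebra t T)"
      unfolding sets_control_algebra space_control_algebra by (intro sigma_sets.Basic) simp
  qed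
  then show ?thesis unfolding I_def .
qed (simp add: set_lebesgue_integral_def)

section \<open>Trajectories\<close>
lemma set_integral_split:
  fixes g :: "real \<Rightarrow> 'b::euclidean_space"
  assumes "a \<le> b" "b \<le> c" and int: "set_integrable lebesgue {a..c} g"
  shows "(LINT r:{a..c}|lebesgue. g r) = (LINT r:{a..b}|lebesgue. g r) + (LINT r:{b..c}|lebesgue. g r)"
proof -
  have eq: "{a..c} = {a..b} \<union> {b..c}" using assms by auto
  have "AE x in lebesgue. \<not> (x \<in> {a..b} \<and> x \<in> {b..c})"
  proof (rule AE_I')
    show "{b} \<in> null_sets lebesgue" by (simp add: null_sets_def)
    show "{x \<in> space lebesgue. \<not> \<not> (x \<in> {a..b} \<and> x \<in> {b..c})} \<subseteq> {b}" by auto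
  qed
  then show ?thesis
    unfolding eq by (rule set_integral_Un_AE) (use assms in \<open>auto intro: set_integrable_subset[OF int]\<close>)
qed

text \<open>
  The weight \<open>exp (2 * L * (r - t))\<close> turns the Picard operator of an
  \<open>L\<close>-Lipschitz field into a contraction with factor 1/2 on the whole interval.
\<close>
lemma norm_set_integral_exp_le:
  fixes g :: "real \<Rightarrow> 'b::euclidean_space"
  assumes ts: "t \<le> s" and L: "L > 0" and c: "c \<ge> 0"
    and g: "\<And>r. r \<in> {t..s} \<Longrightarrow> norm (g r) \<le> L * c * exp (2 * L * (r - t))"
  shows "norm (LINT r:{t..s}|lebesgue. g r) \<le> c / 2 * exp (2 * L * (s - t))"
proof (cases "set_integrable lebesgue {t..s} g")
  case True
  have h: "has_bochner_integral lborel (\<lambda>r. indicator {t..s} r *\<^sub>R (L * c * exp (2 * L * (r - t))))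
      (c / 2 * exp (2 * L * (s - t)) - c / 2 * exp (2 * L * (t - t)))"
  proof (rule has_bochner_integral_FTC_Icc[OF ts])
    fix r
    show "((\<lambda>r. c / 2 * exp (2 * L * (r - t))) has_vector_derivative L * c * exp (2 * L * (r - t))) (at r within {t..s})"
      unfolding has_real_derivative_iff_has_vector_derivative[symmetric]
      by (auto intro!: derivative_eq_intros)
  qed (intro continuous_intros)
  have m: "(\<lambda>r. indicator {t..s} r *\<^sub>R (L * c * exp (2 * L * (r - t)))) \<in> borel_measurable lborel"
    by (rule borel_measurable_integrable[OF integrable.intros[OF h]])
  have "norm (LINT r:{t..s}|lebesgue. g r) \<le> integral\<^sup>L lebesgue (\<lambda>r. indicator {t..s} r *\<^sub>R (L * c * exp (2 * L * (r - t))))"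
    unfolding set_lebesgue_integral_def
  proof (rule Bochner_Integration.integral_norm_bound_integral)
    show "integrable lebesgue (\<lambda>r. indicator {t..s} r *\<^sub>R (L * c * exp (2 * L * (r - t))))"
      using h m by (simp add: integrable_completion has_bochner_integral_iff)
  qed (use g True in \<open>auto simp: indicator_def set_integrable_def\<close>)
  also have "\<dots> = c / 2 * exp (2 * L * (s - t)) - c / 2 * exp (2 * L * (t - t))"
    using h m by (simp add: integral_completion has_bochner_integral_iff)
  also have "\<dots> \<le> c / 2 * exp (2 * L * (s - t))" using c by simp
  finally show ?thesis .
next
  case False
  then have "(LINT r:{t..s}|lebesgue. g r) = 0"
    by (simp add: set_lebesgue_integral_def set_integrable_def not_integrable_integral_eq)
  then show ?thesis using c by simp
qed

text \<open>
  The constants of the theorem are made strictly positive, to avoid degenerate cases.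
\<close>
locale dynamics =
  fixes f :: "real^'n \<Rightarrow> 'u::metric_space \<Rightarrow> 'v::metric_space \<Rightarrow> real^'n" and C L :: real
  assumes compact_u: "compact (UNIV :: 'u set)" and compact_v: "compact (UNIV :: 'v set)"
    and bounded: "norm (f x u v) \<le> C"
    and cont: "continuous_on UNIV (\<lambda>(u, v). f x u v)"
    and lip: "norm (f x u v - f y u v) \<le> L * norm (x - y)"
    and C_pos: "C > 0" and L_pos: "L > 0"
begin

lemma measurable_f:
  assumes X: "X \<in> borel_measurable M" and u: "u \<in> borel_measurable M" and v: "v \<in> borel_measurable M"
  shows "(\<lambda>r. f (X r) (u r) (v r)) \<in> borel_measurable M"
proof -
  obtain du :: "nat \<Rightarrow> 'u" where du: "dense_seq du" using compact_dense_seq[OF compact_u] by blast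
  obtain dv :: "nat \<Rightarrow> 'v" where dv: "dense_seq dv" using compact_dense_seq[OF compact_v] by blast
  obtain dx :: "nat \<Rightarrow> real^'n" where dx: "dense_seq dx" using second_countable_dense_seq by blast
  have 1: "continuous_on UNIV (\<lambda>u. f x u v)" for x v
  proof -
    have "continuous_on UNIV (\<lambda>u::'u. (u, v))" by (intro continuous_intros)
    from continuous_on_compose2[OF cont this] show ?thesis by simp
  qed
  have 2: "continuous_on UNIV (\<lambda>v. f x u v)" for x u
  proof -
    have "continuous_on UNIV (\<lambda>v::'v. (u, v))" by (intro continuous_intros)
    from continuous_on_compose2[OF cont this] show ?thesis by simp
  qed
  have 3: "continuous_on UNIV (\<lambda>x. f x u v)" for u v
    by (rule lipschitz_on_continuous_on[of L], rule lipschitz_onI)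
      (use lip L_pos in \<open>auto simp: dist_norm\<close>)
  have "(\<lambda>r. f x (u r) v) \<in> borel_measurable M" for x v
    by (rule borel_measurable_continuous_on[OF 1 u])
  then have "(\<lambda>r. f x (u r) (v r)) \<in> borel_measurable M" for x
    by (rule measurable_caratheodory[OF dv v]) (rule 2)
  then show ?thesis
    by (rule measurable_caratheodory[OF dx X]) (rule 3)
qed

lemma set_integrable_f:
  assumes "X \<in> borel_measurable (lebesgue_on {t..T})" "u \<in> controls t T" "v \<in> controls t T" "{a..b} \<subseteq> {t..T}"
  shows "set_integrable lebesgue {a..b} (\<lambda>r. f (X r) (u r) (v r))"
  using assms bounded by (intro set_integrable_bounded[of _ t T] measurable_f) (auto simp: controls_def)

definition picard_step :: "real \<Rightarrow> real^'n \<Rightarrow> (real \<Rightarrow> 'u) \<Rightarrow> (real \<Rightarrow> 'v) \<Rightarrow> (real \<Rightarrow> real^'n) \<Rightarrow> real \<Rightarrow> real^'n" where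
  "picard_step t x u v X s = x + (LINT r:{t..s}|lebesgue. f (X r) (u r) (v r))"

definition picard where
  "picard t x u v n = (picard_step t x u v ^^ n) (\<lambda>_. x)"

lemma picard_simps: "picard t x u v 0 = (\<lambda>_. x)" "picard t x u v (Suc n) = picard_step t x u v (picard t x u v n)"
  by (simp_all add: picard_def)

lemma picard_step_lipschitz:
  assumes X: "X \<in> borel_measurable (lebesgue_on {t..T})" and uv: "u \<in> controls t T" "v \<in> controls t T"
    and s: "t \<le> a" "a \<le> b" "b \<le> T"
  shows "norm (picard_step t x u v X b - picard_step t x u v X a) \<le> C * (b - a)"
proof -
  have "picard_step t x u v X b - picard_step t x u v X a = (LINT r:{a..b}|lebesgue. f (X r) (u r) (v r))"
    unfolding picard_step_def using set_integral_split[of t a b "\<lambda>r. f (X r) (u r) (v r)"]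
      set_integrable_f[OF X uv, of t b] s by simp
  then show ?thesis using norm_set_integral_le[of a b "\<lambda>r. f (X r) (u r) (v r)" C] bounded s by (simp add: mult.commute)
qed

lemma picard_step_measurable:
  assumes X: "X \<in> borel_measurable (lebesgue_on {t..T})" and uv: "u \<in> controls t T" "v \<in> controls t T"
  shows "picard_step t x u v X \<in> borel_measurable (lebesgue_on {t..T})"
proof (rule continuous_imp_measurable_on_sets_lebesgue)
  have "norm (picard_step t x u v X a - picard_step t x u v X b) \<le> C * norm (a - b)" if "a \<in> {t..T}" "b \<in> {t..T}" for a b
    using picard_step_lipschitz[OF X uv, of a b x] picard_step_lipschitz[OF X uv, of b a x] that
    by (cases "a \<le> b") (auto simp: norm_minus_commute)
  then have "C-lipschitz_on {t..T} (picard_step t x u v X)"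
    using C_pos by (intro lipschitz_onI) (auto simp: dist_norm)
  then show "continuous_on {t..T} (picard_step t x u v X)" by (rule lipschitz_on_continuous_on)
qed simp

lemma picard_measurable:
  assumes uv: "u \<in> controls t T" "v \<in> controls t T"
  shows "picard t x u v n \<in> borel_measurable (lebesgue_on {t..T})"
  by (induction n) (auto simp: picard_simps intro: picard_step_measurable[OF _ uv])

lemma picard_step_contract:
  assumes X: "X \<in> borel_measurable (lebesgue_on {t..T})" "Y \<in> borel_measurable (lebesgue_on {t..T})"
    and uv: "u \<in> controls t T" "v \<in> controls t T" and c: "c \<ge> 0"
    and le: "\<And>r. r \<in> {t..T} \<Longrightarrow> norm (X r - Y r) \<le> c * exp (2 * L * (r - t))" and s: "s \<in> {t..T}"
  shows "norm (picard_step t x u v X s - picard_step t x u v Y s) \<le> c / 2 * exp (2 * L * (s - t))"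
proof -
  have "picard_step t x u v X s - picard_step t x u v Y s =
      (LINT r:{t..s}|lebesgue. f (X r) (u r) (v r) - f (Y r) (u r) (v r))"
    unfolding picard_step_def using s
    by (subst set_integral_diff(2)) (auto intro!: set_integrable_f[OF _ uv] X)
  also have "norm \<dots> \<le> c / 2 * exp (2 * L * (s - t))"
  proof (rule norm_set_integral_exp_le)
    fix r assume r: "r \<in> {t..s}"
    have "norm (f (X r) (u r) (v r) - f (Y r) (u r) (v r)) \<le> L * norm (X r - Y r)" by (rule lip)
    also have "\<dots> \<le> L * (c * exp (2 * L * (r - t)))" using le[of r] r s L_pos by (intro mult_left_mono) auto
    finally show "norm (f (X r) (u r) (v r) - f (Y r) (u r) (v r)) \<le> L * c * exp (2 * L * (r - t))" by (simp add: mult.assoc)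
  qed (use s L_pos c in auto)
  finally show ?thesis .
qed

text \<open>
  Besides the integral equation, the Picard iterates are exhibited as an approximation of the
  trajectory: dependence on the controls and measurability are proved for the iterates and passed
  to the limit.
\<close>
lemma trajectory_unfold:
  fixes x :: "real^'n" and u :: "real \<Rightarrow> 'u" and v :: "real \<Rightarrow> 'v"
  assumes uv: "u \<in> controls t T" "v \<in> controls t T"
  defines "X \<equiv> trajectory f T t x u v"
  shows "X \<in> borel_measurable (lebesgue_on {t..T})"
    and "s \<in> {t..T} \<Longrightarrow> X s = x + (LINT r:{t..s}|lebesgue. f (X r) (u r) (v r))"
    and "s \<in> {t..T} \<Longrightarrow> (\<lambda>n. picard t x u v n s) \<longlonglongrightarrow> X s"
proof -
  define P where "P n s = picard t x u v n s" for n s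
  have Pm: "P n \<in> borel_measurable (lebesgue_on {t..T})" for n
    using picard_measurable[OF uv, of x n] by (simp add: P_def[abs_def])
  have PS: "P (Suc n) = picard_step t x u v (P n)" "P 0 = (\<lambda>_. x)" for n
    by (simp_all add: P_def[abs_def] picard_simps)
  have step_bound: "norm (picard_step t x u v Y s - x) \<le> C * (T - t) * exp (2 * L * (s - t))"
    if "s \<in> {t..T}" for s Y
  proof -
    have "norm (picard_step t x u v Y s - x) \<le> (s - t) * C"
      using norm_set_integral_le[of t s "\<lambda>r. f (Y r) (u r) (v r)" C] bounded that
      by (simp add: picard_step_def)
    also have "\<dots> \<le> C * (T - t) * 1" using that C_pos by (simp add: mult.commute)
    also have "\<dots> \<le> C * (T - t) * exp (2 * L * (s - t))"
      using that C_pos L_pos by (intro mult_left_mono) auto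
    finally show ?thesis .
  qed
  have conv: "(\<lambda>n. P n s) \<longlonglongrightarrow> Y s"
    if Y: "Y \<in> borel_measurable (lebesgue_on {t..T})" "\<And>s. s \<in> {t..T} \<Longrightarrow> Y s = picard_step t x u v Y s"
      and s: "s \<in> {t..T}" for Y s
  proof -
    have bd: "norm (P n s - Y s) \<le> C * (T - t) / 2 ^ n * exp (2 * L * (s - t))" if "s \<in> {t..T}" for n s
      using that
    proof (induction n arbitrary: s)
      case 0
      then show ?case using step_bound[OF 0, of Y] Y(2)[OF 0] by (simp add: PS norm_minus_commute)
    next
      case (Suc n)
      have "0 \<le> C * (T - t) / 2 ^ n" using C_pos Suc.prems by simp
      from picard_step_contract[OF Pm Y(1) uv this Suc.IH Suc.prems, of x]
      show ?case using Y(2)[OF Suc.prems] by (simp add: PS mult.commute)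
    qed
    have "(\<lambda>n. C * (T - t) * exp (2 * L * (s - t)) * (1 / 2) ^ n) \<longlonglongrightarrow> 0"
      by (intro tendsto_mult_right_zero LIMSEQ_realpow_zero) auto
    then have "(\<lambda>n. P n s - Y s) \<longlonglongrightarrow> 0"
      by (rule Lim_null_comparison[rotated]) (use bd[OF s] in \<open>simp add: power_divide mult_ac\<close>)
    then show ?thesis by (simp add: LIM_zero_iff)
  qed
  have diff: "norm (P (Suc n) s - P n s) \<le> C * (T - t) * exp (2 * L * (s - t)) * (1 / 2) ^ n" if "s \<in> {t..T}" for n s
    using that
  proof (induction n arbitrary: s)
    case 0
    then show ?case using step_bound[OF 0, of "P 0"] by (simp add: PS)
  next
    case (Suc n)
    have "0 \<le> C * (T - t) / 2 ^ n" using C_pos Suc.prems by simp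
    moreover have "norm (P (Suc n) r - P n r) \<le> C * (T - t) / 2 ^ n * exp (2 * L * (r - t))" if "r \<in> {t..T}" for r
      using Suc.IH[OF that] by (simp add: power_divide mult_ac)
    ultimately have "norm (picard_step t x u v (P (Suc n)) s - picard_step t x u v (P n) s)
        \<le> C * (T - t) / 2 ^ n / 2 * exp (2 * L * (s - t))"
      by (intro picard_step_contract[OF Pm Pm uv]) (use Suc.prems in auto)
    then show ?case by (simp add: PS(1)[of "Suc n"] PS(1)[of n, symmetric] power_divide mult_ac)
  qed
  define Y where "Y s = (if s \<in> {t..T} then lim (\<lambda>n. P n s) else undefined)" for s
  have PY: "(\<lambda>n. P n s) \<longlonglongrightarrow> Y s" if s: "s \<in> {t..T}" for s
  proof -
    have "summable (\<lambda>n. C * (T - t) * exp (2 * L * (s - t)) * (1 / 2) ^ n)"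
      by (intro summable_mult summable_geometric) auto
    then have "summable (\<lambda>n. P (Suc n) s - P n s)"
      by (rule summable_comparison_test'[where N = 0]) (use diff[OF s] in auto)
    then have "convergent (\<lambda>n. \<Sum>i<n. P (Suc i) s - P i s)"
      by (simp add: summable_iff_convergent)
    then have "convergent (\<lambda>n. P n s - P 0 s)"
      by (simp add: sum_lessThan_telescope[of "\<lambda>i. P i s"])
    then obtain l where "(\<lambda>n. P n s - P 0 s) \<longlonglongrightarrow> l" by (auto simp: convergent_def)
    from tendsto_add[OF this tendsto_const[of "P 0 s"]] have "convergent (\<lambda>n. P n s)"
      by (auto simp: convergent_def)
    then show ?thesis using s by (simp add: Y_def convergent_LIMSEQ_iff)
  qed
  have Ym: "Y \<in> borel_measurable (lebesgue_on {t..T})"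
    by (rule borel_measurable_LIMSEQ_metric[where f = P, OF Pm]) (use PY in auto)
  have Yeq: "Y s = picard_step t x u v Y s" if s: "s \<in> {t..T}" for s
  proof -
    have "(\<lambda>n. LINT r:{t..s}|lebesgue. f (P n r) (u r) (v r)) \<longlonglongrightarrow> (LINT r:{t..s}|lebesgue. f (Y r) (u r) (v r))"
      unfolding set_lebesgue_integral_def
    proof (rule integral_dominated_convergence)
      have sub: "{t..s} \<subseteq> {t..T}" using s by auto
      show "(\<lambda>r. indicator {t..s} r *\<^sub>R f (P n r) (u r) (v r)) \<in> borel_measurable lebesgue" for n
        using set_integrable_f[OF Pm uv sub] by (simp add: set_integrable_def integrable_iff_bounded)
      show "(\<lambda>r. indicator {t..s} r *\<^sub>R f (Y r) (u r) (v r)) \<in> borel_measurable lebesgue"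
        using set_integrable_f[OF Ym uv sub] by (simp add: set_integrable_def integrable_iff_bounded)
      show "integrable lebesgue (\<lambda>r. C * indicator {t..s} r)"
        by (intro integrable_mult_right integrable_real_indicator) (auto simp: emeasure_lborel_Icc_eq)
      show "AE r in lebesgue. norm (indicator {t..s} r *\<^sub>R f (P n r) (u r) (v r)) \<le> C * indicator {t..s} r" for n
        using bounded by (intro AE_I2) (auto simp: indicator_def)
      have "(\<lambda>n. f (P n r) (u r) (v r)) \<longlonglongrightarrow> f (Y r) (u r) (v r)" if "r \<in> {t..s}" for r
      proof (rule LIM_zero_cancel, rule Lim_null_comparison)
        show "\<forall>\<^sub>F n in sequentially. norm (f (P n r) (u r) (v r) - f (Y r) (u r) (v r)) \<le> L * norm (P n r - Y r)"
          using lip by simp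
        have "(\<lambda>n. norm (P n r - Y r)) \<longlonglongrightarrow> 0"
          using PY[of r] that sub by (intro tendsto_norm_zero) (auto simp: LIM_zero)
        then show "(\<lambda>n. L * norm (P n r - Y r)) \<longlonglongrightarrow> 0" by (rule tendsto_mult_right_zero)
      qed
      then show "AE r in lebesgue. (\<lambda>n. indicator {t..s} r *\<^sub>R f (P n r) (u r) (v r)) \<longlonglongrightarrow> indicator {t..s} r *\<^sub>R f (Y r) (u r) (v r)"
        by (intro AE_I2) (auto simp: indicator_def)
    qed
    then have "(\<lambda>n. P (Suc n) s) \<longlonglongrightarrow> picard_step t x u v Y s"
      unfolding PS picard_step_def by (intro tendsto_intros)
    from LIMSEQ_unique[OF LIMSEQ_Suc[OF PY[OF s]] this] show ?thesis .
  qed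
  let ?sol = "\<lambda>X. X \<in> extensional {t..T} \<and>
     set_integrable lebesgue {t..T} (\<lambda>r. f (X r) (u r) (v r)) \<and>
     (\<forall>s\<in>{t..T}. X s = x + (LINT r:{t..s}|lebesgue. f (X r) (u r) (v r)))"
  have Ysol: "?sol Y"
    using Yeq set_integrable_f[OF Ym uv order_refl] by (auto simp: extensional_def Y_def picard_step_def)
  have "\<exists>!X. ?sol X"
  proof (rule ex1I[of ?sol, OF Ysol])
    \<comment> \<open>Only the composition of a competing solution with f is integrable by assumption; its own
      measurability, which the contraction estimate requires, follows from its Lipschitz continuity.\<close>
    fix Z assume Z: "?sol Z"
    have Zeq: "Z s = picard_step t x u v Z s" if "s \<in> {t..T}" for s
      using Z that by (simp add: picard_step_def)
    have lipZ: "norm (Z b - Z a) \<le> C * (b - a)" if "t \<le> a" "a \<le> b" "b \<le> T" for a b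
    proof -
      have "set_integrable lebesgue {t..b} (\<lambda>r. f (Z r) (u r) (v r))"
        using Z that by (auto intro: set_integrable_subset)
      then have "Z b - Z a = (LINT r:{a..b}|lebesgue. f (Z r) (u r) (v r))"
        using Zeq[of a] Zeq[of b] that set_integral_split[of t a b "\<lambda>r. f (Z r) (u r) (v r)"]
        by (simp add: picard_step_def)
      then show ?thesis using norm_set_integral_le[of a b "\<lambda>r. f (Z r) (u r) (v r)" C] bounded that by (simp add: mult.commute)
    qed
    have "C-lipschitz_on {t..T} Z"
    proof (rule lipschitz_onI)
      show "dist (Z a) (Z b) \<le> C * dist a b" if "a \<in> {t..T}" "b \<in> {t..T}" for a b
        using lipZ[of a b] lipZ[of b a] that by (cases "a \<le> b") (auto simp: dist_norm norm_minus_commute)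
    qed (use C_pos in simp)
    then have Zm: "Z \<in> borel_measurable (lebesgue_on {t..T})"
      by (intro continuous_imp_measurable_on_sets_lebesgue lipschitz_on_continuous_on) auto
    show "Z = Y"
    proof (rule extensionalityI[of _ "{t..T}"])
      show "Z s = Y s" if "s \<in> {t..T}" for s
        using LIMSEQ_unique[OF conv[OF Zm Zeq that] PY[OF that]] .
    qed (use Z Ysol in auto)
  qed
  from the1_equality[where P = ?sol, OF this Ysol] have "X = Y"
    unfolding X_def trajectory_def .
  then show "X \<in> borel_measurable (lebesgue_on {t..T})" "s \<in> {t..T} \<Longrightarrow> X s = x + (LINT r:{t..s}|lebesgue. f (X r) (u r) (v r))"
    "s \<in> {t..T} \<Longrightarrow> (\<lambda>n. picard t x u v n s) \<longlonglongrightarrow> X s"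
    using Ym Ysol PY by (auto simp: P_def)
qed

lemma trajectory_start:
  assumes "u \<in> controls t T" "v \<in> controls t T" "t \<le> T"
  shows "trajectory f T t x u v t = x"
proof -
  have "norm (LINT r:{t..t}|lebesgue. f (trajectory f T t x u v r) (u r) (v r)) \<le> (t - t) * C"
    by (rule norm_set_integral_le) (use bounded in auto)
  then show ?thesis using trajectory_unfold(2)[OF assms(1,2), of t x] assms(3) by simp
qed

lemma trajectory_increment:
  assumes uv: "u \<in> controls t T" "v \<in> controls t T" and s: "t \<le> a" "a \<le> b" "b \<le> T"
  shows "trajectory f T t x u v b - trajectory f T t x u v a =
    (LINT r:{a..b}|lebesgue. f (trajectory f T t x u v r) (u r) (v r))"
proof -
  let ?X = "trajectory f T t x u v"
  have "set_integrable lebesgue {t..b} (\<lambda>r. f (?X r) (u r) (v r))"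
    using s by (intro set_integrable_f[OF trajectory_unfold(1)[OF uv] uv]) auto
  from set_integral_split[OF s(1,2) this]
  show ?thesis using trajectory_unfold(2)[OF uv, of a x] trajectory_unfold(2)[OF uv, of b x] s by simp
qed

lemma trajectory_lipschitz:
  assumes uv: "u \<in> controls t T" "v \<in> controls t T" and s: "t \<le> a" "a \<le> b" "b \<le> T"
  shows "norm (trajectory f T t x u v b - trajectory f T t x u v a) \<le> C * (b - a)"
  unfolding trajectory_increment[OF assms] mult.commute[of C]
  by (rule norm_set_integral_le[OF s(2)]) (rule bounded)

end

lemma AE_lebesgue_on_Icc:
  "(AE s in lebesgue_on {a..b::real}. P s) \<longleftrightarrow> (AE s in lebesgue. s \<in> {a..b} \<longrightarrow> P s)"
  by (rule AE_restrict_space_iff) simp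

lemma AE_lebesgue_on_mono:
  assumes "AE s in lebesgue_on {t..T::real}. P s" "{a..b} \<subseteq> {t..T}"
  shows "AE s in lebesgue_on {a..b}. P s"
  using assms(1) unfolding AE_lebesgue_on_Icc by eventually_elim (use assms(2) in blast)

lemma set_integral_cong_AE_on:
  fixes g g' :: "real \<Rightarrow> 'b::euclidean_space"
  assumes "AE r in lebesgue_on {a..b}. g r = g' r"
    and "set_integrable lebesgue {a..b} g" "set_integrable lebesgue {a..b} g'"
  shows "(LINT r:{a..b}|lebesgue. g r) = (LINT r:{a..b}|lebesgue. g' r)"
  unfolding set_lebesgue_integral_def
proof (rule integral_cong_AE)
  show "AE r in lebesgue. indicator {a..b} r *\<^sub>R g r = indicator {a..b} r *\<^sub>R g' r"
    using assms(1) unfolding AE_lebesgue_on_Icc by eventually_elim (auto simp: indicator_def)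
qed (use assms(2,3) in \<open>simp_all add: set_integrable_def integrable_iff_bounded\<close>)

context dynamics
begin

lemma trajectory_cong_AE:
  assumes uv: "u \<in> controls t T" "v \<in> controls t T" and uv': "u' \<in> controls t T" "v' \<in> controls t T"
    and s: "s \<in> {t..T}"
    and eq: "AE r in lebesgue_on {t..s}. u r = u' r" "AE r in lebesgue_on {t..s}. v r = v' r"
  shows "trajectory f T t x u v s = trajectory f T t x u' v' s"
proof -
  have P: "picard t x u v n b = picard t x u' v' n b" if "b \<in> {t..s}" for n b
    using that
  proof (induction n arbitrary: b)
    case (Suc n)
    have e: "AE r in lebesgue_on {t..b}. u r = u' r" "AE r in lebesgue_on {t..b}. v r = v' r"
      by (rule AE_lebesgue_on_mono[OF eq(1)], use Suc.prems in simp)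
        (rule AE_lebesgue_on_mono[OF eq(2)], use Suc.prems in simp)
    have "AE r in lebesgue_on {t..b}. f (picard t x u v n r) (u r) (v r) = f (picard t x u' v' n r) (u' r) (v' r)"
      using e AE_space
    proof eventually_elim
      case (elim r)
      then show ?case using Suc.IH[of r] Suc.prems by simp
    qed
    then have "(LINT r:{t..b}|lebesgue. f (picard t x u v n r) (u r) (v r)) =
        (LINT r:{t..b}|lebesgue. f (picard t x u' v' n r) (u' r) (v' r))"
      using Suc.prems s
      by (intro set_integral_cong_AE_on set_integrable_f[OF picard_measurable[OF uv] uv]
          set_integrable_f[OF picard_measurable[OF uv'] uv']) auto
    then show ?case by (simp add: picard_simps picard_step_def)
  qed (simp add: picard_simps)
  have "(\<lambda>n. picard t x u v n s) = (\<lambda>n. picard t x u' v' n s)"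
    using P s by auto
  then show ?thesis
    using LIMSEQ_unique trajectory_unfold(3)[OF uv s] trajectory_unfold(3)[OF uv' s] by metis
qed

text \<open>
  The Picard iterates are jointly measurable in the parameter and time, by Fubini for parametrized
  integrals.
\<close>
lemma measurable_trajectory:
  assumes u: "(\<lambda>(\<omega>, s). u \<omega> s) \<in> borel_measurable (M \<Otimes>\<^sub>M restrict_space borel {t..T})"
    and v: "(\<lambda>(\<omega>, s). v \<omega> s) \<in> borel_measurable (M \<Otimes>\<^sub>M restrict_space borel {t..T})"
    and s: "s \<in> {t..T}"
  shows "(\<lambda>\<omega>. trajectory f T t x (u \<omega>) (v \<omega>) s) \<in> borel_measurable M"
proof -
  let ?N = "lebesgue_on {t..T}"
  interpret N: finite_measure ?N
    by (rule finite_measureI) (simp add: emeasure_restrict_space emeasure_lborel_Icc_eq)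
  have pr: "(\<lambda>z. (fst z, snd z)) \<in> measurable (M \<Otimes>\<^sub>M ?N) (M \<Otimes>\<^sub>M restrict_space borel {t..T})"
    by (intro measurable_Pair measurable_fst measurable_compose[OF measurable_snd id_measurable_lebesgue_on])
  have u': "(\<lambda>z. u (fst z) (snd z)) \<in> borel_measurable (M \<Otimes>\<^sub>M ?N)"
    using measurable_compose[OF pr u] by simp
  have v': "(\<lambda>z. v (fst z) (snd z)) \<in> borel_measurable (M \<Otimes>\<^sub>M ?N)"
    using measurable_compose[OF pr v] by simp
  have ctrl: "u \<omega> \<in> controls t T" "v \<omega> \<in> controls t T" if "\<omega> \<in> space M" for \<omega>
    using measurable_space[OF measurable_into_control_algebra[OF compact_u u] that]
      measurable_space[OF measurable_into_control_algebra[OF compact_v v] that]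
    by (simp_all add: space_control_algebra)
  have proj: "(\<lambda>y. (fst (fst y), snd y)) \<in> measurable ((M \<Otimes>\<^sub>M ?N) \<Otimes>\<^sub>M ?N) (M \<Otimes>\<^sub>M ?N)"
    by (intro measurable_Pair measurable_compose[OF measurable_fst measurable_fst] measurable_snd)
  have time: "(\<lambda>s. s) \<in> borel_measurable ?N"
    by (rule measurable_restrict_space1) (simp add: measurable_completion)
  have P: "(\<lambda>z. picard t x (u (fst z)) (v (fst z)) n (snd z)) \<in> borel_measurable (M \<Otimes>\<^sub>M ?N)" for n
  proof (induction n)
    case (Suc n)
    define F where "F z r = (if t \<le> r \<and> r \<le> snd z
      then f (picard t x (u (fst z)) (v (fst z)) n r) (u (fst z) r) (v (fst z) r) else 0)" for z r
    have "(\<lambda>y. F (fst y) (snd y)) \<in> borel_measurable ((M \<Otimes>\<^sub>M ?N) \<Otimes>\<^sub>M ?N)"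
      unfolding F_def
    proof (rule measurable_If)
      show "(\<lambda>y. f (picard t x (u (fst (fst y))) (v (fst (fst y))) n (snd y)) (u (fst (fst y)) (snd y)) (v (fst (fst y)) (snd y)))
        \<in> borel_measurable ((M \<Otimes>\<^sub>M ?N) \<Otimes>\<^sub>M ?N)"
        using measurable_compose[OF proj Suc.IH] measurable_compose[OF proj u'] measurable_compose[OF proj v']
        by (intro measurable_f) simp_all
      have "(\<lambda>y. snd y) \<in> borel_measurable ((M \<Otimes>\<^sub>M ?N) \<Otimes>\<^sub>M ?N)"
        "(\<lambda>y. snd (fst y)) \<in> borel_measurable ((M \<Otimes>\<^sub>M ?N) \<Otimes>\<^sub>M ?N)"
        by (rule measurable_compose[OF measurable_snd time])
          (rule measurable_compose[OF measurable_fst measurable_compose[OF measurable_snd time]])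
      then show "{y \<in> space ((M \<Otimes>\<^sub>M ?N) \<Otimes>\<^sub>M ?N). t \<le> snd y \<and> snd y \<le> snd (fst y)} \<in> sets ((M \<Otimes>\<^sub>M ?N) \<Otimes>\<^sub>M ?N)"
        by (intro sets.sets_Collect_conj borel_measurable_le borel_measurable_const)
    qed simp
    then have "(\<lambda>z. x + (\<integral>r. F z r \<partial>?N)) \<in> borel_measurable (M \<Otimes>\<^sub>M ?N)"
      by (intro borel_measurable_add borel_measurable_const N.borel_measurable_lebesgue_integral)
        (simp add: case_prod_unfold)
    also have "?this \<longleftrightarrow> ?case"
    proof (rule measurable_cong)
      fix z assume "z \<in> space (M \<Otimes>\<^sub>M ?N)"
      then have z: "snd z \<in> {t..T}" by (auto simp: space_pair_measure)
      have "(\<integral>r. F z r \<partial>?N) = (\<integral>r. indicator {t..T} r *\<^sub>R F z r \<partial>lebesgue)"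
        by (rule integral_restrict_space) simp
      also have "\<dots> = (LINT r:{t..snd z}|lebesgue. f (picard t x (u (fst z)) (v (fst z)) n r) (u (fst z) r) (v (fst z) r))"
        unfolding set_lebesgue_integral_def F_def using z
        by (intro Bochner_Integration.integral_cong) (auto simp: indicator_def)
      finally show "x + (\<integral>r. F z r \<partial>?N) = picard t x (u (fst z)) (v (fst z)) (Suc n) (snd z)"
        by (simp add: picard_simps picard_step_def)
    qed
    finally show ?case .
  qed (simp add: picard_simps)
  show ?thesis
  proof (rule borel_measurable_LIMSEQ_metric[where f = "\<lambda>n \<omega>. picard t x (u \<omega>) (v \<omega>) n s"])
    have "(\<lambda>\<omega>. (\<omega>, s)) \<in> measurable M (M \<Otimes>\<^sub>M ?N)" by (rule measurable_Pair2') (use s in simp)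
    from measurable_compose[OF this P]
    show "(\<lambda>\<omega>. picard t x (u \<omega>) (v \<omega>) n s) \<in> borel_measurable M" for n by simp
    show "(\<lambda>n. picard t x (u \<omega>) (v \<omega>) n s) \<longlonglongrightarrow> trajectory f T t x (u \<omega>) (v \<omega>) s" if "\<omega> \<in> space M" for \<omega>
      using trajectory_unfold(3)[OF ctrl[OF that] s] .
  qed
qed

end

section \<open>Playing two strategies against each other\<close>
text \<open>
  The functions \<open>a l\<close> behind a strategy, detached from the probability space: the
  first argument of \<open>a l\<close> is a realization of the signals.
\<close>
definition kernel :: "2 \<Rightarrow> real \<Rightarrow> real list \<Rightarrow> real \<Rightarrow> nat
    \<Rightarrow> (nat \<Rightarrow> (2 \<times> nat \<Rightarrow> real) \<Rightarrow> (real \<Rightarrow> 'b::metric_space) \<Rightarrow> real \<Rightarrow> 'a::metric_space) \<Rightarrow> bool" where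
  "kernel p T \<pi> t k a \<longleftrightarrow> (\<forall>l\<in>{k..<length \<pi>}.
     (\<lambda>(y, s, v). a l y v s) \<in> borel_measurable
       (PiM (info p k l) (\<lambda>_. borel) \<Otimes>\<^sub>M
        restrict_space borel {max t (\<pi> ! (l - 1))..\<pi> ! l} \<Otimes>\<^sub>M control_algebra t T) \<and>
     (\<forall>v\<in>controls t T. \<forall>v'\<in>controls t T.
        (AE s in lebesgue_on {t..\<pi> ! (l - 1)}. v s = v' s) \<longrightarrow>
        (\<forall>y\<in>space (PiM (info p k l) (\<lambda>_. borel)).
           AE s in lebesgue_on {max t (\<pi> ! (l - 1))..\<pi> ! l}. a l y v s = a l y v' s)))"

text \<open>
  The index \<open>k\<close> is that of the partition interval in which the game starts.
\<close>
locale partitioned =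
  fixes T t :: real and \<pi> :: "real list" and k :: nat
  assumes partition: "is_partition T \<pi>" and k: "k \<in> {1..<length \<pi>}" and t: "t \<in> {\<pi> ! (k - 1)..<\<pi> ! k}"
begin

lemma \<pi>_less: "i < j \<Longrightarrow> j < length \<pi> \<Longrightarrow> \<pi> ! i < \<pi> ! j"
  using partition by (simp add: is_partition_def sorted_wrt_iff_nth_less)

lemma \<pi>_mono: "i \<le> j \<Longrightarrow> j < length \<pi> \<Longrightarrow> \<pi> ! i \<le> \<pi> ! j"
  using \<pi>_less[of i j] by (cases "i = j") auto

lemma \<pi>_last: "\<pi> ! (length \<pi> - 1) = T"
  using partition last_conv_nth[of \<pi>] by (auto simp: is_partition_def)

lemma \<pi>_le_pred: "i < j \<Longrightarrow> j < length \<pi> \<Longrightarrow> \<pi> ! i \<le> \<pi> ! (j - 1)"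
  by (rule \<pi>_mono) auto

lemma \<pi>_le_T: "j < length \<pi> \<Longrightarrow> \<pi> ! j \<le> T"
  using \<pi>_mono[of j "length \<pi> - 1"] \<pi>_last by simp

lemma t_less_\<pi>: "k \<le> l \<Longrightarrow> l < length \<pi> \<Longrightarrow> t < \<pi> ! l"
  using t \<pi>_mono[of k l] by auto

lemma t_less_T: "t < T"
  using t_less_\<pi>[of "length \<pi> - 1"] k \<pi>_last by auto

lemma k_unique: "k' \<in> {1..<length \<pi>} \<Longrightarrow> t \<in> {\<pi> ! (k' - 1)..<\<pi> ! k'} \<Longrightarrow> k' = k"
  using \<pi>_le_pred[of k k'] \<pi>_le_pred[of k' k] t k
  by (cases k' k rule: linorder_cases) (auto simp: less_imp_diff_less)

lemma strategies_iff:
  "\<alpha> \<in> strategies p M T \<pi> t \<longleftrightarrow> (\<exists>a. kernel p T \<pi> t k a \<and>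
     (\<forall>l\<in>{k..<length \<pi>}. \<forall>\<omega>\<in>space M. \<forall>v\<in>controls t T. \<forall>s\<in>{max t (\<pi> ! (l - 1))..<\<pi> ! l}.
           \<alpha> \<omega> v s = a l (\<lambda>(i, j)\<in>info p k l. \<zeta> \<pi> i j \<omega>) v s))"
  (is "_ \<longleftrightarrow> ?R")
proof -
  have "\<alpha> \<in> strategies p M T \<pi> t \<longleftrightarrow> (\<forall>k'\<in>{1..<length \<pi>}. t \<in> {\<pi> ! (k' - 1)..<\<pi> ! k'} \<longrightarrow>
     (\<exists>a. \<forall>l\<in>{k'..<length \<pi>}.
        (\<lambda>(y, s, v). a l y v s) \<in> borel_measurable
          (PiM (info p k' l) (\<lambda>_. borel) \<Otimes>\<^sub>M
           restrict_space borel {max t (\<pi> ! (l - 1))..\<pi> ! l} \<Otimes>\<^sub>M control_algebra t T) \<and>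
        (\<forall>v\<in>controls t T. \<forall>v'\<in>controls t T.
           (AE s in lebesgue_on {t..\<pi> ! (l - 1)}. v s = v' s) \<longrightarrow>
           (\<forall>y\<in>space (PiM (info p k' l) (\<lambda>_. borel)).
              AE s in lebesgue_on {max t (\<pi> ! (l - 1))..\<pi> ! l}. a l y v s = a l y v' s)) \<and>
        (\<forall>\<omega>\<in>space M. \<forall>v\<in>controls t T. \<forall>s\<in>{max t (\<pi> ! (l - 1))..<\<pi> ! l}.
           \<alpha> \<omega> v s = a l (\<lambda>(i, j)\<in>info p k' l. \<zeta> \<pi> i j \<omega>) v s)))"
    (is "_ \<longleftrightarrow> (\<forall>k'\<in>?K. ?t k' \<longrightarrow> ?P k')")
    unfolding strategies_def by (rule mem_Collect_eq)
  also have "\<dots> \<longleftrightarrow> ?P k"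
  proof
    assume A: "\<forall>k'\<in>?K. ?t k' \<longrightarrow> ?P k'"
    show "?P k" by (rule A[rule_format, OF k t])
  next
    assume P: "?P k"
    show "\<forall>k'\<in>?K. ?t k' \<longrightarrow> ?P k'"
    proof (intro ballI impI)
      fix k' assume "k' \<in> ?K" "?t k'"
      then have "k' = k" by (rule k_unique)
      with P show "?P k'" by (simp only:)
    qed
  qed
  also have "\<dots> \<longleftrightarrow> ?R"
    unfolding kernel_def ball_conj_distrib by (simp only: conj_assoc)
  finally show ?thesis .
qed

abbreviation stage :: "nat \<Rightarrow> real set" where "stage l \<equiv> {max t (\<pi> ! (l - 1))..<\<pi> ! l}"

lemma stage_exists:
  assumes "t \<le> s" "s < \<pi> ! l" "l < length \<pi>"
  shows "\<exists>l'\<in>{k..l}. s \<in> stage l'"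
  using assms
proof (induction l)
  case 0
  then show ?case using t \<pi>_mono[of 0 "k - 1"] k by (auto simp: less_imp_diff_less)
next
  case (Suc l)
  show ?case
  proof (cases "s < \<pi> ! l")
    case True
    then show ?thesis using Suc.IH[of ] Suc.prems by (auto intro: le_SucI)
  next
    case False
    moreover have "k \<le> Suc l"
    proof (rule ccontr)
      assume "\<not> k \<le> Suc l"
      then have "\<pi> ! Suc l \<le> \<pi> ! (k - 1)" using k by (intro \<pi>_mono) auto
      then show False using Suc.prems t by auto
    qed
    ultimately show ?thesis using Suc.prems by (intro bexI[of _ "Suc l"]) auto
  qed
qed

lemma stage_disjoint:
  assumes "s \<in> stage l" "s \<in> stage l'" "l < length \<pi>" "l' < length \<pi>"
  shows "l = l'"
  using assms \<pi>_le_pred[of l l'] \<pi>_le_pred[of l' l]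
  by (cases l l' rule: linorder_cases) (auto simp: less_imp_diff_less)

abbreviation signals :: "(2 \<times> nat) set" where "signals \<equiv> UNIV \<times> {..<length \<pi> - 1}"

lemma info_sub: "l \<in> {k..<length \<pi>} \<Longrightarrow> info p k l \<subseteq> signals"
  using k by (auto simp: info_def)

lemma info_mono: "k \<le> l' \<Longrightarrow> l' \<le> l \<Longrightarrow> info p k l' \<subseteq> info p k l"
  using k by (cases "l' = l") (auto simp: info_def)

text \<open>
  The pair of controls after \<open>m\<close> intervals. On the next interval each player applies
  the kernel to the opponent's control as constructed so far. Since kernels are nonanticipating
  with the delay of one interval, the result stays valid when that control is completed
  afterwards.
\<close>
fun play :: "2 \<Rightarrow> 2 \<Rightarrow> (nat \<Rightarrow> (2 \<times> nat \<Rightarrow> real) \<Rightarrow> (real \<Rightarrow> 'b) \<Rightarrow> real \<Rightarrow> 'a)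
    \<Rightarrow> (nat \<Rightarrow> (2 \<times> nat \<Rightarrow> real) \<Rightarrow> (real \<Rightarrow> 'a) \<Rightarrow> real \<Rightarrow> 'b) \<Rightarrow> nat \<Rightarrow> (2 \<times> nat \<Rightarrow> real)
    \<Rightarrow> (real \<Rightarrow> 'a) \<times> (real \<Rightarrow> 'b)" where
  "play p q a b 0 z = (\<lambda>_. undefined, \<lambda>_. undefined)"
| "play p q a b (Suc m) z =
    (\<lambda>s. if s \<in> stage (k + m) then a (k + m) (restrict z (info p k (k + m))) (snd (play p q a b m z)) s else fst (play p q a b m z) s,
     \<lambda>s. if s \<in> stage (k + m) then b (k + m) (restrict z (info q k (k + m))) (fst (play p q a b m z)) s else snd (play p q a b m z) s)"

lemma play_stable:
  assumes "m \<le> m'" "k + m' \<le> length \<pi>" "s < \<pi> ! (k + m - 1)"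
  shows "fst (play p q a b m' z) s = fst (play p q a b m z) s" "snd (play p q a b m' z) s = snd (play p q a b m z) s"
proof -
  have "fst (play p q a b m' z) s = fst (play p q a b m z) s \<and> snd (play p q a b m' z) s = snd (play p q a b m z) s"
    using assms
  proof (induction m' rule: dec_induct)
    case (step m'')
    have "\<pi> ! (k + m - 1) \<le> \<pi> ! (k + m'' - 1)" using step by (intro \<pi>_mono) auto
    then have "s \<notin> stage (k + m'')" using step by auto
    then show ?case using step by (simp del: atLeastLessThan_iff)
  qed simp
  then show "fst (play p q a b m' z) s = fst (play p q a b m z) s" "snd (play p q a b m' z) s = snd (play p q a b m z) s"
    by auto
qed

abbreviation "full \<equiv> length \<pi> - k"

lemma play_on_stage:
  assumes l: "l \<in> {k..<length \<pi>}" and s: "s \<in> stage l"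
  shows "fst (play p q a b full z) s = a l (restrict z (info p k l)) (snd (play p q a b (l - k) z)) s"
    "snd (play p q a b full z) s = b l (restrict z (info q k l)) (fst (play p q a b (l - k) z)) s"
proof -
  have "Suc (l - k) \<le> full" "k + full \<le> length \<pi>" "s < \<pi> ! (k + Suc (l - k) - 1)" using l k s by auto
  note * = play_stable[OF this, of p q a b z]
  show "fst (play p q a b full z) s = a l (restrict z (info p k l)) (snd (play p q a b (l - k) z)) s"
    "snd (play p q a b full z) s = b l (restrict z (info q k l)) (fst (play p q a b (l - k) z)) s"
    using * l s by simp_all
qed

lemma play_cong:
  assumes "\<And>i. i \<in> UNIV \<times> {k - 1..<k + m - 1} \<Longrightarrow> z i = z' i"
  shows "play p q a b m z = play p q a b m z'"
  using assms
proof (induction m)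
  case (Suc m)
  have "restrict z (info r k (k + m)) = restrict z' (info r k (k + m))" for r
    using Suc.prems k by (intro restrict_ext) (auto simp: info_def)
  moreover have "play p q a b m z = play p q a b m z'"
    using Suc.prems by (intro Suc.IH) auto
  ultimately show ?case by (simp only: play.simps)
qed simp

text \<open>
  The source of the independence exploited by the randomized punishment: the signal that the
  opponent of player \<open>q\<close> uses on the \<open>l\<close>-th interval does not belong to
  \<open>info q k l\<close>.
\<close>
lemma play_snd_cong:
  assumes l: "l \<in> {k..<length \<pi>}" and z: "\<And>i. i \<in> info q k l \<Longrightarrow> z i = z' i" and s: "t \<le> s" "s < \<pi> ! l"
  shows "snd (play p q a b full z) s = snd (play p q a b full z') s"
proof -
  obtain l' where l': "l' \<in> {k..l}" "s \<in> stage l'" using stage_exists[of s l] s l by auto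
  have "play p q a b (l' - k) z = play p q a b (l' - k) z'"
  proof (rule play_cong)
    fix i :: "2 \<times> nat" assume "i \<in> UNIV \<times> {k - 1..<k + (l' - k) - 1}"
    then have "i \<in> info q k l'" using l' by (auto simp: info_def)
    then have "i \<in> info q k l" using info_mono[of l' l q] l' by auto
    then show "z i = z' i" by (rule z)
  qed
  moreover have "restrict z (info q k l') = restrict z' (info q k l')"
    using z info_mono[of l' l q] l' by (intro restrict_ext) auto
  ultimately show ?thesis using play_on_stage(2)[of l' s p q a b] l l' by auto
qed

text \<open>
  Joint measurability in signals and time is the induction hypothesis needed, since it is what
  \<open>measurable_into_control_algebra\<close> turns into measurability of the map from signals
  to controls that is plugged into the next kernel.
\<close>
lemma measurable_play:
  fixes a :: "nat \<Rightarrow> (2 \<times> nat \<Rightarrow> real) \<Rightarrow> (real \<Rightarrow> 'b::metric_space) \<Rightarrow> real \<Rightarrow> 'a::metric_space"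
  assumes comp: "compact (UNIV :: 'a set)" "compact (UNIV :: 'b set)"
    and a: "kernel p T \<pi> t k a" and b: "kernel q T \<pi> t k b" and m: "m \<le> full"
  shows "(\<lambda>(z, s). fst (play p q a b m z) s) \<in> borel_measurable (PiM signals (\<lambda>_. borel) \<Otimes>\<^sub>M restrict_space borel {t..T})"
    and "(\<lambda>(z, s). snd (play p q a b m z) s) \<in> borel_measurable (PiM signals (\<lambda>_. borel) \<Otimes>\<^sub>M restrict_space borel {t..T})"
proof -
  let ?Z = "PiM signals (\<lambda>_. borel) :: (2 \<times> nat \<Rightarrow> real) measure" and ?R = "restrict_space borel {t..T} :: real measure"
  let ?Q = "?Z \<Otimes>\<^sub>M ?R"
  have time: "(\<lambda>z. snd z) \<in> borel_measurable ?Q"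
    by (rule measurable_compose[OF measurable_snd]) (rule measurable_restrict_space1, simp)
  have stage: "{z \<in> space ?Q. snd z \<in> stage l} \<in> sets ?Q" for l
    using measurable_sets[OF time, of "stage l"] by (simp add: vimage_def Int_def conj_commute)
  have step: "(\<lambda>z. c l (restrict (fst z) (info r k l)) (w (fst z)) (snd z))
      \<in> borel_measurable (restrict_space ?Q {z. snd z \<in> stage l})"
    if c: "kernel r T \<pi> t k c" and w: "w \<in> measurable ?Z (control_algebra t T)" and l: "l \<in> {k..<length \<pi>}"
    for r c w l
  proof -
    let ?P = "restrict_space ?Q {z. snd z \<in> stage l}"
    have m: "(\<lambda>(y, s, v). c l y v s) \<in> borel_measurable
       (PiM (info r k l) (\<lambda>_. borel) \<Otimes>\<^sub>M
        restrict_space borel {max t (\<pi> ! (l - 1))..\<pi> ! l} \<Otimes>\<^sub>M control_algebra t T)"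
      using c l unfolding kernel_def by blast
    have f: "(\<lambda>z. fst z) \<in> measurable ?P ?Z" by (rule measurable_restrict_space1) simp
    have "(\<lambda>z. (restrict (fst z) (info r k l), snd z, w (fst z))) \<in> measurable ?P
       (PiM (info r k l) (\<lambda>_. borel) \<Otimes>\<^sub>M
        restrict_space borel {max t (\<pi> ! (l - 1))..\<pi> ! l} \<Otimes>\<^sub>M control_algebra t T)"
    proof (intro measurable_Pair)
      show "(\<lambda>z. restrict (fst z) (info r k l)) \<in> measurable ?P (PiM (info r k l) (\<lambda>_. borel))"
        by (rule measurable_compose[OF f]) (rule measurable_restrict_subset, rule info_sub[OF l])
      show "(\<lambda>z. snd z) \<in> measurable ?P (restrict_space borel {max t (\<pi> ! (l - 1))..\<pi> ! l})"
      proof (rule measurable_restrict_space2)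
        show "(\<lambda>z. snd z) \<in> borel_measurable ?P" by (rule measurable_restrict_space1[OF time])
      qed (auto simp: space_restrict_space)
      show "(\<lambda>z. w (fst z)) \<in> measurable ?P (control_algebra t T)" by (rule measurable_compose[OF f w])
    qed
    from measurable_compose[OF this m] show ?thesis by simp
  qed
  have "(\<lambda>(z, s). fst (play p q a b m z) s) \<in> borel_measurable ?Q \<and> (\<lambda>(z, s). snd (play p q a b m z) s) \<in> borel_measurable ?Q"
    using m
  proof (induction m)
    case (Suc m)
    then have IH: "(\<lambda>(z, s). fst (play p q a b m z) s) \<in> borel_measurable ?Q"
      "(\<lambda>(z, s). snd (play p q a b m z) s) \<in> borel_measurable ?Q" and l: "k + m \<in> {k..<length \<pi>}"
      by auto
    note w = measurable_into_control_algebra[OF comp(1) IH(1)] measurable_into_control_algebra[OF comp(2) IH(2)]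
    have "(\<lambda>z. if snd z \<in> stage (k + m) then a (k + m) (restrict (fst z) (info p k (k + m))) (snd (play p q a b m (fst z))) (snd z)
        else fst (play p q a b m (fst z)) (snd z)) \<in> borel_measurable ?Q"
      unfolding measurable_If_restrict_space_iff[OF stage]
      using step[OF a w(2) l] measurable_restrict_space1[OF IH(1)] by (simp add: case_prod_unfold)
    moreover have "(\<lambda>z. if snd z \<in> stage (k + m) then b (k + m) (restrict (fst z) (info q k (k + m))) (fst (play p q a b m (fst z))) (snd z)
        else snd (play p q a b m (fst z)) (snd z)) \<in> borel_measurable ?Q"
      unfolding measurable_If_restrict_space_iff[OF stage]
      using step[OF b w(1) l] measurable_restrict_space1[OF IH(2)] by (simp add: case_prod_unfold)
    ultimately show ?case by (simp add: case_prod_unfold)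
  qed simp
  then show "(\<lambda>(z, s). fst (play p q a b m z) s) \<in> borel_measurable ?Q"
    "(\<lambda>(z, s). snd (play p q a b m z) s) \<in> borel_measurable ?Q" by auto
qed

end

lemma AE_lebesgue_neq: "AE s in lebesgue. s \<noteq> (c::real)"
  by (rule AE_I'[of "{c}"]) (auto simp: null_sets_def)

lemma AE_lebesgue_on_Ico:
  assumes "\<And>s. s \<in> {a..<b::real} \<Longrightarrow> P s"
  shows "AE s in lebesgue_on {a..b}. P s"
  unfolding AE_lebesgue_on_Icc using AE_lebesgue_neq[of b] by eventually_elim (use assms in auto)

lemma AE_lebesgue_on_combine:
  assumes "AE s in lebesgue_on {a..b::real}. P s" "AE s in lebesgue_on {c..d}. P s" "{e..g} \<subseteq> {a..b} \<union> {c..d}"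
  shows "AE s in lebesgue_on {e..g}. P s"
  using assms(1,2) unfolding AE_lebesgue_on_Icc by eventually_elim (use assms(3) in auto)

context partitioned
begin

definition consistent where
  "consistent p q a b z u v \<longleftrightarrow> u \<in> controls t T \<and> v \<in> controls t T \<and> (\<forall>l\<in>{k..<length \<pi>}.
    (AE s in lebesgue_on {max t (\<pi> ! (l - 1))..\<pi> ! l}. u s = a l (restrict z (info p k l)) v s) \<and>
    (AE s in lebesgue_on {max t (\<pi> ! (l - 1))..\<pi> ! l}. v s = b l (restrict z (info q k l)) u s))"

lemma restrict_info_space: "restrict z (info p k l) \<in> space (PiM (info p k l) (\<lambda>_. borel :: real measure))"
  by (simp add: space_PiM)

lemma kernel_nonanticipating:
  assumes "kernel p T \<pi> t k a" "l \<in> {k..<length \<pi>}" "v \<in> controls t T" "v' \<in> controls t T"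
    "AE s in lebesgue_on {t..\<pi> ! (l - 1)}. v s = v' s"
  shows "AE s in lebesgue_on {max t (\<pi> ! (l - 1))..\<pi> ! l}. a l (restrict z (info p k l)) v s = a l (restrict z (info p k l)) v' s"
  using assms restrict_info_space[of z p l] unfolding kernel_def by blast

lemma play_controls:
  fixes a :: "nat \<Rightarrow> (2 \<times> nat \<Rightarrow> real) \<Rightarrow> (real \<Rightarrow> 'b::metric_space) \<Rightarrow> real \<Rightarrow> 'a::metric_space"
  assumes comp: "compact (UNIV :: 'a set)" "compact (UNIV :: 'b set)"
    and a: "kernel p T \<pi> t k a" and b: "kernel q T \<pi> t k b" and m: "m \<le> full"
    and z: "z \<in> space (PiM signals (\<lambda>_. borel))"
  shows "fst (play p q a b m z) \<in> controls t T" "snd (play p q a b m z) \<in> controls t T"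
  using measurable_space[OF measurable_into_control_algebra[OF comp(1) measurable_play(1)[OF comp a b m]] z]
    measurable_space[OF measurable_into_control_algebra[OF comp(2) measurable_play(2)[OF comp a b m]] z]
  by (simp_all add: space_control_algebra)

lemma play_consistent:
  fixes a :: "nat \<Rightarrow> (2 \<times> nat \<Rightarrow> real) \<Rightarrow> (real \<Rightarrow> 'b::metric_space) \<Rightarrow> real \<Rightarrow> 'a::metric_space"
  assumes comp: "compact (UNIV :: 'a set)" "compact (UNIV :: 'b set)"
    and a: "kernel p T \<pi> t k a" and b: "kernel q T \<pi> t k b"
    and z: "z \<in> space (PiM signals (\<lambda>_. borel))"
  shows "consistent p q a b z (fst (play p q a b full z)) (snd (play p q a b full z))"
  unfolding consistent_def
proof (intro conjI ballI)
  note ctrl = play_controls[OF comp a b _ z]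
  show "fst (play p q a b full z) \<in> controls t T" "snd (play p q a b full z) \<in> controls t T"
    by (rule ctrl, simp)+
  fix l assume l: "l \<in> {k..<length \<pi>}"
  have past: "fst (play p q a b full z) s = fst (play p q a b (l - k) z) s"
    "snd (play p q a b full z) s = snd (play p q a b (l - k) z) s" if "s \<in> {t..<\<pi> ! (l - 1)}" for s
    using play_stable[of "l - k" full s p q a b z] that l k by auto
  have "AE s in lebesgue_on {t..\<pi> ! (l - 1)}. snd (play p q a b (l - k) z) s = snd (play p q a b full z) s"
    by (rule AE_lebesgue_on_Ico) (use past in auto)
  from kernel_nonanticipating[OF a l ctrl(2) ctrl(2) this, of z]
  have 1: "AE s in lebesgue_on {max t (\<pi> ! (l - 1))..\<pi> ! l}.
      a l (restrict z (info p k l)) (snd (play p q a b (l - k) z)) s = a l (restrict z (info p k l)) (snd (play p q a b full z)) s"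
    using l by (simp add: diff_le_mono)
  have 2: "AE s in lebesgue_on {max t (\<pi> ! (l - 1))..\<pi> ! l}.
      fst (play p q a b full z) s = a l (restrict z (info p k l)) (snd (play p q a b (l - k) z)) s"
    by (rule AE_lebesgue_on_Ico) (rule play_on_stage(1)[OF l])
  show "AE s in lebesgue_on {max t (\<pi> ! (l - 1))..\<pi> ! l}.
      fst (play p q a b full z) s = a l (restrict z (info p k l)) (snd (play p q a b full z)) s"
    using 2 1 by eventually_elim (rule trans)
  have "AE s in lebesgue_on {t..\<pi> ! (l - 1)}. fst (play p q a b (l - k) z) s = fst (play p q a b full z) s"
    by (rule AE_lebesgue_on_Ico) (use past in auto)
  from kernel_nonanticipating[OF b l ctrl(1) ctrl(1) this, of z]
  have 1: "AE s in lebesgue_on {max t (\<pi> ! (l - 1))..\<pi> ! l}.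
      b l (restrict z (info q k l)) (fst (play p q a b (l - k) z)) s = b l (restrict z (info q k l)) (fst (play p q a b full z)) s"
    using l by (simp add: diff_le_mono)
  have 2: "AE s in lebesgue_on {max t (\<pi> ! (l - 1))..\<pi> ! l}.
      snd (play p q a b full z) s = b l (restrict z (info q k l)) (fst (play p q a b (l - k) z)) s"
    by (rule AE_lebesgue_on_Ico) (rule play_on_stage(2)[OF l])
  show "AE s in lebesgue_on {max t (\<pi> ! (l - 1))..\<pi> ! l}.
      snd (play p q a b full z) s = b l (restrict z (info q k l)) (fst (play p q a b full z)) s"
    using 2 1 by eventually_elim (rule trans)
qed

text \<open>
  Two consistent pairs agree interval by interval: on each interval both are determined by their
  common past.
\<close>
lemma consistent_unique:
  assumes a: "kernel p T \<pi> t k a" and b: "kernel q T \<pi> t k b"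
    and uv: "consistent p q a b z u v" and uv': "consistent p q a b z u' v'"
  shows "AE s in lebesgue_on {t..T}. u s = u' s \<and> v s = v' s"
proof -
  have ctrl: "u \<in> controls t T" "v \<in> controls t T" "u' \<in> controls t T" "v' \<in> controls t T"
    using uv uv' by (auto simp: consistent_def)
  have "AE s in lebesgue_on {t..\<pi> ! (k + m - 1)}. u s = u' s \<and> v s = v' s" if "m \<le> full" for m
    using that
  proof (induction m)
    case 0
    have "\<pi> ! (k - 1) \<le> t" using t by auto
    then show ?case by (intro AE_lebesgue_on_Ico) auto
  next
    case (Suc m)
    let ?l = "k + m"
    have l: "?l \<in> {k..<length \<pi>}" using Suc.prems by auto
    have IH: "AE s in lebesgue_on {t..\<pi> ! (?l - 1)}. u s = u' s" "AE s in lebesgue_on {t..\<pi> ! (?l - 1)}. v s = v' s"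
      using Suc by (auto simp: eventually_conj_iff)
    let ?P = "\<lambda>s. u s = u' s \<and> v s = v' s"
    have "AE s in lebesgue_on {max t (\<pi> ! (?l - 1))..\<pi> ! ?l}. ?P s"
      using kernel_nonanticipating[OF a l ctrl(2,4) IH(2), of z] kernel_nonanticipating[OF b l ctrl(1,3) IH(1), of z]
        uv[unfolded consistent_def, THEN conjunct2, THEN conjunct2, rule_format, OF l, THEN conjunct1]
        uv[unfolded consistent_def, THEN conjunct2, THEN conjunct2, rule_format, OF l, THEN conjunct2]
        uv'[unfolded consistent_def, THEN conjunct2, THEN conjunct2, rule_format, OF l, THEN conjunct1]
        uv'[unfolded consistent_def, THEN conjunct2, THEN conjunct2, rule_format, OF l, THEN conjunct2]
      by eventually_elim simp
    moreover have "AE s in lebesgue_on {t..\<pi> ! (?l - 1)}. ?P s" using Suc by simp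
    ultimately have "AE s in lebesgue_on {t..\<pi> ! ?l}. ?P s"
      by (rule AE_lebesgue_on_combine) auto
    moreover have "k + Suc m - 1 = ?l" by simp
    ultimately show ?case by (simp only:)
  qed
  from this[of full, OF order_refl] have "AE s in lebesgue_on {t..\<pi> ! (k + full - 1)}. u s = u' s \<and> v s = v' s" .
  moreover have "k + full - 1 = length \<pi> - 1" using k by auto
  ultimately show ?thesis by (simp only: \<pi>_last)
qed

end

section \<open>The law of the signals\<close>
abbreviation uniform01 :: "real measure" where "uniform01 \<equiv> uniform_measure lborel {0..1}"

lemma prob_space_uniform01: "prob_space uniform01"
  by (rule prob_space_uniform_measure) auto

lemma cdf_uniform01: "cdf uniform01 a = (if a < 0 then 0 else if a < 1 then a else 1)"
proof -
  have "{0..1} \<inter> {..a} = (if a < 0 then {} else if a < 1 then {0..a} else {0..1})" by auto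
  then show ?thesis by (simp add: cdf_def2 measure_uniform_measure)
qed

text \<open>
  The probability integral transform. For a level \<open>a\<close> strictly between 0 and 1, the
  set where the continuous distribution function is at most \<open>a\<close> is a closed
  half-line, whose end point has distribution value \<open>a\<close>.
\<close>
lemma distr_cdf_eq_uniform01:
  assumes N: "real_distribution N" and atoms: "\<And>x. measure N {x} = 0"
  shows "distr N borel (cdf N) = uniform01"
proof (rule cdf_unique)
  interpret N: real_distribution N by fact
  have mono: "mono (cdf N)" by (auto simp: mono_def N.cdf_nondecreasing)
  have meas[measurable]: "cdf N \<in> borel_measurable borel" by (rule borel_measurable_mono[OF mono])
  have cont: "isCont (cdf N) x" for x using atoms[of x] N.isCont_cdf by simp
  have measN: "cdf N \<in> measurable N borel" by simp
  show "real_distribution (distr N borel (cdf N))" using measN by (rule N.real_distribution_distr)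
  show "real_distribution uniform01"
    by (simp add: real_distribution_def real_distribution_axioms_def prob_space_uniform01)
  show "cdf (distr N borel (cdf N)) = cdf uniform01"
  proof
    fix a
    have eq: "cdf (distr N borel (cdf N)) a = measure N {x. cdf N x \<le> a}" (is "_ = measure N ?S")
      using measure_distr[OF measN, of "{..a}"] by (simp add: cdf_def2 vimage_def)
    consider "a < 0" | "1 \<le> a" | "0 \<le> a" "a < 1" by linarith
    then show "cdf (distr N borel (cdf N)) a = cdf uniform01 a"
    proof cases
      case 1
      then have "?S = {}" using N.cdf_nonneg by (auto simp: not_le intro: less_le_trans)
      then show ?thesis using 1 by (simp add: eq cdf_uniform01)
    next
      case 2
      then have "?S = UNIV" using N.cdf_bounded_prob by (auto intro: order_trans)
      then show ?thesis using 2 N.prob_space by (simp add: eq cdf_uniform01)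
    next
      case 3
      have "\<forall>\<^sub>F x in at_top. cdf N x > a" using N.cdf_lim_at_top_prob 3(2) by (rule order_tendstoD)
      then obtain b where b: "cdf N b > a" by (auto simp: eventually_at_top_linorder)
      have bdd: "bdd_above ?S"
      proof (rule bdd_aboveI)
        fix x assume "x \<in> ?S"
        then have "cdf N x < cdf N b" using b by simp
        then show "x \<le> b" using N.cdf_nondecreasing[of b x] by linarith
      qed
      have le: "measure N ?S \<le> a"
      proof (cases "?S = {}")
        case False
        let ?c = "Sup ?S"
        have "closed ?S" by (rule closed_Collect_le) (auto intro!: continuous_at_imp_continuous_on cont)
        have c: "?c \<in> ?S" using False bdd \<open>closed ?S\<close> by (rule closed_contains_Sup)
        have "?S \<subseteq> {..?c}" using bdd by (auto intro: cSup_upper)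
        then have "measure N ?S \<le> cdf N ?c" unfolding cdf_def2 by (intro N.finite_measure_mono) auto
        then show ?thesis using c by simp
      qed (use 3 in simp)
      have ge: "a \<le> measure N ?S"
      proof (cases "a = 0")
        case False
        then have "\<forall>\<^sub>F x in at_bot. cdf N x < a" using 3 by (intro order_tendstoD(2)[OF N.cdf_lim_at_bot]) simp
        then obtain b' where b': "cdf N b' < a" by (auto simp: eventually_at_bot_linorder)
        have "b' \<le> b" using b b' N.cdf_nondecreasing[of b b'] by linarith
        then obtain c where c: "cdf N c = a"
          using IVT[of "cdf N" b' a b] b b' cont by auto
        have S: "?S \<in> sets borel" using borel_measurable_le[OF meas borel_measurable_const] by simp
        have "{..c} \<subseteq> ?S" using c N.cdf_nondecreasing[of _ c] by auto
        then have "measure N {..c} \<le> measure N ?S" using S by (intro N.finite_measure_mono) auto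
        then have "cdf N c \<le> measure N ?S" by (simp only: cdf_def2)
        then show ?thesis using c by simp
      qed simp
      show ?thesis using le ge 3 by (simp add: eq cdf_uniform01)
    qed
  qed
qed

lemma std_normal_no_atoms: "measure std_normal_distribution {x} = 0"
proof -
  have "emeasure std_normal_distribution {x} = 0"
  proof (subst emeasure_density)
    have "(\<integral>\<^sup>+y. ennreal (std_normal_density y) * indicator {x} y \<partial>lborel) = (\<integral>\<^sup>+y. 0 \<partial>(lborel :: real measure))"
      by (rule nn_integral_cong_AE) (use AE_lborel_singleton[of x] in \<open>eventually_elim, simp\<close>)
    then show "(\<integral>\<^sup>+y. ennreal (std_normal_density y) * indicator {x} y \<partial>lborel) = 0" by simp
  qed auto
  then show ?thesis by (simp add: measure_def)
qed

context
  fixes T :: real and W and \<pi> :: "real list"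
  assumes W: "wiener_measure T W" and part: "is_partition T \<pi>" and len: "2 \<le> length \<pi>"
begin

interpretation W: prob_space W using W by (simp add: wiener_measure_def)

lemma W_incr:
  assumes "Suc j < length \<pi>"
  shows "distributed W lborel (\<lambda>B. B (\<pi> ! Suc j) $ i - B (\<pi> ! j) $ i) (normal_density 0 (sqrt (\<pi> ! Suc j - \<pi> ! j)))"
    and "0 < \<pi> ! Suc j - \<pi> ! j"
proof -
  have s: "sorted_wrt (<) \<pi>" "hd \<pi> = 0" "last \<pi> = T" "\<pi> \<noteq> []" using part by (auto simp: is_partition_def)
  have m: "\<pi> ! a < \<pi> ! b" if "a < b" "b < length \<pi>" for a b using s(1) that by (simp add: sorted_wrt_iff_nth_less)
  have z: "\<pi> ! 0 = 0" "\<pi> ! (length \<pi> - 1) = T" using s by (auto simp: hd_conv_nth last_conv_nth)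
  have "0 \<le> \<pi> ! j" using m[of 0 j] z assms by (cases "j = 0") auto
  moreover have "\<pi> ! Suc j \<le> T"
    using m[of "Suc j" "length \<pi> - 1"] z assms by (cases "Suc j = length \<pi> - 1") (auto simp: less_imp_le)
  moreover have "\<pi> ! j < \<pi> ! Suc j" using m assms by auto
  ultimately show "distributed W lborel (\<lambda>B. B (\<pi> ! Suc j) $ i - B (\<pi> ! j) $ i) (normal_density 0 (sqrt (\<pi> ! Suc j - \<pi> ! j)))"
    "0 < \<pi> ! Suc j - \<pi> ! j"
    using W unfolding wiener_measure_def by auto
qed

text \<open>
  The signals that come from the Brownian motion, with the index shifted down by one, as in the
  increments of \<open>wiener_measure\<close>.
\<close>
definition unif :: "2 \<times> nat \<Rightarrow> (real \<Rightarrow> real^2) \<Rightarrow> real" where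
  "unif = (\<lambda>(i, j) B. cdf std_normal_distribution ((B (\<pi> ! Suc j) $ i - B (\<pi> ! j) $ i) / sqrt (\<pi> ! Suc j - \<pi> ! j)))"

lemma cdf_std_normal_measurable: "cdf std_normal_distribution \<in> borel_measurable borel"
proof -
  interpret N: real_distribution std_normal_distribution by (rule real_dist_normal_dist)
  show ?thesis by (rule borel_measurable_mono) (auto simp: mono_def N.cdf_nondecreasing)
qed

lemma unif_measurable: "Suc j < length \<pi> \<Longrightarrow> unif (i, j) \<in> borel_measurable W"
  using distributed_measurable[OF W_incr(1)[of j i]] unfolding unif_def case_prod_conv
  by (intro measurable_compose[OF _ cdf_std_normal_measurable] borel_measurable_divide borel_measurable_const) simp_all

lemma distr_unif:
  assumes "Suc j < length \<pi>"
  shows "distr W borel (unif (i, j)) = uniform01"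
proof -
  let ?X = "\<lambda>B. (B (\<pi> ! Suc j) $ i - B (\<pi> ! j) $ i - 0) / sqrt (\<pi> ! Suc j - \<pi> ! j)"
  have D: "distributed W lborel ?X std_normal_density"
    using W_incr[OF assms] by (subst W.normal_standard_normal_convert[symmetric]) auto
  have m: "?X \<in> measurable W lborel" using D by (rule distributed_measurable)
  have "distr W borel (unif (i, j)) = distr (distr W lborel ?X) borel (cdf std_normal_distribution)"
    using m cdf_std_normal_measurable by (subst distr_distr) (auto simp: unif_def comp_def)
  also have "\<dots> = uniform01"
    unfolding distributed_distr_eq_density[OF D]
    by (rule distr_cdf_eq_uniform01[OF real_dist_normal_dist std_normal_no_atoms])
  finally show ?thesis .
qed

lemma indep_unif: "W.indep_vars (\<lambda>_. borel) unif (UNIV \<times> {j. Suc j < length \<pi>})"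
proof -
  have s: "sorted_wrt (<) \<pi>" "hd \<pi> = 0" "last \<pi> = T" "\<pi> \<noteq> []" using part by (auto simp: is_partition_def)
  have "set \<pi> \<subseteq> {0..T}"
  proof
    fix x assume "x \<in> set \<pi>"
    then obtain a where a: "a < length \<pi>" "x = \<pi> ! a" by (auto simp: in_set_conv_nth)
    have m: "\<pi> ! a \<le> \<pi> ! b" if "a \<le> b" "b < length \<pi>" for a b
      using s(1) that by (cases "a = b") (auto simp: sorted_wrt_iff_nth_less less_imp_le)
    show "x \<in> {0..T}" using m[of 0 a] m[of a "length \<pi> - 1"] a s by (auto simp: hd_conv_nth last_conv_nth)
  qed
  then have "W.indep_vars (\<lambda>_. borel) (\<lambda>(i, j) B. B (\<pi> ! Suc j) $ i - B (\<pi> ! j) $ i) (UNIV \<times> {j. Suc j < length \<pi>})"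
    using W s(1) unfolding wiener_measure_def by auto
  from W.indep_vars_compose2[OF this, of "\<lambda>(i, j) x. cdf std_normal_distribution (x / sqrt (\<pi> ! Suc j - \<pi> ! j))" "\<lambda>_. borel"]
  have "W.indep_vars (\<lambda>_. borel) (\<lambda>i x. (\<lambda>(i, j) x. cdf std_normal_distribution (x / sqrt (\<pi> ! Suc j - \<pi> ! j))) i
      ((\<lambda>(i, j) B. B (\<pi> ! Suc j) $ i - B (\<pi> ! j) $ i) i x)) (UNIV \<times> {j. Suc j < length \<pi>})"
    using measurable_compose[OF borel_measurable_divide[OF measurable_ident_sets[OF refl] borel_measurable_const] cdf_std_normal_measurable]
    by (simp add: case_prod_unfold id_def)
  then show ?thesis by (simp add: unif_def case_prod_unfold)
qed

lemma emeasure_unif: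
  assumes A: "\<And>i. A i \<in> sets borel"
  shows "emeasure W {B\<in>space W. \<forall>i\<in>UNIV \<times> {j. Suc j < length \<pi>}. unif i B \<in> A i} =
    (\<Prod>i\<in>UNIV \<times> {j. Suc j < length \<pi>}. emeasure uniform01 (A i))"
proof -
  let ?J = "UNIV \<times> {j. Suc j < length \<pi>} :: (2 \<times> nat) set"
  have fin: "finite ?J" by (rule finite_subset[of _ "UNIV \<times> {..<length \<pi>}"]) auto
  have ne: "?J \<noteq> {}" using len by (auto intro!: exI[of _ 0])
  have rv: "i \<in> ?J \<Longrightarrow> unif i \<in> borel_measurable W" for i using unif_measurable by auto
  have D: "distr W (PiM ?J (\<lambda>_. borel)) (\<lambda>B. \<lambda>i\<in>?J. unif i B) = PiM ?J (\<lambda>i. distr W borel (unif i))"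
    using W.indep_vars_iff_distr_eq_PiM'[OF ne, of unif "\<lambda>_. borel"] rv indep_unif by blast
  have m: "(\<lambda>B. \<lambda>i\<in>?J. unif i B) \<in> measurable W (PiM ?J (\<lambda>_. borel))" by (intro measurable_restrict rv)
  have E: "Pi\<^sub>E ?J A \<in> sets (PiM ?J (\<lambda>_. borel))" using A fin by (intro sets_PiM_I_finite) auto
  have "emeasure W {B\<in>space W. \<forall>i\<in>?J. unif i B \<in> A i} = emeasure (distr W (PiM ?J (\<lambda>_. borel)) (\<lambda>B. \<lambda>i\<in>?J. unif i B)) (Pi\<^sub>E ?J A)"
    unfolding emeasure_distr[OF m E] by (rule arg_cong[where f = "emeasure W"]) (auto simp: PiE_def Pi_def)
  also have "\<dots> = emeasure (PiM ?J (\<lambda>_. uniform01)) (Pi\<^sub>E ?J A)"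
    unfolding D by (intro arg_cong2[where f = emeasure] PiM_cong refl) (auto simp: distr_unif)
  also have "\<dots> = (\<Prod>i\<in>?J. emeasure uniform01 (A i))"
  proof -
    interpret product_prob_space "\<lambda>_::2 \<times> nat. uniform01"
      by (rule product_prob_spaceI) (rule prob_space_uniform01)
    show ?thesis using A fin by (intro emeasure_PiM) auto
  qed
  finally show ?thesis .
qed

abbreviation "sig \<equiv> UNIV \<times> {..<length \<pi> - 1} :: (2 \<times> nat) set"

lemma measurable_\<zeta>: "i \<in> sig \<Longrightarrow> (\<lambda>\<omega>. case i of (p, j) \<Rightarrow> \<zeta> \<pi> p j \<omega>) \<in> borel_measurable (enlarged W)"
proof -
  assume i: "i \<in> sig"
  obtain p j where ij: "i = (p, j)" by (cases i)
  show ?thesis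
  proof (cases j)
    case 0
    have "(\<lambda>c. c p) \<in> measurable (PiM (UNIV :: 2 set) (\<lambda>_. uniform01)) uniform01"
      by (rule measurable_component_singleton) simp
    then have "(\<lambda>\<omega>. snd \<omega> p) \<in> borel_measurable (enlarged W)"
      unfolding enlarged_def by (intro measurable_compose[OF measurable_snd]) (simp cong: measurable_cong_sets)
    then show ?thesis using ij 0 by (simp add: \<zeta>_def)
  next
    case (Suc m)
    have "(\<lambda>\<omega>. unif (p, m) (fst \<omega>)) \<in> borel_measurable (enlarged W)"
      unfolding enlarged_def by (rule measurable_compose[OF measurable_fst unif_measurable]) (use i ij Suc in auto)
    then show ?thesis using ij Suc by (simp add: \<zeta>_def unif_def)
  qed
qed

lemma measurable_signals: "(\<lambda>\<omega>. \<lambda>(i, j)\<in>sig. \<zeta> \<pi> i j \<omega>) \<in> measurable (enlarged W) (PiM sig (\<lambda>_. borel))"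
  using measurable_\<zeta> by (intro measurable_restrict)

text \<open>
  The signals that a strategy may use are independent and uniform. The signals with index 0 come
  from the second component of the sample space, those with index at least 1 from independent
  Brownian increments.
\<close>
lemma distr_signals: "distr (enlarged W) (PiM sig (\<lambda>_. borel)) (\<lambda>\<omega>. \<lambda>(i, j)\<in>sig. \<zeta> \<pi> i j \<omega>) = PiM sig (\<lambda>_. uniform01)"
proof -
  interpret product_prob_space "\<lambda>_::2 \<times> nat. uniform01"
    by (rule product_prob_spaceI) (rule prob_space_uniform01)
  interpret P: product_prob_space "\<lambda>_::2. uniform01" "UNIV :: 2 set"
    by (rule product_prob_spaceI) (rule prob_space_uniform01)
  have PP: "prob_space (PiM (UNIV :: 2 set) (\<lambda>_. uniform01))" by (intro prob_space_PiM prob_space_uniform01)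
  show ?thesis
  proof (rule PiM_eqI)
    show "finite sig" by simp
    show "sets (distr (enlarged W) (PiM sig (\<lambda>_. borel)) (\<lambda>\<omega>. \<lambda>(i, j)\<in>sig. \<zeta> \<pi> i j \<omega>)) = sets (PiM sig (\<lambda>_. uniform01))"
      by (simp cong: sets_PiM_cong)
    fix A :: "2 \<times> nat \<Rightarrow> real set" assume "\<And>i. i \<in> sig \<Longrightarrow> A i \<in> sets uniform01"
    then have A: "A i \<in> sets borel" if "i \<in> sig" for i using that by simp
    \<comment> \<open>A strategy sees signals with indices below N only; the increment over the last interval would have
      index N.\<close>
    define A' where "A' = (\<lambda>(i, j). if Suc j < length \<pi> - 1 then A (i, Suc j) else UNIV)"
    have A': "A' i \<in> sets borel" for i using A by (auto simp: A'_def split: prod.split)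
    let ?J = "UNIV \<times> {j. Suc j < length \<pi>} :: (2 \<times> nat) set"
    let ?E = "{B\<in>space W. \<forall>i\<in>?J. unif i B \<in> A' i}"
    let ?F = "Pi\<^sub>E UNIV (\<lambda>i::2. A (i, 0))"
    have fin: "finite ?J" by (rule finite_subset[of _ "UNIV \<times> {..<length \<pi>}"]) auto
    have E: "?E \<in> sets W"
    proof (rule sets.sets_Collect_finite_All'[OF _ fin])
      show "{B \<in> space W. unif i B \<in> A' i} \<in> sets W" if "i \<in> ?J" for i
        using measurable_sets[OF unif_measurable A'[of i], of "snd i" "fst i"] that
        by (auto simp: vimage_def Int_def conj_commute)
      show "?J \<noteq> {}" using len by (auto intro!: exI[of _ 0])
    qed
    have A0: "A (i, 0) \<in> sets uniform01" for i using A[of "(i, 0)"] len by simp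
    have F: "?F \<in> sets (PiM UNIV (\<lambda>_. uniform01))" using A0 by (intro sets_PiM_I_finite) auto
    have in_iff: "(\<lambda>(i, j)\<in>sig. \<zeta> \<pi> i j \<omega>) \<in> Pi\<^sub>E sig A \<longleftrightarrow> (\<forall>i\<in>?J. unif i (fst \<omega>) \<in> A' i) \<and> (\<forall>i. snd \<omega> i \<in> A (i, 0))" for \<omega>
    proof -
      have "(\<lambda>(i, j)\<in>sig. \<zeta> \<pi> i j \<omega>) \<in> Pi\<^sub>E sig A \<longleftrightarrow> (\<forall>i j. j < length \<pi> - 1 \<longrightarrow> \<zeta> \<pi> i j \<omega> \<in> A (i, j))"
        unfolding restrict_PiE_iff by auto
      also have "\<dots> \<longleftrightarrow> (\<forall>i j. Suc j < length \<pi> - 1 \<longrightarrow> \<zeta> \<pi> i (Suc j) \<omega> \<in> A (i, Suc j)) \<and> (\<forall>i. \<zeta> \<pi> i 0 \<omega> \<in> A (i, 0))"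
      proof -
        obtain n where n: "length \<pi> - 1 = Suc n" using len by (cases "length \<pi> - 1") auto
        show ?thesis unfolding n by (auto simp: All_less_Suc2)
      qed
      also have "\<dots> \<longleftrightarrow> (\<forall>i\<in>?J. unif i (fst \<omega>) \<in> A' i) \<and> (\<forall>i. snd \<omega> i \<in> A (i, 0))"
        by (auto simp: A'_def unif_def \<zeta>_def)
      finally show ?thesis .
    qed
    have PE: "Pi\<^sub>E sig A \<in> sets (PiM sig (\<lambda>_. borel))" using A by (intro sets_PiM_I_finite) auto
    have "emeasure (distr (enlarged W) (PiM sig (\<lambda>_. borel)) (\<lambda>\<omega>. \<lambda>(i, j)\<in>sig. \<zeta> \<pi> i j \<omega>)) (Pi\<^sub>E sig A) = emeasure (enlarged W) (?E \<times> ?F)"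
      unfolding emeasure_distr[OF measurable_signals PE]
    proof (rule arg_cong[where f = "emeasure (enlarged W)"], rule set_eqI)
      fix \<omega>
      have "\<omega> \<in> space (enlarged W) \<longleftrightarrow> fst \<omega> \<in> space W"
        by (cases \<omega>) (simp add: enlarged_def space_pair_measure space_PiM)
      moreover have "\<omega> \<in> ?E \<times> ?F \<longleftrightarrow> fst \<omega> \<in> space W \<and> (\<forall>i\<in>?J. unif i (fst \<omega>) \<in> A' i) \<and> (\<forall>i. snd \<omega> i \<in> A (i, 0))"
        by (cases \<omega>) (simp add: PiE_iff)
      ultimately show "\<omega> \<in> (\<lambda>\<omega>. \<lambda>(i, j)\<in>sig. \<zeta> \<pi> i j \<omega>) -` Pi\<^sub>E sig A \<inter> space (enlarged W) \<longleftrightarrow> \<omega> \<in> ?E \<times> ?F"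
        by (simp only: vimage_eq Int_iff in_iff) blast
    qed
    also have "\<dots> = emeasure W ?E * emeasure (PiM UNIV (\<lambda>_. uniform01)) ?F"
      unfolding enlarged_def using E F
      by (rule sigma_finite_measure.emeasure_pair_measure_Times[OF prob_space_imp_sigma_finite[OF PP]])
    also have "\<dots> = (\<Prod>i\<in>?J. emeasure uniform01 (A' i)) * (\<Prod>i\<in>UNIV. emeasure uniform01 (A (i, 0)))"
      using A0 by (simp only: emeasure_unif[OF A']) (subst P.emeasure_PiM, auto)
    also have "\<dots> = (\<Prod>i\<in>sig. emeasure uniform01 (A i))"
    proof -
      let ?J' = "UNIV \<times> {j. Suc j < length \<pi> - 1} :: (2 \<times> nat) set"
      have fin': "finite ?J'" by (rule finite_subset[of _ "UNIV \<times> {..<length \<pi>}"]) auto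
      have "emeasure uniform01 UNIV = 1" using prob_space.emeasure_space_1[OF prob_space_uniform01] by simp
      then have "(\<Prod>i\<in>?J. emeasure uniform01 (A' i)) = (\<Prod>i\<in>?J'. emeasure uniform01 (A' i))"
        by (intro prod.mono_neutral_right[OF fin]) (auto simp: A'_def split: if_splits)
      also have "\<dots> = (\<Prod>i\<in>(\<lambda>(i, j). (i, Suc j)) ` ?J'. emeasure uniform01 (A i))"
        by (subst prod.reindex) (auto simp: inj_on_def A'_def intro!: prod.cong)
      finally have 1: "(\<Prod>i\<in>?J. emeasure uniform01 (A' i)) = (\<Prod>i\<in>(\<lambda>(i, j). (i, Suc j)) ` ?J'. emeasure uniform01 (A i))" .
      have 2: "(\<Prod>i\<in>UNIV. emeasure uniform01 (A (i, 0))) = (\<Prod>i\<in>(\<lambda>i. (i, 0)) ` UNIV. emeasure uniform01 (A i))"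
        by (subst prod.reindex) (auto simp: inj_on_def)
      have sig: "sig = (\<lambda>(i, j). (i, Suc j)) ` ?J' \<union> (\<lambda>i. (i, 0)) ` UNIV"
      proof (intro set_eqI iffI)
        fix z assume z: "z \<in> sig"
        then show "z \<in> (\<lambda>(i, j). (i, Suc j)) ` ?J' \<union> (\<lambda>i. (i, 0)) ` UNIV"
          by (cases z; cases "snd z") (auto simp: image_iff)
      qed (use len in auto)
      show ?thesis unfolding 1 2 sig using fin' by (subst prod.union_disjoint) auto
    qed
    finally show "emeasure (distr (enlarged W) (PiM sig (\<lambda>_. borel)) (\<lambda>\<omega>. \<lambda>(i, j)\<in>sig. \<zeta> \<pi> i j \<omega>)) (Pi\<^sub>E sig A) =
        (\<Prod>i\<in>sig. emeasure uniform01 (A i))" .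
  qed
qed

end

section \<open>Payoffs as integrals over the signals\<close>
locale game = dynamics f C L + partitioned T t \<pi> k
  for f :: "real^'n \<Rightarrow> 'u::metric_space \<Rightarrow> 'v::metric_space \<Rightarrow> real^'n" and C L T t \<pi> k
begin

abbreviation "law \<equiv> PiM signals (\<lambda>_. uniform01) :: (2 \<times> nat \<Rightarrow> real) measure"

definition signal :: "sample \<Rightarrow> 2 \<times> nat \<Rightarrow> real" where
  "signal \<omega> = (\<lambda>(i, j)\<in>signals. \<zeta> \<pi> i j \<omega>)"

lemma restrict_signal: "l \<in> {k..<length \<pi>} \<Longrightarrow> restrict (signal \<omega>) (info p k l) = (\<lambda>(i, j)\<in>info p k l. \<zeta> \<pi> i j \<omega>)"
  using info_sub[of l p] unfolding signal_def restrict_restrict by (simp add: Int_absorb1)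

lemma AE_stagewise:
  "(AE s in lebesgue_on {t..T}. P s) \<longleftrightarrow>
    (\<forall>l\<in>{k..<length \<pi>}. AE s in lebesgue_on {max t (\<pi> ! (l - 1))..\<pi> ! l}. P s)"
proof (intro iffI ballI)
  fix l assume "AE s in lebesgue_on {t..T}. P s" "l \<in> {k..<length \<pi>}"
  then show "AE s in lebesgue_on {max t (\<pi> ! (l - 1))..\<pi> ! l}. P s"
    using \<pi>_le_T[of l] by (elim AE_lebesgue_on_mono) auto
next
  assume "\<forall>l\<in>{k..<length \<pi>}. AE s in lebesgue_on {max t (\<pi> ! (l - 1))..\<pi> ! l}. P s"
  then have "AE s in lebesgue. \<forall>l\<in>{k..<length \<pi>}. s \<in> {max t (\<pi> ! (l - 1))..\<pi> ! l} \<longrightarrow> P s"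
    unfolding AE_lebesgue_on_Icc by (intro AE_finite_allI) auto
  then have "AE s in lebesgue. s \<in> {t..T} \<longrightarrow> P s" using AE_lebesgue_neq[of T]
  proof eventually_elim
    case (elim s)
    show ?case
    proof
      assume "s \<in> {t..T}"
      then have "\<exists>l\<in>{k..length \<pi> - 1}. s \<in> stage l"
        using elim(2) \<pi>_last k by (intro stage_exists) auto
      then obtain l where "l \<in> {k..length \<pi> - 1}" "s \<in> stage l" by blast
      then show "P s" using elim(1)[rule_format, of l] k by auto
    qed
  qed
  then show "AE s in lebesgue_on {t..T}. P s" unfolding AE_lebesgue_on_Icc .
qed

lemma strategy_response_iff:
  assumes a: "\<forall>l\<in>{k..<length \<pi>}. \<forall>\<omega>\<in>space M. \<forall>v\<in>controls t T. \<forall>s\<in>stage l.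
           \<alpha> \<omega> v s = a l (\<lambda>(i, j)\<in>info p k l. \<zeta> \<pi> i j \<omega>) v s"
    and \<omega>: "\<omega> \<in> space M" and v: "v \<in> controls t T"
  shows "(AE s in lebesgue_on {t..T}. \<alpha> \<omega> v s = u s) \<longleftrightarrow>
    (\<forall>l\<in>{k..<length \<pi>}. AE s in lebesgue_on {max t (\<pi> ! (l - 1))..\<pi> ! l}. u s = a l (restrict (signal \<omega>) (info p k l)) v s)"
  unfolding AE_stagewise
proof (intro ball_cong refl)
  fix l assume l: "l \<in> {k..<length \<pi>}"
  have eq: "AE s in lebesgue_on {max t (\<pi> ! (l - 1))..\<pi> ! l}. \<alpha> \<omega> v s = a l (restrict (signal \<omega>) (info p k l)) v s"
    by (rule AE_lebesgue_on_Ico) (use a l \<omega> v in \<open>simp add: restrict_signal\<close>)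
  show "(AE s in lebesgue_on {max t (\<pi> ! (l - 1))..\<pi> ! l}. \<alpha> \<omega> v s = u s) \<longleftrightarrow>
    (AE s in lebesgue_on {max t (\<pi> ! (l - 1))..\<pi> ! l}. u s = a l (restrict (signal \<omega>) (info p k l)) v s)"
  proof
    assume "AE s in lebesgue_on {max t (\<pi> ! (l - 1))..\<pi> ! l}. \<alpha> \<omega> v s = u s"
    with eq show "AE s in lebesgue_on {max t (\<pi> ! (l - 1))..\<pi> ! l}. u s = a l (restrict (signal \<omega>) (info p k l)) v s"
      by eventually_elim simp
  next
    assume "AE s in lebesgue_on {max t (\<pi> ! (l - 1))..\<pi> ! l}. u s = a l (restrict (signal \<omega>) (info p k l)) v s"
    with eq show "AE s in lebesgue_on {max t (\<pi> ! (l - 1))..\<pi> ! l}. \<alpha> \<omega> v s = u s"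
      by eventually_elim simp
  qed
qed

text \<open>
  The outcome of two strategies, chosen arbitrarily among the measurable fixed points, coincides
  almost everywhere with the controls produced by \<open>play\<close> from the signals; so only
  the law of the signals matters.
\<close>
lemma payoff_eq:
  assumes W: "wiener_measure T W" and g: "g \<in> borel_measurable borel"
    and a: "kernel 1 T \<pi> t k a" and b: "kernel 2 T \<pi> t k b"
    and \<alpha>: "\<forall>l\<in>{k..<length \<pi>}. \<forall>\<omega>\<in>space (enlarged W). \<forall>v\<in>controls t T. \<forall>s\<in>stage l.
           \<alpha> \<omega> v s = a l (\<lambda>(i, j)\<in>info 1 k l. \<zeta> \<pi> i j \<omega>) v s"
    and \<beta>: "\<forall>l\<in>{k..<length \<pi>}. \<forall>\<omega>\<in>space (enlarged W). \<forall>v\<in>controls t T. \<forall>s\<in>stage l.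
           \<beta> \<omega> v s = b l (\<lambda>(i, j)\<in>info 2 k l. \<zeta> \<pi> i j \<omega>) v s"
  shows "payoff f g (enlarged W) T t x \<alpha> \<beta> =
    (\<integral>z. g (trajectory f T t x (fst (play 1 2 a b full z)) (snd (play 1 2 a b full z)) T) \<partial>law)"
proof -
  let ?M = "enlarged W" and ?C = "control_algebra t T \<Otimes>\<^sub>M control_algebra t T"
  let ?u = "\<lambda>z. fst (play 1 2 a b full z)" and ?v = "\<lambda>z. snd (play 1 2 a b full z)"
  have len: "2 \<le> length \<pi>" using k by auto
  have sig: "signal \<in> measurable ?M (PiM signals (\<lambda>_. borel))"
    unfolding signal_def[abs_def] by (rule measurable_signals[OF W partition len])
  note comp = compact_u compact_v
  note mp = measurable_play[OF comp a b order_refl]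
  let ?fix = "\<lambda>uv. uv \<in> measurable ?M ?C \<and>
        (\<forall>\<omega>\<in>space ?M.
           (AE s in lebesgue_on {t..T}. \<alpha> \<omega> (snd (uv \<omega>)) s = fst (uv \<omega>) s) \<and>
           (AE s in lebesgue_on {t..T}. \<beta> \<omega> (fst (uv \<omega>)) s = snd (uv \<omega>) s))"
  have cons_iff: "consistent 1 2 a b (signal \<omega>) u v \<longleftrightarrow>
      (AE s in lebesgue_on {t..T}. \<alpha> \<omega> v s = u s) \<and> (AE s in lebesgue_on {t..T}. \<beta> \<omega> u s = v s)"
    if "\<omega> \<in> space ?M" "u \<in> controls t T" "v \<in> controls t T" for \<omega> u v
    unfolding strategy_response_iff[OF \<alpha> that(1,3)] strategy_response_iff[OF \<beta> that(1,2)] consistent_def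
    using that(2,3) by (auto simp: ball_conj_distrib)
  have "?fix (\<lambda>\<omega>. (?u (signal \<omega>), ?v (signal \<omega>)))"
  proof (intro conjI ballI)
    show "(\<lambda>\<omega>. (?u (signal \<omega>), ?v (signal \<omega>))) \<in> measurable ?M ?C"
      using measurable_compose[OF sig measurable_into_control_algebra[OF comp(1) mp(1)]]
        measurable_compose[OF sig measurable_into_control_algebra[OF comp(2) mp(2)]]
      by (intro measurable_Pair)
    fix \<omega> assume \<omega>: "\<omega> \<in> space ?M"
    have z: "signal \<omega> \<in> space (PiM signals (\<lambda>_. borel))" using measurable_space[OF sig \<omega>] .
    note c = play_controls[OF comp a b order_refl z]
    show "AE s in lebesgue_on {t..T}. \<alpha> \<omega> (snd (?u (signal \<omega>), ?v (signal \<omega>))) s = fst (?u (signal \<omega>), ?v (signal \<omega>)) s"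
      "AE s in lebesgue_on {t..T}. \<beta> \<omega> (fst (?u (signal \<omega>), ?v (signal \<omega>))) s = snd (?u (signal \<omega>), ?v (signal \<omega>)) s"
      using cons_iff[OF \<omega> c] play_consistent[OF comp a b z] by simp_all
  qed
  then have out: "?fix (outcome ?M T t \<alpha> \<beta>)"
    unfolding outcome_def by (rule someI[of ?fix])
  have eq: "trajectory f T t x (fst (outcome ?M T t \<alpha> \<beta> \<omega>)) (snd (outcome ?M T t \<alpha> \<beta> \<omega>)) T =
      trajectory f T t x (?u (signal \<omega>)) (?v (signal \<omega>)) T" if \<omega>: "\<omega> \<in> space ?M" for \<omega>
  proof -
    let ?u' = "fst (outcome ?M T t \<alpha> \<beta> \<omega>)" and ?v' = "snd (outcome ?M T t \<alpha> \<beta> \<omega>)"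
    have z: "signal \<omega> \<in> space (PiM signals (\<lambda>_. borel))" using measurable_space[OF sig \<omega>] .
    have "outcome ?M T t \<alpha> \<beta> \<omega> \<in> space ?C" using measurable_space[of _ ?M ?C, OF _ \<omega>] out by blast
    then have c: "?u' \<in> controls t T" "?v' \<in> controls t T"
      by (auto simp: space_pair_measure space_control_algebra)
    have "consistent 1 2 a b (signal \<omega>) ?u' ?v'"
      unfolding cons_iff[OF \<omega> c] using out \<omega> by blast
    from consistent_unique[OF a b this play_consistent[OF comp a b z]]
    have "AE s in lebesgue_on {t..T}. ?u' s = ?u (signal \<omega>) s \<and> ?v' s = ?v (signal \<omega>) s" .
    then show ?thesis
      by (intro trajectory_cong_AE c play_controls[OF comp a b order_refl z])
        (use t_less_T in \<open>auto simp: eventually_conj_iff\<close>)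
  qed
  have T: "T \<in> {t..T}" using t_less_T by simp
  have meas: "(\<lambda>z. g (trajectory f T t x (?u z) (?v z) T)) \<in> borel_measurable (PiM signals (\<lambda>_. borel))"
    by (rule measurable_compose[OF measurable_trajectory[OF mp T] g])
  have "payoff f g ?M T t x \<alpha> \<beta> = (\<integral>\<omega>. g (trajectory f T t x (?u (signal \<omega>)) (?v (signal \<omega>)) T) \<partial>?M)"
    unfolding payoff_def using t_less_T eq by (simp cong: Bochner_Integration.integral_cong)
  also have "\<dots> = (\<integral>z. g (trajectory f T t x (?u z) (?v z) T) \<partial>distr ?M (PiM signals (\<lambda>_. borel)) signal)"
    by (rule integral_distr[OF sig meas, symmetric])
  also have "distr ?M (PiM signals (\<lambda>_. borel)) signal = law"
    unfolding signal_def[abs_def] by (rule distr_signals[OF W partition len])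
  finally show ?thesis .
qed

text \<open>
  Together with \<open>trajectory_swap\<close> this exchanges the roles of the two players, so
  that the punishing strategy has to be constructed for one of them only.
\<close>
lemma play_swap:
  fixes a :: "nat \<Rightarrow> (2 \<times> nat \<Rightarrow> real) \<Rightarrow> (real \<Rightarrow> 'b) \<Rightarrow> real \<Rightarrow> 'a"
  shows "fst (play q p b a m z) = snd (play p q a b m z)" "snd (play q p b a m z) = fst (play p q a b m z)"
proof -
  have "fst (play q p b a m z) = snd (play p q a b m z) \<and> snd (play q p b a m z) = fst (play p q a b m z)"
  proof (induction m)
    case (Suc m)
    show ?case unfolding play.simps fst_conv snd_conv
      by (simp only: Suc.IH[THEN conjunct1] Suc.IH[THEN conjunct2])
  qed simp
  then show "fst (play q p b a m z) = snd (play p q a b m z)" "snd (play q p b a m z) = fst (play p q a b m z)" by auto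
qed

end

lemma trajectory_swap: "trajectory (\<lambda>x v u. f x u v) T t x v u = trajectory f T t x u v"
  by (simp add: trajectory_def)

section \<open>Relaxed actions and approximate saddle points\<close>
text \<open>
  A relaxed action is a probability measure on the actions. Finitely supported measures with
  rational weights suffice here; they are represented by the uniform distribution on the values of
  a function at \<open>0, \<dots>, n\<close>, repetitions allowed.
\<close>
type_synonym 'a relaxed = "nat \<times> (nat \<Rightarrow> 'a)"

definition avg :: "'a relaxed \<Rightarrow> ('a \<Rightarrow> 'b::real_vector) \<Rightarrow> 'b" where
  "avg \<mu> \<phi> = (\<Sum>i\<le>fst \<mu>. \<phi> (snd \<mu> i)) /\<^sub>R real (Suc (fst \<mu>))"

lemma avg_const: "avg \<mu> (\<lambda>_. c) = c"
  by (simp add: avg_def sum_constant_scaleR del: sum_constant of_nat_Suc)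

lemma avg_add: "avg \<mu> (\<lambda>x. \<phi> x + \<psi> x) = avg \<mu> \<phi> + avg \<mu> \<psi>"
  by (simp add: avg_def sum.distrib scaleR_add_right)

lemma avg_diff: "avg \<mu> (\<lambda>x. \<phi> x - \<psi> x) = avg \<mu> \<phi> - avg \<mu> \<psi>"
  by (simp add: avg_def sum_subtractf scaleR_diff_right)

lemma avg_mono: "(\<And>x. \<phi> x \<le> \<psi> x) \<Longrightarrow> avg \<mu> \<phi> \<le> (avg \<mu> \<psi> :: real)"
  by (auto simp: avg_def intro!: mult_left_mono sum_mono)

lemma avg_linear: "linear h \<Longrightarrow> h (avg \<mu> \<phi>) = avg \<mu> (\<lambda>x. h (\<phi> x))"
  by (simp add: avg_def linear_scale linear_sum o_def)

lemma avg_swap: "avg \<mu> (\<lambda>x. avg \<nu> (\<lambda>y. \<phi> x y)) = avg \<nu> (\<lambda>y. avg \<mu> (\<lambda>x. \<phi> x y))"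
  by (simp add: avg_def scaleR_sum_right) (subst sum.swap, simp add: mult.commute)

lemma norm_avg_le:
  assumes "\<And>x. norm (\<phi> x) \<le> K"
  shows "norm (avg \<mu> \<phi> :: 'b::real_normed_vector) \<le> K"
proof -
  have "norm (avg \<mu> \<phi>) \<le> avg \<mu> (\<lambda>x. norm (\<phi> x))"
    unfolding avg_def by (auto intro!: mult_left_mono sum_norm_le)
  also have "\<dots> \<le> avg \<mu> (\<lambda>_. K)" using assms by (rule avg_mono)
  finally show ?thesis by (simp add: avg_const)
qed

lemma relaxed_of_weights:
  assumes "finite V" "(\<Sum>v\<in>V. m v) > (0::nat)"
  shows "\<exists>\<nu>. \<forall>\<phi>::'v \<Rightarrow> real. avg \<nu> \<phi> = (\<Sum>v\<in>V. real (m v) * \<phi> v) / real (\<Sum>v\<in>V. m v)"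
proof -
  have "\<exists>xs. length xs = (\<Sum>v\<in>V. m v) \<and> (\<forall>\<phi>::'v \<Rightarrow> real. (\<Sum>x\<leftarrow>xs. \<phi> x) = (\<Sum>v\<in>V. real (m v) * \<phi> v))"
    using assms(1)
  proof (induction V)
    case (insert v V)
    then obtain xs where "length xs = (\<Sum>v\<in>V. m v)" "\<forall>\<phi>::'v \<Rightarrow> real. (\<Sum>x\<leftarrow>xs. \<phi> x) = (\<Sum>v\<in>V. real (m v) * \<phi> v)"
      by blast
    then show ?case using insert by (intro exI[of _ "replicate (m v) v @ xs"]) (simp add: sum_list_replicate)
  qed simp
  then obtain xs where xs: "length xs = (\<Sum>v\<in>V. m v)" "\<And>\<phi>::'v \<Rightarrow> real. (\<Sum>x\<leftarrow>xs. \<phi> x) = (\<Sum>v\<in>V. real (m v) * \<phi> v)"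
    by blast
  have n: "Suc (length xs - 1) = length xs" using assms(2) xs(1) by simp
  have "avg (length xs - 1, (!) xs) \<phi> = (\<Sum>x\<leftarrow>xs. \<phi> x) / real (length xs)" for \<phi> :: "'v \<Rightarrow> real"
  proof -
    have "{..length xs - 1} = {..<length xs}" using lessThan_Suc_atMost[of "length xs - 1"] unfolding n by (rule sym)
    then show ?thesis
      unfolding avg_def fst_conv snd_conv n
      by (simp add: sum_list_sum_nth atLeast0LessThan divide_inverse mult.commute)
  qed
  then show ?thesis using xs by metis
qed

text \<open>
  Blackwell's approachability of the negative orthant, which replaces the minimax theorem. If the
  minimizer can answer every mixed action of the opponent, then answering at each round the mixed
  action proportional to the positive parts of the accumulated payoffs keeps their squared norm
  below a constant times the number of rounds, so the average payoff vector approaches the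
  orthant. Integer payoffs keep these mixed actions rational.
\<close>
lemma blackwell:
  fixes A :: "'u \<Rightarrow> 'v \<Rightarrow> int"
  assumes fin: "finite V" and K: "\<And>u v. \<bar>A u v\<bar> \<le> K" and e: "e > 0"
    and resp: "\<And>m. (\<Sum>v\<in>V. m v) > (0::nat) \<Longrightarrow> \<exists>u. (\<Sum>v\<in>V. int (m v) * A u v) \<le> 0"
  shows "\<exists>\<mu>. \<forall>v\<in>V. avg \<mu> (\<lambda>u. real_of_int (A u v)) \<le> e"
proof -
  define next_u where "next_u S = (SOME u. (\<Sum>v\<in>V. int (nat (S v)) * A u v) \<le> 0)" for S :: "'v \<Rightarrow> int"
  define S where "S = rec_nat (\<lambda>_. 0 :: int) (\<lambda>_ S v. S v + A (next_u S) v)"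
  have S0: "S 0 v = 0" and SSuc: "S (Suc n) v = S n v + A (next_u (S n)) v" for n v by (simp_all add: S_def)
  have nu: "(\<Sum>v\<in>V. int (nat (S n v)) * A (next_u (S n)) v) \<le> 0" for n
  proof (cases "(\<Sum>v\<in>V. nat (S n v)) > 0")
    case True
    from someI_ex[OF resp[OF this]] show ?thesis unfolding next_u_def .
  next
    case False
    then have "\<forall>v\<in>V. nat (S n v) = 0" using fin by simp
    then show ?thesis by simp
  qed
  have K0: "0 \<le> K" using K[of undefined undefined] by linarith
  have bd: "(\<Sum>v\<in>V. (int (nat (S n v)))\<^sup>2) \<le> int n * (int (card V) * K\<^sup>2)" for n
  proof (induction n)
    case (Suc n)
    have "(int (nat (S (Suc n) v)))\<^sup>2 \<le> (int (nat (S n v)))\<^sup>2 + 2 * (int (nat (S n v)) * A (next_u (S n)) v) + K\<^sup>2" for v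
    proof -
      let ?a = "A (next_u (S n)) v" and ?s = "int (nat (S n v))"
      have "int (nat (S n v + ?a)) \<le> \<bar>?s + ?a\<bar>" by linarith
      then have "(int (nat (S n v + ?a)))\<^sup>2 \<le> (?s + ?a)\<^sup>2" by (simp add: abs_le_square_iff[symmetric])
      also have "\<dots> = ?s\<^sup>2 + 2 * (?s * ?a) + ?a\<^sup>2" by (simp add: power2_sum)
      also have "?a\<^sup>2 \<le> K\<^sup>2" using K[of "next_u (S n)" v] K0 by (simp add: abs_le_square_iff[symmetric])
      finally show ?thesis by (simp add: SSuc)
    qed
    then have "(\<Sum>v\<in>V. (int (nat (S (Suc n) v)))\<^sup>2)
        \<le> (\<Sum>v\<in>V. (int (nat (S n v)))\<^sup>2 + 2 * (int (nat (S n v)) * A (next_u (S n)) v) + K\<^sup>2)"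
      by (rule sum_mono)
    also have "\<dots> = (\<Sum>v\<in>V. (int (nat (S n v)))\<^sup>2) + 2 * (\<Sum>v\<in>V. int (nat (S n v)) * A (next_u (S n)) v) + int (card V) * K\<^sup>2"
      by (simp add: sum.distrib sum_distrib_left)
    also have "\<dots> \<le> int n * (int (card V) * K\<^sup>2) + int (card V) * K\<^sup>2" using Suc.IH nu[of n] by linarith
    finally show ?case by (simp add: algebra_simps)
  qed (simp add: S0)
  define B where "B = real (card V) * (real_of_int K)\<^sup>2"
  obtain n where n: "B / e\<^sup>2 < real (Suc n)" using reals_Archimedean2 by (metis less_Suc_eq of_nat_less_iff order_less_trans)
  let ?\<mu> = "(n, \<lambda>i. next_u (S i))"
  have sumS: "real_of_int (S (Suc n) v) = (\<Sum>i\<le>n. real_of_int (A (next_u (S i)) v))" for v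
  proof -
    have "S m v = (\<Sum>i<m. A (next_u (S i)) v)" for m
      by (induction m) (simp_all add: S0 SSuc cong del: sum.cong)
    from this[of "Suc n"] show ?thesis unfolding lessThan_Suc_atMost by simp
  qed
  have "avg ?\<mu> (\<lambda>u. real_of_int (A u v)) \<le> e" if v: "v \<in> V" for v
  proof (rule ccontr)
    assume "\<not> ?thesis"
    then have "e < real_of_int (S (Suc n) v) / real (Suc n)"
      unfolding avg_def fst_conv snd_conv sumS by (simp add: divide_inverse mult.commute del: of_nat_Suc)
    then have lt: "e * real (Suc n) < real_of_int (S (Suc n) v)" by (simp add: field_simps del: of_nat_Suc)
    then have pos: "S (Suc n) v > 0" using e by (smt (verit) mult_nonneg_nonneg of_int_0_less_iff of_nat_0_le_iff)
    have "(e * real (Suc n))\<^sup>2 < (real_of_int (S (Suc n) v))\<^sup>2"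
      using lt e by (intro power_strict_mono) auto
    also have "\<dots> = real_of_int ((int (nat (S (Suc n) v)))\<^sup>2)" using pos by simp
    also have "(int (nat (S (Suc n) v)))\<^sup>2 \<le> (\<Sum>v\<in>V. (int (nat (S (Suc n) v)))\<^sup>2)"
      using v fin by (intro member_le_sum) auto
    also note bd[of "Suc n"]
    also have "real_of_int (int (Suc n) * (int (card V) * K\<^sup>2)) = real (Suc n) * B" by (simp add: B_def)
    finally have "e\<^sup>2 * real (Suc n) * real (Suc n) < B * real (Suc n)"
      by (simp add: power_mult_distrib power2_eq_square algebra_simps del: of_nat_Suc)
    then have "e\<^sup>2 * real (Suc n) < B" by (simp del: of_nat_Suc)
    then show False using n e by (simp add: field_simps del: of_nat_Suc)
  qed
  then show ?thesis by blast
qed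

text \<open>
  Round the payoffs to multiples of \<open>\<eta>\<close> and let \<open>c\<close> be a threshold
  such that the minimizer can answer every mixed action with a payoff at most \<open>c\<close> but
  not always with a payoff at most \<open>c - 1\<close>. The former gives, by approachability, a
  mixed action of the minimizer that guarantees about \<open>c\<close>; a mixed action witnessing
  the latter guarantees about \<open>c - 1\<close> to the maximizer.
\<close>
lemma approximate_saddle:
  fixes A :: "'u \<Rightarrow> 'v \<Rightarrow> real"
  assumes fin: "finite V" and net: "\<And>v. \<exists>v'\<in>V. \<forall>u. \<bar>A u v - A u v'\<bar> \<le> \<eta>"
    and bound: "\<And>u v. \<bar>A u v\<bar> \<le> K" and \<eta>: "\<eta> > 0"
  shows "\<exists>\<mu> \<nu>. \<forall>u v. avg \<mu> (\<lambda>u. A u v) \<le> avg \<nu> (A u) + 5 * \<eta>"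
proof -
  define a where "a u v = \<lfloor>A u v / \<eta>\<rfloor>" for u v
  have a: "real_of_int (a u v) * \<eta> \<le> A u v" "A u v \<le> (real_of_int (a u v) + 1) * \<eta>" for u v
  proof -
    have "real_of_int (a u v) \<le> A u v / \<eta>" "A u v / \<eta> \<le> real_of_int (a u v) + 1" unfolding a_def by linarith+
    then show "real_of_int (a u v) * \<eta> \<le> A u v" "A u v \<le> (real_of_int (a u v) + 1) * \<eta>"
      using \<eta> by (simp_all add: field_simps)
  qed
  obtain N :: nat where N: "K / \<eta> + 1 < real N" using reals_Archimedean2 by blast
  have aN: "\<bar>a u v\<bar> \<le> int N" for u v
  proof -
    have "\<bar>A u v / \<eta>\<bar> \<le> K / \<eta>" using bound[of u v] \<eta> by (simp add: divide_right_mono)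
    then have "\<bar>real_of_int (a u v)\<bar> \<le> real N" using N unfolding a_def by linarith
    then show ?thesis by linarith
  qed
  \<comment> \<open>Mixed actions on V are given by integer weights m.\<close>
  define good where "good c \<longleftrightarrow> (\<forall>m. (\<Sum>v\<in>V. m v) > (0::nat) \<longrightarrow> (\<exists>u. (\<Sum>v\<in>V. int (m v) * (a u v - c)) \<le> 0))" for c
  have goodN: "good (int N)"
    unfolding good_def
  proof (intro allI impI)
    fix m show "\<exists>u. (\<Sum>v\<in>V. int (m v) * (a u v - int N)) \<le> 0"
      by (rule exI, rule sum_nonpos, rule mult_nonneg_nonpos) (use aN in \<open>auto simp: abs_le_iff\<close>)
  qed
  obtain v0 where v0: "v0 \<in> V" using net by blast
  have badN: "\<not> good (- int N - 1)"
  proof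
    assume "good (- int N - 1)"
    then obtain u where "(\<Sum>v\<in>V. int (if v = v0 then 1 else 0) * (a u v - (- int N - 1))) \<le> 0"
      unfolding good_def using fin v0 by (auto elim!: allE[of _ "\<lambda>v. if v = v0 then 1 else 0"])
    moreover have "(\<Sum>v\<in>V. int (if v = v0 then 1 else 0) * (a u v - (- int N - 1))) = a u v0 + int N + 1"
      using fin v0 by (simp add: if_distrib[of int] if_distrib[of "\<lambda>x. x * _"] cong: if_cong)
    ultimately show False using aN[of u v0] by linarith
  qed
  have "\<exists>c. good c \<and> \<not> good (c - 1)"
  proof (rule ccontr)
    assume "\<not> ?thesis"
    then have down: "good c \<Longrightarrow> good (c - 1)" for c by blast
    have desc: "good (int N - int j)" for j
    proof (induction j)
      case (Suc j)
      have "int N - int (Suc j) = int N - int j - 1" by simp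
      with down[OF Suc.IH] show ?case by (simp only:)
    qed (use goodN in simp)
    have "int N - int (2 * N + 1) = - int N - 1" by simp
    with desc[of "2 * N + 1"] badN show False by (simp only:)
  qed
  then obtain c where c: "good c" "\<not> good (c - 1)" by blast
  have "\<exists>\<mu>. \<forall>v\<in>V. avg \<mu> (\<lambda>u. real_of_int (a u v - c)) \<le> 1"
  proof (rule blackwell[OF fin])
    show "\<bar>a u v - c\<bar> \<le> int N + \<bar>c\<bar>" for u v using aN[of u v] by linarith
  qed (use c(1) in \<open>auto simp: good_def\<close>)
  then obtain \<mu> where \<mu>: "\<And>v. v \<in> V \<Longrightarrow> avg \<mu> (\<lambda>u. real_of_int (a u v - c)) \<le> 1" by blast
  obtain m where m: "(\<Sum>v\<in>V. m v) > (0::nat)" "\<And>u. (\<Sum>v\<in>V. int (m v) * (a u v - (c - 1))) > 0"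
    using c(2) unfolding good_def by (auto simp: not_le)
  obtain \<nu> where \<nu>: "\<And>\<phi>::'v \<Rightarrow> real. avg \<nu> \<phi> = (\<Sum>v\<in>V. real (m v) * \<phi> v) / real (\<Sum>v\<in>V. m v)"
    using relaxed_of_weights[OF fin m(1)] by blast
  have up: "avg \<mu> (\<lambda>u. A u v) \<le> (real_of_int c + 3) * \<eta>" for v
  proof -
    obtain v' where v': "v' \<in> V" "\<And>u. \<bar>A u v - A u v'\<bar> \<le> \<eta>" using net by blast
    have "A u v \<le> \<eta> * real_of_int (a u v' - c) + (real_of_int c + 2) * \<eta>" for u
      using v'(2)[of u] a(2)[of u v'] by (simp add: algebra_simps)
    then have "avg \<mu> (\<lambda>u. A u v) \<le> avg \<mu> (\<lambda>u. \<eta> * real_of_int (a u v' - c) + (real_of_int c + 2) * \<eta>)" by (rule avg_mono)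
    also have "\<dots> = \<eta> * avg \<mu> (\<lambda>u. real_of_int (a u v' - c)) + (real_of_int c + 2) * \<eta>"
      unfolding avg_add avg_const using avg_linear[of "\<lambda>x. \<eta> * x" \<mu> "\<lambda>u. real_of_int (a u v' - c)"] by simp
    also have "\<dots> \<le> \<eta> * 1 + (real_of_int c + 2) * \<eta>" using \<mu>[OF v'(1)] \<eta> by (intro add_right_mono mult_left_mono) auto
    finally show ?thesis by (simp add: algebra_simps)
  qed
  have low: "(real_of_int c - 1) * \<eta> \<le> avg \<nu> (A u)" for u
  proof -
    have "0 \<le> real_of_int (\<Sum>v\<in>V. int (m v) * (a u v - (c - 1)))" using m(2)[of u] by linarith
    then have num: "0 \<le> (\<Sum>v\<in>V. real (m v) * real_of_int (a u v - (c - 1)))" by simp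
    have "0 \<le> avg \<nu> (\<lambda>v. real_of_int (a u v - (c - 1)))"
      unfolding \<nu> by (rule divide_nonneg_nonneg[OF num of_nat_0_le_iff])
    then have "0 \<le> \<eta> * avg \<nu> (\<lambda>v. real_of_int (a u v - (c - 1)))" using \<eta> by simp
    also have "\<dots> = avg \<nu> (\<lambda>v. \<eta> * real_of_int (a u v - (c - 1)))"
      using avg_linear[of "\<lambda>x. \<eta> * x"] by simp
    also have "\<dots> \<le> avg \<nu> (\<lambda>v. A u v - (real_of_int c - 1) * \<eta>)"
      by (rule avg_mono) (use a(1) in \<open>simp add: algebra_simps\<close>)
    also have "\<dots> = avg \<nu> (A u) - (real_of_int c - 1) * \<eta>" by (simp add: avg_diff avg_const)
    finally show ?thesis by simp
  qed
  have "avg \<mu> (\<lambda>u. A u v) \<le> avg \<nu> (A u) + 5 * \<eta>" for u v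
    using up[of v] low[of u] \<eta> by (simp add: algebra_simps)
  then show ?thesis by blast
qed

section \<open>Guide values and the plan\<close>
definition relaxed_field :: "('x \<Rightarrow> 'u \<Rightarrow> 'v \<Rightarrow> 'b::real_vector) \<Rightarrow> 'x \<Rightarrow> 'u relaxed \<Rightarrow> 'v relaxed \<Rightarrow> 'b" where
  "relaxed_field f x \<mu> \<nu> = avg \<mu> (\<lambda>u. avg \<nu> (\<lambda>v. f x u v))"

lemma relaxed_field_swap: "relaxed_field (\<lambda>x v u. f x u v) x \<nu> \<mu> = relaxed_field f x \<mu> \<nu>"
  unfolding relaxed_field_def by (rule avg_swap)

text \<open>
  What a player with terminal payoff \<open>g\<close> can secure in \<open>j\<close> steps of
  length \<open>h\<close> if this player chooses a relaxed action first and the opponent answers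
  it with a relaxed action. The guide of the punishing strategy moves by the very steps of this
  recursion; it is compared with the true position only at the terminal time, where the value is
  \<open>g\<close>.
\<close>
primrec guide_value :: "('x::real_vector \<Rightarrow> 'u \<Rightarrow> 'v \<Rightarrow> 'x) \<Rightarrow> real \<Rightarrow> ('x \<Rightarrow> real) \<Rightarrow> nat \<Rightarrow> 'x \<Rightarrow> real" where
  "guide_value f h g 0 x = g x"
| "guide_value f h g (Suc j) x = (SUP \<nu>. INF \<mu>. guide_value f h g j (x + h *\<^sub>R relaxed_field f x \<mu> \<nu>))"

context
  fixes f :: "'x::real_vector \<Rightarrow> 'u \<Rightarrow> 'v \<Rightarrow> 'x" and h :: real and g :: "'x \<Rightarrow> real" and K :: real
  assumes gK: "\<And>x. \<bar>g x\<bar> \<le> K"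
begin

lemma guide_value_bounded: "\<bar>guide_value f h g j x\<bar> \<le> K"
proof (induction j arbitrary: x)
  case (Suc j)
  let ?w = "\<lambda>\<mu> \<nu>. guide_value f h g j (x + h *\<^sub>R relaxed_field f x \<mu> \<nu>)"
  have w: "- K \<le> ?w \<mu> \<nu>" "?w \<mu> \<nu> \<le> K" for \<mu> \<nu> using Suc.IH by (auto simp: abs_le_iff minus_le_iff)
  have I1: "- K \<le> (INF \<mu>. ?w \<mu> \<nu>)" for \<nu> by (rule cINF_greatest) (use w in auto)
  have bI: "bdd_below (range (\<lambda>\<mu>. ?w \<mu> \<nu>))" for \<nu> using w(1) by (intro bdd_belowI2[of UNIV "- K"])
  have I2: "(INF \<mu>. ?w \<mu> \<nu>) \<le> K" for \<nu>
    using cINF_lower[OF bI, of undefined \<nu>] w(2)[of undefined \<nu>] by simp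
  have bS: "bdd_above (range (\<lambda>\<nu>. INF \<mu>. ?w \<mu> \<nu>))" using I2 by (intro bdd_aboveI2)
  have "- K \<le> (SUP \<nu>. INF \<mu>. ?w \<mu> \<nu>)"
    using cSUP_upper[OF _ bS, of undefined] I1[of undefined] by simp
  moreover have "(SUP \<nu>. INF \<mu>. ?w \<mu> \<nu>) \<le> K" by (rule cSUP_least) (use I2 in auto)
  ultimately show ?case by (simp add: abs_le_iff)
qed (use gK in simp)

lemma guide_value_stable:
  assumes "e > 0"
  shows "\<exists>\<mu>. guide_value f h g j (x + h *\<^sub>R relaxed_field f x \<mu> \<nu>) \<le> guide_value f h g (Suc j) x + e"
proof -
  let ?w = "\<lambda>\<mu> \<nu>. guide_value f h g j (x + h *\<^sub>R relaxed_field f x \<mu> \<nu>)"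
  have w: "- K \<le> ?w \<mu> \<nu>" "?w \<mu> \<nu> \<le> K" for \<mu> \<nu> using guide_value_bounded[of j] by (auto simp: abs_le_iff minus_le_iff)
  have bI: "bdd_below (range (\<lambda>\<mu>. ?w \<mu> \<nu>))" for \<nu> using w(1) by (intro bdd_belowI2[of UNIV "- K"])
  have I2: "(INF \<mu>. ?w \<mu> \<nu>) \<le> K" for \<nu>
    using cINF_lower[OF bI, of undefined \<nu>] w(2)[of undefined \<nu>] by simp
  have "(INF \<mu>. ?w \<mu> \<nu>) \<le> guide_value f h g (Suc j) x"
    unfolding guide_value.simps by (rule cSUP_upper[OF UNIV_I]) (use I2 in \<open>intro bdd_aboveI2\<close>)
  then have "(INF \<mu>. ?w \<mu> \<nu>) < guide_value f h g (Suc j) x + e" using assms by linarith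
  then obtain \<mu> where "?w \<mu> \<nu> < guide_value f h g (Suc j) x + e"
    using cINF_less_iff[OF _ bI] by auto
  then show ?thesis by (intro exI[of _ \<mu>]) simp
qed

lemma guide_value_secure:
  assumes "e > 0"
  shows "\<exists>\<nu>. \<forall>\<mu>. guide_value f h g (Suc j) x \<le> guide_value f h g j (x + h *\<^sub>R relaxed_field f x \<mu> \<nu>) + e"
proof -
  let ?w = "\<lambda>\<mu> \<nu>. guide_value f h g j (x + h *\<^sub>R relaxed_field f x \<mu> \<nu>)"
  have w: "- K \<le> ?w \<mu> \<nu>" "?w \<mu> \<nu> \<le> K" for \<mu> \<nu> using guide_value_bounded[of j] by (auto simp: abs_le_iff minus_le_iff)
  have bI: "bdd_below (range (\<lambda>\<mu>. ?w \<mu> \<nu>))" for \<nu> using w(1) by (intro bdd_belowI2[of UNIV "- K"])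
  have I2: "(INF \<mu>. ?w \<mu> \<nu>) \<le> K" for \<nu>
    using cINF_lower[OF bI, of undefined \<nu>] w(2)[of undefined \<nu>] by simp
  have bS: "bdd_above (range (\<lambda>\<nu>. INF \<mu>. ?w \<mu> \<nu>))" using I2 by (intro bdd_aboveI2)
  have "guide_value f h g (Suc j) x - e < (SUP \<nu>. INF \<mu>. ?w \<mu> \<nu>)" using assms by simp
  then obtain \<nu> where \<nu>: "guide_value f h g (Suc j) x - e < (INF \<mu>. ?w \<mu> \<nu>)"
    using less_cSUP_iff[OF _ bS] by auto
  have "guide_value f h g (Suc j) x \<le> ?w \<mu> \<nu> + e" for \<mu>
    using \<nu> cINF_lower[OF bI, of \<mu> \<nu>] by simp
  then show ?thesis by blast
qed

end

text \<open>
  The first alternative in \<open>step\<close> allows the quantity to be reset to a small value;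
  this happens as long as no deviation has been detected.
\<close>
lemma discrete_gronwall:
  fixes d :: "nat \<Rightarrow> real"
  assumes "a \<ge> 0" "b \<ge> 0" "c \<ge> 0" "d 0 \<le> c"
    and step: "\<And>i. i < m \<Longrightarrow> d (Suc i) \<le> c \<or> d (Suc i) \<le> (1 + a) * d i + b"
  shows "i \<le> m \<Longrightarrow> d i \<le> exp (a * real i) * (c + real i * b)"
proof (induction i)
  case (Suc i)
  let ?E = "exp (a * real i)" and ?E' = "exp (a * real (Suc i))"
  have E1: "1 \<le> ?E'" using assms(1) by (simp del: of_nat_Suc)
  have E: "(1 + a) * ?E \<le> ?E'"
  proof -
    have "a * real (Suc i) = a + a * real i" by (simp add: distrib_left)
    then have "?E' = exp a * ?E" by (simp only: exp_add)
    then show ?thesis using exp_ge_add_one_self[of a] by (simp add: mult_right_mono)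
  qed
  from step[of i] Suc.prems consider "d (Suc i) \<le> c" | "d (Suc i) \<le> (1 + a) * d i + b" by auto
  then show ?case
  proof cases
    case 1
    have "c \<le> 1 * (c + real (Suc i) * b)" using assms by simp
    also have "\<dots> \<le> ?E' * (c + real (Suc i) * b)" using E1 assms by (intro mult_right_mono) auto
    finally show ?thesis using 1 by linarith
  next
    case 2
    have "(1 + a) * d i \<le> (1 + a) * (?E * (c + real i * b))" using Suc assms by (intro mult_left_mono) auto
    also have "\<dots> = ((1 + a) * ?E) * (c + real i * b)" by simp
    also have "\<dots> \<le> ?E' * (c + real i * b)" using E assms by (intro mult_right_mono) auto
    finally have "(1 + a) * d i \<le> ?E' * (c + real i * b)" .
    moreover have "b \<le> ?E' * b" using mult_right_mono[OF E1, of b] assms by simp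
    moreover have "?E' * (c + real i * b) + ?E' * b = ?E' * (c + real (Suc i) * b)" by (simp add: algebra_simps)
    ultimately show ?thesis using 2 by linarith
  qed
qed (use assms in simp)

text \<open>
  The step \<open>i\<close> of length \<open>h\<close> is divided into \<open>n i\<close> cells,
  on which the actions \<open>w i c\<close> are played in turn.
\<close>
definition chatter :: "real \<Rightarrow> real \<Rightarrow> (nat \<Rightarrow> nat) \<Rightarrow> (nat \<Rightarrow> nat \<Rightarrow> 'a) \<Rightarrow> real \<Rightarrow> 'a" where
  "chatter t h n w s = (let i = nat \<lfloor>(s - t) / h\<rfloor> in w i (nat \<lfloor>(s - (t + real i * h)) * real (n i) / h\<rfloor>))"

lemma measurable_chatter: "chatter t h n w \<in> borel_measurable borel"
proof -
  have 1: "(\<lambda>s. nat \<lfloor>(s - t) / h\<rfloor>) \<in> measurable borel (count_space UNIV)" by measurable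
  have 2: "(\<lambda>s. w i (nat \<lfloor>(s - (t + real i * h)) * real (n i) / h\<rfloor>)) \<in> borel_measurable borel" for i
  proof -
    have "(\<lambda>s. nat \<lfloor>(s - (t + real i * h)) * real (n i) / h\<rfloor>) \<in> measurable borel (count_space UNIV)" by measurable
    from measurable_compose[OF this, of "w i" borel] show ?thesis by simp
  qed
  show ?thesis unfolding chatter_def Let_def by (rule measurable_compose_countable[OF 2 1])
qed

lemma chatter_cell:
  assumes h: "h > 0" and c: "c < n i"
    and s: "s \<in> {t + real i * h + real c * (h / real (n i))..<t + real i * h + real (Suc c) * (h / real (n i))}"
  shows "chatter t h n w s = w i c"
proof -
  have n: "real (n i) > 0" using c by simp
  have le: "real (Suc c) * (h / real (n i)) \<le> h"
  proof -
    have "real (Suc c) * h \<le> real (n i) * h" using c h by (intro mult_right_mono) auto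
    then show ?thesis using n by (simp add: field_simps)
  qed
  have lo: "0 \<le> real c * (h / real (n i))" using h by simp
  have "\<lfloor>(s - t) / h\<rfloor> = int i"
  proof (rule floor_unique)
    from s have "t + real i * h + real c * (h / real (n i)) \<le> s" "s < t + real i * h + real (Suc c) * (h / real (n i))"
      by (simp_all only: atLeastLessThan_iff)
    with lo le have "real i * h \<le> s - t" "s - t < real i * h + h" by linarith+
    then show "real_of_int (int i) \<le> (s - t) / h" using h by (simp add: field_simps)
    from \<open>s - t < real i * h + h\<close> show "(s - t) / h < real_of_int (int i) + 1" using h by (simp add: field_simps)
  qed
  moreover have "\<lfloor>(s - (t + real i * h)) * real (n i) / h\<rfloor> = int c"
  proof (rule floor_unique)
    have "real c * (h / real (n i)) \<le> s - (t + real i * h)" "s - (t + real i * h) < real (Suc c) * (h / real (n i))"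
      using s by auto
    then show "real_of_int (int c) \<le> (s - (t + real i * h)) * real (n i) / h"
      "(s - (t + real i * h)) * real (n i) / h < real_of_int (int c) + 1"
      using n h by (simp_all add: field_simps)
  qed
  ultimately show ?thesis by (simp add: chatter_def)
qed

lemma sum_div_mod:
  fixes \<phi> :: "nat \<Rightarrow> nat \<Rightarrow> 'b::comm_monoid_add"
  shows "(\<Sum>c<n * m. \<phi> (c div m) (c mod m)) = (\<Sum>a<n. \<Sum>b<m. \<phi> a b)"
proof (cases "m = 0")
  case False
  have "(\<Sum>c<n * m. \<phi> (c div m) (c mod m)) = (\<Sum>a<n. \<Sum>c\<in>{a * m..<a * m + m}. \<phi> (c div m) (c mod m))"
    by (rule sum.nat_group[symmetric])
  also have "\<dots> = (\<Sum>a<n. \<Sum>b<m. \<phi> a b)"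
  proof (rule sum.cong[OF refl])
    fix a
    have "(\<Sum>c\<in>{a * m..<a * m + m}. \<phi> (c div m) (c mod m)) = (\<Sum>b\<in>{0..<m}. \<phi> ((b + a * m) div m) ((b + a * m) mod m))"
      using sum.shift_bounds_nat_ivl[of "\<lambda>c. \<phi> (c div m) (c mod m)" 0 "a * m" m] by (simp add: add.commute)
    also have "\<dots> = (\<Sum>b<m. \<phi> a b)"
      using False by (intro sum.cong) auto
    finally show "(\<Sum>c\<in>{a * m..<a * m + m}. \<phi> (c div m) (c mod m)) = (\<Sum>b<m. \<phi> a b)" .
  qed
  finally show ?thesis .
qed simp

lemma borel_controls: "u \<in> borel_measurable borel \<Longrightarrow> u \<in> controls t T"
  unfolding controls_def using measurable_compose[OF id_measurable_lebesgue_on measurable_restrict_space1] by blast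

context dynamics
begin

lemma norm_relaxed_field: "norm (relaxed_field f x \<mu> \<nu>) \<le> C"
  unfolding relaxed_field_def by (intro norm_avg_le bounded)

lemma relaxed_field_lipschitz: "norm (relaxed_field f x \<mu> \<nu> - relaxed_field f y \<mu> \<nu>) \<le> L * norm (x - y)"
  unfolding relaxed_field_def avg_diff[symmetric] by (intro norm_avg_le lip)

text \<open>
  A pair of independent relaxed actions is realized by running through all pairs of actions,
  enumerated by quotient and remainder.
\<close>
definition plan_u where
  "plan_u t h \<mu> \<nu> = chatter t h (\<lambda>i. Suc (fst (\<mu> i)) * Suc (fst (\<nu> i))) (\<lambda>i c. snd (\<mu> i :: 'u relaxed) (c div Suc (fst (\<nu> i :: 'v relaxed))))"

definition plan_v where
  "plan_v t h \<mu> \<nu> = chatter t h (\<lambda>i. Suc (fst (\<mu> i)) * Suc (fst (\<nu> i))) (\<lambda>i c. snd (\<nu> i :: 'v relaxed) (c mod Suc (fst (\<nu> i :: 'v relaxed))))"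

text \<open>
  With the state frozen, chattering produces exactly the relaxed field over one step.
\<close>
lemma plan_integral:
  fixes \<mu> :: "nat \<Rightarrow> 'u relaxed" and \<nu> :: "nat \<Rightarrow> 'v relaxed"
  assumes h: "h > 0"
  shows "(LINT s:{t + real i * h..t + real (Suc i) * h}|lebesgue. f x (plan_u t h \<mu> \<nu> s) (plan_v t h \<mu> \<nu> s)) =
    h *\<^sub>R relaxed_field f x (\<mu> i) (\<nu> i)"
proof -
  let ?n = "Suc (fst (\<mu> i))" and ?m = "Suc (fst (\<nu> i))" and ?u = "plan_u t h \<mu> \<nu>" and ?v = "plan_v t h \<mu> \<nu>"
  define N where "N = ?n * ?m"
  define \<delta> where "\<delta> = h / real N"
  have N: "real N > 0" by (simp add: N_def del: of_nat_mult of_nat_Suc)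
  have \<delta>: "\<delta> > 0" using h N by (simp add: \<delta>_def)
  let ?a = "t + real i * h"
  let ?\<phi> = "\<lambda>c. f x (snd (\<mu> i) (c div ?m)) (snd (\<nu> i) (c mod ?m))"
  have int: "set_integrable lebesgue {a..b} (\<lambda>s. f x (?u s) (?v s))" for a b
    by (rule set_integrable_f[of _ a b]) (auto simp: plan_u_def plan_v_def intro!: borel_controls measurable_chatter)
  have "(LINT s:{?a..?a + real c * \<delta>}|lebesgue. f x (?u s) (?v s)) = \<delta> *\<^sub>R (\<Sum>c'<c. ?\<phi> c')" if "c \<le> N" for c
    using that
  proof (induction c)
    case 0
    have "norm (LINT s:{?a..?a}|lebesgue. f x (?u s) (?v s)) \<le> (?a - ?a) * C"
      by (rule norm_set_integral_le) (use bounded in auto)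
    then show ?case by simp
  next
    case (Suc c)
    have le: "?a \<le> ?a + real c * \<delta>" "?a + real c * \<delta> \<le> ?a + real (Suc c) * \<delta>" using \<delta> by (auto simp: algebra_simps)
    have "AE s in lebesgue_on {?a + real c * \<delta>..?a + real (Suc c) * \<delta>}. f x (?u s) (?v s) = ?\<phi> c"
    proof (rule AE_lebesgue_on_Ico)
      fix s assume s: "s \<in> {?a + real c * \<delta>..<?a + real (Suc c) * \<delta>}"
      have "?u s = snd (\<mu> i) (c div ?m)" unfolding plan_u_def
        by (rule chatter_cell[OF h]) (use Suc.prems s in \<open>auto simp: N_def \<delta>_def\<close>)
      moreover have "?v s = snd (\<nu> i) (c mod ?m)" unfolding plan_v_def
        by (rule chatter_cell[OF h]) (use Suc.prems s in \<open>auto simp: N_def \<delta>_def\<close>)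
      ultimately show "f x (?u s) (?v s) = ?\<phi> c" by simp
    qed
    then have "(LINT s:{?a + real c * \<delta>..?a + real (Suc c) * \<delta>}|lebesgue. f x (?u s) (?v s)) =
        (LINT s:{?a + real c * \<delta>..?a + real (Suc c) * \<delta>}|lebesgue. ?\<phi> c)"
      by (rule set_integral_cong_AE_on[OF _ int]) (rule set_integrable_bounded[of _ "?a + real c * \<delta>" "?a + real (Suc c) * \<delta>"], auto)
    also have "\<dots> = \<delta> *\<^sub>R ?\<phi> c" using set_integral_const[OF le(2), of "?\<phi> c"] by (simp add: algebra_simps)
    finally show ?case
      using set_integral_split[OF le int] Suc by (simp add: scaleR_add_right)
  qed
  from this[OF order_refl] have "(LINT s:{?a..?a + real N * \<delta>}|lebesgue. f x (?u s) (?v s)) = \<delta> *\<^sub>R (\<Sum>c'<N. ?\<phi> c')" .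
  also have "?a + real N * \<delta> = t + real (Suc i) * h" using N by (simp add: \<delta>_def algebra_simps)
  also have "(\<Sum>c'<N. ?\<phi> c') = (\<Sum>a<?n. \<Sum>b<?m. f x (snd (\<mu> i) a) (snd (\<nu> i) b))"
    unfolding N_def by (rule sum_div_mod)
  also have "\<delta> *\<^sub>R \<dots> = h *\<^sub>R relaxed_field f x (\<mu> i) (\<nu> i)"
  proof -
    have "inverse (real N) = inverse (real ?n) * inverse (real ?m)"
      by (simp only: N_def of_nat_mult inverse_mult_distrib)
    then show ?thesis
      unfolding relaxed_field_def avg_def lessThan_Suc_atMost \<delta>_def divide_inverse
      by (simp only: scaleR_sum_right[symmetric] scaleR_scaleR mult.assoc)
  qed
  finally show ?thesis .
qed

lemma plan_controls: "plan_u t h \<mu> \<nu> \<in> controls t' T" "plan_v t h \<mu> \<nu> \<in> controls t' T"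
  unfolding plan_u_def plan_v_def by (rule borel_controls, rule measurable_chatter)+

lemma plan_trajectory:
  fixes \<mu> :: "nat \<Rightarrow> 'u relaxed" and \<nu> :: "nat \<Rightarrow> 'v relaxed"
  assumes h: "h > 0" and T: "t + real m * h = T"
    and X: "X 0 = x" "\<And>i. i < m \<Longrightarrow> X (Suc i) = X i + h *\<^sub>R relaxed_field f (X i) (\<mu> i) (\<nu> i)"
    and i: "i \<le> m"
  shows "norm (trajectory f T t x (plan_u t h \<mu> \<nu>) (plan_v t h \<mu> \<nu>) (t + real i * h) - X i)
    \<le> exp (L * (T - t)) * (T - t) * L * C * h"
proof -
  let ?u = "plan_u t h \<mu> \<nu>" and ?v = "plan_v t h \<mu> \<nu>"
  let ?x = "trajectory f T t x ?u ?v"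
  note uv = plan_controls[of t h \<mu> \<nu> t T]
  have "t \<le> t + real m * h" using h by simp
  then have tT: "t \<le> T" using T by simp
  define d where "d i = norm (?x (t + real i * h) - X i)" for i
  have "d (Suc i) \<le> (1 + L * h) * d i + L * C * h * h" if i: "i < m" for i
  proof -
    let ?a = "t + real i * h" and ?b = "t + real (Suc i) * h"
    have ab: "t \<le> ?a" "?a \<le> ?b" "?b \<le> T"
      using h i mult_right_mono[of "real (Suc i)" "real m" h] by (auto simp: T[symmetric] algebra_simps)
    have sub: "{?a..?b} \<subseteq> {t..T}" using ab by auto
    have int1: "set_integrable lebesgue {?a..?b} (\<lambda>s. f (?x s) (?u s) (?v s))"
      by (rule set_integrable_f[OF trajectory_unfold(1)[OF uv] uv sub])
    have int2: "set_integrable lebesgue {?a..?b} (\<lambda>s. f (X i) (?u s) (?v s))"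
      by (rule set_integrable_f[OF _ uv sub]) simp
    have "?x ?b - X (Suc i) = (?x ?a - X i) + ((LINT s:{?a..?b}|lebesgue. f (?x s) (?u s) (?v s)) -
        (LINT s:{?a..?b}|lebesgue. f (X i) (?u s) (?v s)))"
      unfolding plan_integral[OF h] X(2)[OF i] trajectory_increment[OF uv ab, symmetric] by simp
    also have "\<dots> = (?x ?a - X i) + (LINT s:{?a..?b}|lebesgue. f (?x s) (?u s) (?v s) - f (X i) (?u s) (?v s))"
      by (simp only: set_integral_diff(2)[OF int1 int2])
    finally have "d (Suc i) \<le> d i + norm (LINT s:{?a..?b}|lebesgue. f (?x s) (?u s) (?v s) - f (X i) (?u s) (?v s))"
      unfolding d_def by (simp only: norm_triangle_ineq)
    also have "norm (LINT s:{?a..?b}|lebesgue. f (?x s) (?u s) (?v s) - f (X i) (?u s) (?v s)) \<le> (?b - ?a) * (L * (C * h + d i))"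
    proof (rule norm_set_integral_le[OF ab(2)])
      fix s assume s: "s \<in> {?a..?b}"
      have "norm (?x s - X i) \<le> norm (?x s - ?x ?a) + norm (?x ?a - X i)" using norm_triangle_ineq[of "?x s - ?x ?a" "?x ?a - X i"] by simp
      also have "norm (?x s - ?x ?a) \<le> C * (s - ?a)"
        by (rule trajectory_lipschitz[OF uv]) (use s ab in auto)
      also have "C * (s - ?a) \<le> C * h" using s C_pos by (intro mult_left_mono) (auto simp: algebra_simps)
      finally have "norm (?x s - X i) \<le> C * h + d i" by (simp add: d_def)
      then show "norm (f (?x s) (?u s) (?v s) - f (X i) (?u s) (?v s)) \<le> L * (C * h + d i)"
        using L_pos by (intro order_trans[OF lip] mult_left_mono) auto
    qed
    also have "?b - ?a = h" by (simp add: algebra_simps)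
    finally show ?thesis by (simp add: algebra_simps)
  qed
  moreover have "d 0 \<le> 0" using trajectory_start[OF uv tT] X(1) by (simp add: d_def)
  ultimately have "d i \<le> exp (L * h * real i) * (0 + real i * (L * C * h * h))"
    using h L_pos C_pos i by (intro discrete_gronwall[of "L * h" "L * C * h * h" 0 d m i]) auto
  also have "\<dots> \<le> exp (L * (T - t)) * (0 + real m * (L * C * h * h))"
  proof (intro mult_mono add_left_mono mult_right_mono)
    have "h * real i \<le> T - t" using i h mult_right_mono[of "real i" "real m" h] by (simp add: T[symmetric] mult.commute)
    then show "exp (L * h * real i) \<le> exp (L * (T - t))" using L_pos by (simp add: mult.assoc)
  qed (use i h L_pos C_pos in auto)
  also have "\<dots> = exp (L * (T - t)) * (T - t) * L * C * h" by (simp add: T[symmetric] mult_ac)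
  finally show ?thesis by (simp add: d_def)
qed

end

section \<open>The punishing strategy\<close>
text \<open>
  Functions with countably many values, each attained on a measurable set. The choices of saddle
  points and of responses below depend on the state through arbitrary selections; keeping the
  state countably valued makes every such selection measurable.
\<close>
definition discretely_measurable :: "'x measure \<Rightarrow> ('x \<Rightarrow> 's) \<Rightarrow> bool" where
  "discretely_measurable M S \<longleftrightarrow> (\<exists>\<iota> D. \<iota> \<in> measurable M (count_space (UNIV :: nat set)) \<and> (\<forall>x\<in>space M. S x = D (\<iota> x)))"

lemma discretely_measurable_compose:
  assumes S: "discretely_measurable M S" and F: "\<And>c. F c \<in> measurable M N"
  shows "(\<lambda>x. F (S x) x) \<in> measurable M N"
proof -
  obtain \<iota> D where \<iota>: "\<iota> \<in> measurable M (count_space (UNIV :: nat set))" "\<And>x. x \<in> space M \<Longrightarrow> S x = D (\<iota> x)"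
    using S unfolding discretely_measurable_def by blast
  have "(\<lambda>x. F (D (\<iota> x)) x) \<in> measurable M N"
    by (rule measurable_compose_countable[where f = "\<lambda>i. F (D i)", OF F \<iota>(1)])
  then show ?thesis by (rule measurable_cong[THEN iffD1, rotated]) (simp add: \<iota>(2))
qed

lemma discretely_measurable_bind:
  assumes S: "discretely_measurable M S" and F: "\<And>c. discretely_measurable M (F c)"
  shows "discretely_measurable M (\<lambda>x. F (S x) x)"
proof -
  obtain \<iota> D where \<iota>: "\<iota> \<in> measurable M (count_space (UNIV :: nat set))" "\<And>x. x \<in> space M \<Longrightarrow> S x = D (\<iota> x)"
    using S unfolding discretely_measurable_def by blast
  have "\<forall>c. \<exists>\<iota>D. fst \<iota>D \<in> measurable M (count_space (UNIV :: nat set)) \<and> (\<forall>x\<in>space M. F c x = snd \<iota>D (fst \<iota>D x))"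
    using F unfolding discretely_measurable_def by (metis fst_conv snd_conv)
  from choice[OF this] obtain \<iota>D where \<iota>D: "\<forall>c. fst (\<iota>D c) \<in> measurable M (count_space (UNIV :: nat set)) \<and>
      (\<forall>x\<in>space M. F c x = snd (\<iota>D c) (fst (\<iota>D c) x))" by (elim exE)
  have "(\<lambda>x. prod_encode (\<iota> x, fst (\<iota>D (D (\<iota> x))) x)) \<in> measurable M (count_space UNIV)"
  proof (rule measurable_compose_countable[where f = "\<lambda>i x. prod_encode (i, fst (\<iota>D (D i)) x)", OF _ \<iota>(1)])
    fix i
    show "(\<lambda>x. prod_encode (i, fst (\<iota>D (D i)) x)) \<in> measurable M (count_space UNIV)"
      using \<iota>D by (intro measurable_compose[of "fst (\<iota>D (D i))" M "count_space UNIV" "\<lambda>j. prod_encode (i, j)"]) auto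
  qed
  moreover have "\<forall>x\<in>space M. F (S x) x = (\<lambda>j. snd (\<iota>D (D (fst (prod_decode j)))) (snd (prod_decode j))) (prod_encode (\<iota> x, fst (\<iota>D (D (\<iota> x))) x))"
    using \<iota>(2) \<iota>D by simp
  ultimately show ?thesis unfolding discretely_measurable_def by (intro exI conjI)
qed

lemma discretely_measurable_nat: "\<iota> \<in> measurable M (count_space (UNIV :: nat set)) \<Longrightarrow> discretely_measurable M (\<lambda>x. D (\<iota> x))"
  unfolding discretely_measurable_def by blast

lemma discretely_measurable_const: "discretely_measurable M (\<lambda>_. c)"
  using discretely_measurable_nat[of "\<lambda>_. 0" M "\<lambda>_. c"] by simp

lemma discretely_measurable_map:
  assumes "discretely_measurable M S"
  shows "discretely_measurable M (\<lambda>x. G (S x))"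
  by (rule discretely_measurable_bind[OF assms discretely_measurable_const])

lemma discretely_measurable_if:
  assumes P: "{x \<in> space M. P x} \<in> sets M" and S: "discretely_measurable M S" "discretely_measurable M S'"
  shows "discretely_measurable M (\<lambda>x. if P x then S x else S' x)"
proof -
  have "(\<lambda>x. if P x then 0 else 1 :: nat) \<in> measurable M (count_space UNIV)"
    by (rule measurable_If[OF _ _ P]) auto
  then have "discretely_measurable M (\<lambda>x. (if P x then 0 else 1 :: nat) = 0)" by (rule discretely_measurable_nat)
  then have P: "discretely_measurable M P" by (rule discretely_measurable_map[of M _ "\<lambda>b. b", THEN iffD1[OF arg_cong[where f = "discretely_measurable M"], rotated]]) (auto)
  have "discretely_measurable M (if b then S else S')" for b using S by simp
  from discretely_measurable_bind[OF P this] show ?thesis by (simp add: if_distrib[of "\<lambda>f. f _"] cong: if_cong)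
qed

lemma discretely_measurable_near:
  assumes "q \<in> borel_measurable M"
  shows "discretely_measurable M (\<lambda>x. d (near d e (q x)))"
  by (rule discretely_measurable_nat) (rule measurable_compose[OF assms measurable_near])

lemma discretely_measurable_comp:
  assumes "h \<in> measurable N M" "discretely_measurable M S"
  shows "discretely_measurable N (\<lambda>x. S (h x))"
proof -
  obtain \<iota> D where \<iota>: "\<iota> \<in> measurable M (count_space (UNIV :: nat set))" "\<And>x. x \<in> space M \<Longrightarrow> S x = D (\<iota> x)"
    using assms(2) unfolding discretely_measurable_def by blast
  have "\<forall>x\<in>space N. S (h x) = D (\<iota> (h x))" using \<iota>(2) measurable_space[OF assms(1)] by blast
  then show ?thesis unfolding discretely_measurable_def using measurable_compose[OF assms(1) \<iota>(1)] by blast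
qed

definition draw_index :: "nat \<Rightarrow> real \<Rightarrow> nat" where
  "draw_index n r = min n (nat \<lfloor>real (Suc n) * r\<rfloor>)"

text \<open>
  A random action with distribution \<open>\<mu>\<close> if \<open>r\<close> is uniform.
\<close>
definition draw :: "'a relaxed \<Rightarrow> real \<Rightarrow> 'a" where
  "draw \<mu> r = snd \<mu> (draw_index (fst \<mu>) r)"

lemma measurable_draw_index[measurable]: "draw_index n \<in> measurable borel (count_space UNIV)"
  unfolding draw_index_def[abs_def] by measurable

lemma measure_draw_index:
  assumes "i \<le> n"
  shows "measure uniform01 {r. draw_index n r = i} = 1 / real (Suc n)"
proof -
  let ?N = "real (Suc n)"
  have N: "?N > 0" by simp
  have "{r. draw_index n r = i} \<in> sets borel"
    using measurable_sets[OF measurable_draw_index, of "{i}" n] by (simp add: vimage_def)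
  then have "measure uniform01 {r. draw_index n r = i} = measure lborel ({0..1} \<inter> {r. draw_index n r = i})"
    by (simp add: measure_uniform_measure)
  also have "\<dots> = measure lborel {real i / ?N..<real (Suc i) / ?N}"
  proof (rule measure_eq_AE)
    have "AE r in lborel. r \<noteq> (1::real)" by (rule AE_lborel_singleton)
    then show "AE r in lborel. r \<in> {0..1} \<inter> {r. draw_index n r = i} \<longleftrightarrow> r \<in> {real i / ?N..<real (Suc i) / ?N}"
    proof eventually_elim
      case (elim r)
      have "r \<in> {real i / ?N..<real (Suc i) / ?N} \<longleftrightarrow> real i \<le> ?N * r \<and> ?N * r < real (Suc i)"
        using N by (simp add: field_simps del: of_nat_Suc)
      also have "\<dots> \<longleftrightarrow> 0 \<le> r \<and> r < 1 \<and> \<lfloor>?N * r\<rfloor> = int i"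
      proof
        assume A: "real i \<le> ?N * r \<and> ?N * r < real (Suc i)"
        then have "0 \<le> ?N * r" by (meson of_nat_0_le_iff order_trans)
        then have "0 \<le> r" using N by (simp add: zero_le_mult_iff del: of_nat_Suc)
        moreover have "real (Suc i) \<le> ?N" using assms by simp
        from less_le_trans[OF conjunct2[OF A] this] have "?N * r < ?N * 1" by (simp only: mult_1_right)
        then have "r < 1" using N by (simp del: of_nat_Suc)
        moreover have "\<lfloor>?N * r\<rfloor> = int i" by (rule floor_unique) (use A in auto)
        ultimately show "0 \<le> r \<and> r < 1 \<and> \<lfloor>?N * r\<rfloor> = int i" by blast
      next
        assume "0 \<le> r \<and> r < 1 \<and> \<lfloor>?N * r\<rfloor> = int i"
        then show "real i \<le> ?N * r \<and> ?N * r < real (Suc i)"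
          using floor_correct[of "?N * r"] by simp
      qed
      also have "\<dots> \<longleftrightarrow> r \<in> {0..1} \<inter> {r. draw_index n r = i}"
      proof -
        have "draw_index n r = i \<longleftrightarrow> \<lfloor>?N * r\<rfloor> = int i" if "0 \<le> r" "r < 1"
        proof -
          have "?N * r < ?N" "0 \<le> ?N * r" using that N by (auto simp del: of_nat_Suc)
          then have "\<lfloor>?N * r\<rfloor> < int (Suc n)" "0 \<le> \<lfloor>?N * r\<rfloor>"
            by (simp_all only: floor_less_iff of_int_of_nat_eq zero_le_floor)
          then show ?thesis unfolding draw_index_def by (simp add: min_def) linarith
        qed
        then show ?thesis using elim by auto
      qed
      finally show ?case by blast
    qed
  qed (use measurable_sets[OF measurable_draw_index, of "{i}" n] in \<open>auto simp: vimage_def\<close>)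
  also have "\<dots> = real (Suc i) / ?N - real i / ?N" by (simp add: divide_right_mono)
  also have "\<dots> = 1 / ?N" by (simp add: diff_divide_distrib[symmetric])
  finally show ?thesis .
qed

lemma integral_draw: "(\<integral>r. \<phi> (draw \<mu> r) \<partial>uniform01) = avg \<mu> (\<phi> :: 'a \<Rightarrow> real)"
proof -
  interpret prob_space uniform01 by (rule prob_space_uniform01)
  let ?n = "fst \<mu>"
  have E: "{r. draw_index ?n r = i} \<in> sets uniform01" for i
    using measurable_sets[OF measurable_draw_index, of "{i}" ?n] by (simp add: vimage_def)
  have "\<phi> (draw \<mu> r) = (\<Sum>i\<le>?n. \<phi> (snd \<mu> i) * indicator {r. draw_index ?n r = i} r)" for r
  proof -
    have "draw_index ?n r \<le> ?n" by (simp add: draw_index_def)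
    then show ?thesis by (simp add: draw_def indicator_def if_distrib cong: if_cong)
  qed
  then have "(\<integral>r. \<phi> (draw \<mu> r) \<partial>uniform01) = (\<integral>r. (\<Sum>i\<le>?n. \<phi> (snd \<mu> i) * indicator {r. draw_index ?n r = i} r) \<partial>uniform01)"
    by simp
  also have "\<dots> = (\<Sum>i\<le>?n. \<phi> (snd \<mu> i) * measure uniform01 {r. draw_index ?n r = i})"
  proof (subst Bochner_Integration.integral_sum)
    show "integrable uniform01 (\<lambda>r. \<phi> (snd \<mu> i) * indicator {r. draw_index ?n r = i} r)" for i
      using emeasure_finite[of "{r. draw_index ?n r = i}"]
      by (intro integrable_mult_right integrable_real_indicator E) (simp only: infinity_ennreal_def less_top)
  qed (simp del: measure_uniform_measure)
  also have "\<dots> = (\<Sum>i\<le>?n. \<phi> (snd \<mu> i) * (1 / real (Suc ?n)))"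
    by (intro sum.cong refl arg_cong2[where f = "(*)"] measure_draw_index) simp
  also have "\<dots> = avg \<mu> \<phi>"
    by (simp add: avg_def sum_distrib_left divide_inverse mult.commute del: of_nat_Suc)
  finally show ?thesis .
qed

context dynamics
begin

lemma measurable_integral_f:
  assumes ab: "{a..b} \<subseteq> {t..T}"
  shows "(\<lambda>v. LINT r:{a..b}|lebesgue. f x u (v r)) \<in> borel_measurable (control_algebra t T)"
proof (subst borel_measurable_euclidean_space, intro ballI)
  fix e :: "real^'n" assume e: "e \<in> Basis"
  have "(\<lambda>v. LINT r:{a..b}|lebesgue. f x u (v r) \<bullet> e) \<in> borel_measurable (control_algebra t T)"
  proof (rule measurable_control_integral[OF compact_v, where K = C])
    fix v show "\<bar>f x u v \<bullet> e\<bar> \<le> C"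
      using Cauchy_Schwarz_ineq2[of "f x u v" e] e bounded[of x u v] by (simp add: norm_Basis)
  next
    fix \<epsilon> :: real assume "\<epsilon> > 0"
    have "continuous_on UNIV (\<lambda>v::'v. (u, v))" by (intro continuous_intros)
    from continuous_on_compose2[OF cont[of x] this] have "continuous_on UNIV (\<lambda>v. f x u v \<bullet> e)"
      by (intro continuous_on_inner continuous_on_const) simp
    then have "uniformly_continuous_on UNIV (\<lambda>v. f x u v \<bullet> e)"
      using compact_v by (rule compact_uniformly_continuous)
    then obtain \<delta> where "\<delta> > 0" "\<And>v v'. dist v v' < \<delta> \<Longrightarrow> dist (f x u v \<bullet> e) (f x u v' \<bullet> e) < \<epsilon>"
      using \<open>\<epsilon> > 0\<close> unfolding uniformly_continuous_on_def by (metis UNIV_I dist_commute)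
    then show "\<exists>\<delta>>0. \<forall>r v v'. dist v v' < \<delta> \<longrightarrow> \<bar>f x u v \<bullet> e - f x u v' \<bullet> e\<bar> \<le> \<epsilon>"
      by (intro exI[of _ \<delta>]) (auto simp: dist_real_def intro: less_imp_le)
  next
    fix v :: "real \<Rightarrow> 'v" assume v: "v \<in> controls t T"
    show "(\<lambda>r. f x u (v r) \<bullet> e) \<in> borel_measurable (lebesgue_on {t..T})"
      using v by (intro borel_measurable_inner measurable_f borel_measurable_const) (simp_all add: controls_def)
  qed (rule ab)
  also have "?this \<longleftrightarrow> (\<lambda>v. (LINT r:{a..b}|lebesgue. f x u (v r)) \<bullet> e) \<in> borel_measurable (control_algebra t T)"
  proof (rule measurable_cong)
    fix v :: "real \<Rightarrow> 'v" assume "v \<in> space (control_algebra t T)"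
    then have v: "v \<in> controls t T" by (simp add: space_control_algebra)
    have "set_integrable lebesgue {a..b} (\<lambda>r. f x u (v r))"
      by (rule set_integrable_f[OF _ _ v ab]) (simp_all add: controls_def)
    then have "integrable lebesgue (\<lambda>r. indicator {a..b} r *\<^sub>R f x u (v r))" by (simp add: set_integrable_def)
    from integral_inner_left[OF this, of e]
    show "(LINT r:{a..b}|lebesgue. f x u (v r) \<bullet> e) = (LINT r:{a..b}|lebesgue. f x u (v r)) \<bullet> e"
      by (simp add: set_lebesgue_integral_def)
  qed
  finally show "(\<lambda>v. (LINT r:{a..b}|lebesgue. f x u (v r)) \<bullet> e) \<in> borel_measurable (control_algebra t T)" .
qed

end

text \<open>
  Player \<open>p\<close> follows the plan \<open>us\<close>, monitors whether the opponent
  follows \<open>vs\<close>, and punishes a deviation. Time is divided into \<open>m\<close> macro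
  steps of length \<open>h\<close>, which in the estimates are much longer than the partition
  intervals; \<open>X i\<close> is the position of the plan after \<open>i\<close> macro steps.
  The function \<open>aim\<close> selects, for a position and a guide, a pair of relaxed actions,
  later an approximate saddle point, and \<open>react\<close> selects the action by which the
  guide answers the second one; \<open>d\<close> serves to round positions.
\<close>
locale punishment = game f C L T t \<pi> k
  for f :: "real^'n \<Rightarrow> 'u::metric_space \<Rightarrow> 'v::metric_space \<Rightarrow> real^'n" and C L T t \<pi> k +
  fixes p :: 2 and m :: nat and h :: real and X :: "nat \<Rightarrow> real^'n"
    and us :: "real \<Rightarrow> 'u" and vs :: "real \<Rightarrow> 'v" and d :: "nat \<Rightarrow> real^'n"
    and aim :: "real^'n \<Rightarrow> real^'n \<Rightarrow> 'u relaxed \<times> 'v relaxed"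
    and react :: "nat \<Rightarrow> real^'n \<Rightarrow> 'v relaxed \<Rightarrow> 'u relaxed"
  assumes h_pos: "h > 0" and h_T: "t + real m * h = T" and m_pos: "m > 0"
    and us: "us \<in> borel_measurable borel" and vs: "vs \<in> borel_measurable borel"
    and d: "dense_seq d"
begin

text \<open>
  The first partition point at or after the macro time \<open>t + i * h\<close>. Decisions for the
  macro step \<open>i\<close> are taken there and apply to the partition intervals from
  \<open>grid i\<close> to \<open>grid (Suc i)\<close>. The bound \<open>k \<le> l\<close> gives
  \<open>grid 0 = k\<close> even if the game starts at a partition point.
\<close>
definition grid :: "nat \<Rightarrow> nat" where "grid i = (LEAST l. k \<le> l \<and> t + real i * h \<le> \<pi> ! l)"

lemma grid_exists: "i \<le> m \<Longrightarrow> k \<le> length \<pi> - 1 \<and> t + real i * h \<le> \<pi> ! (length \<pi> - 1)"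
proof -
  assume "i \<le> m"
  then have "real i * h \<le> real m * h" using h_pos by (intro mult_right_mono) auto
  then show "k \<le> length \<pi> - 1 \<and> t + real i * h \<le> \<pi> ! (length \<pi> - 1)" using k \<pi>_last h_T by auto
qed

lemma grid:
  assumes "i \<le> m"
  shows "k \<le> grid i" "t + real i * h \<le> \<pi> ! grid i" "grid i < length \<pi>"
proof -
  show "k \<le> grid i" "t + real i * h \<le> \<pi> ! grid i"
    unfolding grid_def using LeastI[of "\<lambda>l. k \<le> l \<and> t + real i * h \<le> \<pi> ! l", OF grid_exists[OF assms]] by auto
  have "grid i \<le> length \<pi> - 1" unfolding grid_def by (rule Least_le) (rule grid_exists[OF assms])
  then show "grid i < length \<pi>" using k by auto
qed

lemma grid_0: "grid 0 = k"
  unfolding grid_def by (rule Least_equality) (use t in auto)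

lemma grid_m: "grid m = length \<pi> - 1"
proof (rule antisym)
  show "grid m \<le> length \<pi> - 1" using grid(3)[of m] by simp
  show "length \<pi> - 1 \<le> grid m"
  proof (rule ccontr)
    assume "\<not> ?thesis"
    then have "\<pi> ! grid m < T" using \<pi>_less[of "grid m" "length \<pi> - 1"] k \<pi>_last by auto
    then show False using grid(2)[of m] h_T by simp
  qed
qed

lemma grid_mono: "i \<le> j \<Longrightarrow> j \<le> m \<Longrightarrow> grid i \<le> grid j"
proof -
  assume ij: "i \<le> j" "j \<le> m"
  have "t + real i * h \<le> t + real j * h" using ij h_pos by (simp add: mult_right_mono)
  then show ?thesis unfolding grid_def[of i] by (intro Least_le) (use grid[OF ij(2)] in auto)
qed

definition macro :: "nat \<Rightarrow> nat" where "macro l = (LEAST i. l \<le> grid (Suc i))"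

lemma macro_eq: "i < m \<Longrightarrow> grid i < l \<Longrightarrow> l \<le> grid (Suc i) \<Longrightarrow> macro l = i"
  unfolding macro_def
proof (rule Least_equality)
  fix j assume i: "i < m" "grid i < l" and "l \<le> grid (Suc j)"
  show "i \<le> j"
  proof (rule ccontr)
    assume "\<not> i \<le> j"
    then have "grid (Suc j) \<le> grid i" using i by (intro grid_mono) auto
    then show False using i \<open>l \<le> grid (Suc j)\<close> by simp
  qed
qed

lemma macro:
  assumes "k < l" "l < length \<pi>"
  shows "macro l < m" "grid (macro l) < l" "l \<le> grid (Suc (macro l))"
proof -
  have ex: "l \<le> grid (Suc (m - 1))" using assms grid_m m_pos by simp
  then show "l \<le> grid (Suc (macro l))" unfolding macro_def by (rule LeastI)
  have "macro l \<le> m - 1" unfolding macro_def by (rule Least_le) (rule ex)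
  then show "macro l < m" using m_pos by simp
  show "grid (macro l) < l"
  proof (cases "macro l")
    case 0
    then show ?thesis using grid_0 assms by simp
  next
    case (Suc j)
    then have "\<not> l \<le> grid (Suc j)" using not_less_Least[of j "\<lambda>i. l \<le> grid (Suc i)"] unfolding macro_def by simp
    then show ?thesis using Suc by simp
  qed
qed

text \<open>
  The integral of the distance, rather than almost sure equality, exhibits the condition as a
  measurable one.
\<close>
definition undetected :: "nat \<Rightarrow> (real \<Rightarrow> 'v) \<Rightarrow> bool" where
  "undetected i v \<longleftrightarrow> (LINT r:{t..\<pi> ! grid i}|lebesgue. dist (v r) (vs r)) = 0"

text \<open>
  The first component estimates the true position from the punisher's own signals and the
  opponent's control; it is rounded to a countable set. The second component is the guide, a
  fictitious position which moves by the relaxed actions \<open>react\<close> and the second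
  component of \<open>aim\<close>. Until a deviation is detected both are reset to the plan.
\<close>
primrec state :: "nat \<Rightarrow> (2 \<times> nat \<Rightarrow> real) \<Rightarrow> (real \<Rightarrow> 'v) \<Rightarrow> (real^'n) \<times> (real^'n)" where
  "state 0 y v = (X 0, X 0)"
| "state (Suc i) y v = (if undetected i v then (X (Suc i), X (Suc i)) else
    case state i y v of (a, b) \<Rightarrow>
      (d (near d (h\<^sup>2) (a + (\<Sum>l\<in>{grid i<..grid (Suc i)}. LINT r:{\<pi> ! (l - 1)..\<pi> ! l}|lebesgue.
          f a (draw (fst (aim a b)) (y (p, l - 1))) (v r)))),
       b + h *\<^sub>R relaxed_field f b (react i b (snd (aim a b))) (snd (aim a b))))"

text \<open>
  Extremal aiming, randomized: on each partition interval a fresh action is drawn from the relaxed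
  action that \<open>aim\<close> prescribes for the current estimate and guide, with the private
  signal \<open>(p, l - 1)\<close> of that interval. On the first interval nothing has been
  observed yet.
\<close>
definition punish :: "nat \<Rightarrow> (2 \<times> nat \<Rightarrow> real) \<Rightarrow> (real \<Rightarrow> 'v) \<Rightarrow> real \<Rightarrow> 'u" where
  "punish l y v s = (if l \<le> k \<or> undetected (macro l) v then us s
    else draw (fst (case_prod aim (state (macro l) y v))) (y (p, l - 1)))"

lemma measurable_dist_vs:
  assumes "v \<in> controls t T"
  shows "(\<lambda>r. dist (v r) (vs r)) \<in> borel_measurable (lebesgue_on {t..T})"
proof -
  obtain dv :: "nat \<Rightarrow> 'v" where dv: "dense_seq dv" using compact_dense_seq[OF compact_v] by blast
  show ?thesis
    using assms borel_controls[OF vs, of t T] by (intro measurable_dist_dense[OF dv]) (simp_all add: controls_def)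
qed

lemma dist_bounded: "\<exists>K. \<forall>x y :: 'v. dist x y \<le> K"
proof -
  have "Elementary_Metric_Spaces.bounded (UNIV :: 'v set)" using compact_v by (rule compact_imp_bounded)
  then show ?thesis by (auto simp: bounded_two_points)
qed

lemma grid_interval: "i \<le> m \<Longrightarrow> {t..\<pi> ! grid i} \<subseteq> {t..T}"
  using \<pi>_le_T[OF grid(3)] by auto

lemma set_integrable_dist_vs:
  assumes "i \<le> m" "v \<in> controls t T"
  shows "set_integrable lebesgue {t..\<pi> ! grid i} (\<lambda>r. dist (v r) (vs r))"
proof -
  obtain K where K: "\<And>x y :: 'v. dist x y \<le> K" using dist_bounded by blast
  show ?thesis
    by (rule set_integrable_bounded[OF measurable_dist_vs[OF assms(2)] _ grid_interval[OF assms(1)]]) (use K in simp)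
qed

lemma undetected_cong:
  assumes "i \<le> m" "v \<in> controls t T" "v' \<in> controls t T" "AE s in lebesgue_on {t..\<pi> ! grid i}. v s = v' s"
  shows "undetected i v \<longleftrightarrow> undetected i v'"
proof -
  have "AE s in lebesgue_on {t..\<pi> ! grid i}. dist (v s) (vs s) = dist (v' s) (vs s)"
    using assms(4) by eventually_elim simp
  then have "(LINT r:{t..\<pi> ! grid i}|lebesgue. dist (v r) (vs r)) = (LINT r:{t..\<pi> ! grid i}|lebesgue. dist (v' r) (vs r))"
    by (intro set_integral_cong_AE_on set_integrable_dist_vs assms)
  then show ?thesis by (simp add: undetected_def)
qed

lemma undetected_iff:
  assumes "i \<le> m" "v \<in> controls t T"
  shows "undetected i v \<longleftrightarrow> (AE s in lebesgue_on {t..\<pi> ! grid i}. v s = vs s)"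
proof
  assume "AE s in lebesgue_on {t..\<pi> ! grid i}. v s = vs s"
  from undetected_cong[OF assms borel_controls[OF vs] this]
  show "undetected i v" by (simp add: undetected_def set_lebesgue_integral_def)
next
  assume U: "undetected i v"
  have "AE s in lebesgue. indicator {t..\<pi> ! grid i} s *\<^sub>R dist (v s) (vs s) = 0"
    using U set_integrable_dist_vs[OF assms]
      integral_nonneg_eq_0_iff_AE[of lebesgue "\<lambda>s. indicator {t..\<pi> ! grid i} s *\<^sub>R dist (v s) (vs s)"]
    by (simp add: undetected_def set_integrable_def set_lebesgue_integral_def)
  then show "AE s in lebesgue_on {t..\<pi> ! grid i}. v s = vs s"
    unfolding AE_lebesgue_on_Icc by eventually_elim (auto simp: indicator_def)
qed

lemma measurable_undetected:
  assumes "i \<le> m"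
  shows "{v \<in> space (control_algebra t T). undetected i v} \<in> sets (control_algebra t T)"
proof -
  obtain K where K: "\<And>x y :: 'v. dist x y \<le> K" using dist_bounded by blast
  have "(\<lambda>v. LINT r:{t..\<pi> ! grid i}|lebesgue. dist (v r) (vs r)) \<in> borel_measurable (control_algebra t T)"
  proof (rule measurable_control_integral[OF compact_v, where \<phi> = "\<lambda>r v. dist v (vs r)" and K = K])
    show "\<bar>dist v (vs r)\<bar> \<le> K" for r v using K by simp
    show "\<exists>\<delta>>0. \<forall>r v v'. dist v v' < \<delta> \<longrightarrow> \<bar>dist v (vs r) - dist v' (vs r)\<bar> \<le> e" if "e > 0" for e
    proof (intro exI[of _ e] conjI allI impI that)
      fix r and v v' :: 'v assume "dist v v' < e"
      then show "\<bar>dist v (vs r) - dist v' (vs r)\<bar> \<le> e"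
        using dist_triangle[of v "vs r" v'] dist_triangle3[of v' "vs r" v] by (simp add: abs_le_iff)
    qed
  qed (rule measurable_dist_vs grid_interval assms | assumption)+
  then show ?thesis unfolding undetected_def by (rule borel_measurable_eq) simp
qed

lemma stage_interval:
  assumes "i < m" "l \<in> {grid i<..grid (Suc i)}"
  shows "l \<in> {k..<length \<pi>}" "k < l" "t < \<pi> ! (l - 1)" "{\<pi> ! (l - 1)..\<pi> ! l} \<subseteq> {t..T}" "\<pi> ! (l - 1) \<le> \<pi> ! l"
    "\<pi> ! l \<le> \<pi> ! grid (Suc i)" "max t (\<pi> ! (l - 1)) = \<pi> ! (l - 1)"
proof -
  have k1: "k \<le> grid i" "grid (Suc i) < length \<pi>" using grid[of i] grid[of "Suc i"] assms by auto
  show l: "l \<in> {k..<length \<pi>}" "k < l" using assms k1 by auto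
  show t: "t < \<pi> ! (l - 1)" using l by (intro t_less_\<pi>) auto
  show "{\<pi> ! (l - 1)..\<pi> ! l} \<subseteq> {t..T}" using t \<pi>_le_T[of l] l by auto
  show "\<pi> ! (l - 1) \<le> \<pi> ! l" using l by (intro \<pi>_mono) auto
  show "\<pi> ! l \<le> \<pi> ! grid (Suc i)" using assms k1 by (intro \<pi>_mono) auto
  show "max t (\<pi> ! (l - 1)) = \<pi> ! (l - 1)" using t by simp
qed

text \<open>
  Needed twice: the punishing strategy is nonanticipating, and resampling a later signal leaves
  the state at decision \<open>i\<close> unchanged.
\<close>
lemma state_cong:
  assumes "i \<le> m" "v \<in> controls t T" "v' \<in> controls t T" "AE s in lebesgue_on {t..\<pi> ! grid i}. v s = v' s"
    and "\<And>j. j < grid i \<Longrightarrow> k \<le> j \<Longrightarrow> y (p, j) = y' (p, j)"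
  shows "state i y v = state i y' v'"
  using assms
proof (induction i)
  case (Suc i)
  then have i: "i < m" "i \<le> m" by auto
  have lm: "grid i \<le> grid (Suc i)" by (rule grid_mono) (use Suc.prems in auto)
  have le: "\<pi> ! grid i \<le> \<pi> ! grid (Suc i)" by (rule \<pi>_mono[OF lm grid(3)[OF Suc.prems(1)]])
  have AE: "AE s in lebesgue_on {t..\<pi> ! grid i}. v s = v' s"
    by (rule AE_lebesgue_on_mono[OF Suc.prems(4)]) (use le in auto)
  have st: "state i y v = state i y' v'" by (rule Suc.IH[OF i(2) Suc.prems(2,3) AE]) (use Suc.prems(5) lm in auto)
  have un: "undetected i v \<longleftrightarrow> undetected i v'" by (rule undetected_cong[OF i(2) Suc.prems(2,3) AE])
  have "(LINT r:{\<pi> ! (l - 1)..\<pi> ! l}|lebesgue. f a (draw \<mu> (y (p, l - 1))) (v r)) =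
      (LINT r:{\<pi> ! (l - 1)..\<pi> ! l}|lebesgue. f a (draw \<mu> (y' (p, l - 1))) (v' r))"
    if l: "l \<in> {grid i<..grid (Suc i)}" for l a \<mu>
  proof -
    note si = stage_interval[OF i(1) l]
    have y: "y (p, l - 1) = y' (p, l - 1)" using l grid(1)[OF i(2)] by (intro Suc.prems(5)) auto
    have "AE r in lebesgue_on {\<pi> ! (l - 1)..\<pi> ! l}. v r = v' r"
      by (rule AE_lebesgue_on_mono[OF Suc.prems(4)]) (use si(3,6) in auto)
    then have "AE r in lebesgue_on {\<pi> ! (l - 1)..\<pi> ! l}. f a (draw \<mu> (y' (p, l - 1))) (v r) = f a (draw \<mu> (y' (p, l - 1))) (v' r)"
      by eventually_elim simp
    then show ?thesis unfolding y
      by (rule set_integral_cong_AE_on)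
        (rule set_integrable_f[OF _ _ Suc.prems(2) si(4)] set_integrable_f[OF _ _ Suc.prems(3) si(4)], simp, simp add: controls_def)+
  qed
  then have "(\<Sum>l\<in>{grid i<..grid (Suc i)}. LINT r:{\<pi> ! (l - 1)..\<pi> ! l}|lebesgue. f a (draw \<mu> (y (p, l - 1))) (v r)) =
      (\<Sum>l\<in>{grid i<..grid (Suc i)}. LINT r:{\<pi> ! (l - 1)..\<pi> ! l}|lebesgue. f a (draw \<mu> (y' (p, l - 1))) (v' r))" for a \<mu>
    by (intro sum.cong refl)
  then show ?case unfolding state.simps st un by (simp only:)
qed simp

lemma measurable_stage_integral:
  assumes i: "i < m" and l: "l \<in> {grid i<..grid (Suc i)}" and J: "(p, l - 1) \<in> J"
  shows "(\<lambda>x. LINT r:{\<pi> ! (l - 1)..\<pi> ! l}|lebesgue. f a (draw \<mu> (fst x (p, l - 1))) (snd x r))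
    \<in> borel_measurable (PiM J (\<lambda>_. borel) \<Otimes>\<^sub>M control_algebra t T)" (is "_ \<in> borel_measurable ?M")
proof -
  have "(\<lambda>x. draw_index (fst \<mu>) (fst x (p, l - 1))) \<in> measurable ?M (count_space UNIV)"
    using J by (intro measurable_compose[OF _ measurable_draw_index] measurable_compose[OF measurable_fst measurable_component_singleton])
  moreover have "(\<lambda>x. LINT r:{\<pi> ! (l - 1)..\<pi> ! l}|lebesgue. f a (snd \<mu> j) (snd x r)) \<in> borel_measurable ?M" for j
    by (rule measurable_compose[OF measurable_snd measurable_integral_f[OF stage_interval(4)[OF i l]]])
  ultimately show ?thesis unfolding draw_def
    by (rule measurable_compose_countable[where f = "\<lambda>j x. LINT r:{\<pi> ! (l - 1)..\<pi> ! l}|lebesgue. f a (snd \<mu> j) (snd x r)", rotated])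
qed

lemma discretely_measurable_state:
  assumes "i \<le> m" and J: "{p} \<times> {k..<grid i} \<subseteq> J"
  shows "discretely_measurable (PiM J (\<lambda>_. borel) \<Otimes>\<^sub>M control_algebra t T) (\<lambda>x. state i (fst x) (snd x))"
  using assms
proof (induction i)
  case 0
  show ?case unfolding state.simps by (rule discretely_measurable_const)
next
  case (Suc i)
  let ?M = "PiM J (\<lambda>_. borel) \<Otimes>\<^sub>M control_algebra t T"
  have i: "i < m" "i \<le> m" using Suc by auto
  have lm: "grid i \<le> grid (Suc i)" by (rule grid_mono) (use Suc.prems in auto)
  have J: "{p} \<times> {k..<grid i} \<subseteq> J" using Suc.prems(2) lm by auto
  define step where "step ab x = (d (near d (h\<^sup>2) (fst ab + (\<Sum>l\<in>{grid i<..grid (Suc i)}. LINT r:{\<pi> ! (l - 1)..\<pi> ! l}|lebesgue.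
          f (fst ab) (draw (fst (aim (fst ab) (snd ab))) (fst x (p, l - 1))) (snd x r)))),
       snd ab + h *\<^sub>R relaxed_field f (snd ab) (react i (snd ab) (snd (aim (fst ab) (snd ab)))) (snd (aim (fst ab) (snd ab))))"
    for ab :: "(real^'n) \<times> (real^'n)" and x :: "(2 \<times> nat \<Rightarrow> real) \<times> (real \<Rightarrow> 'v)"
  have int: "(\<lambda>x. LINT r:{\<pi> ! (l - 1)..\<pi> ! l}|lebesgue. f a (draw \<mu> (fst x (p, l - 1))) (snd x r)) \<in> borel_measurable ?M"
    if l: "l \<in> {grid i<..grid (Suc i)}" for l a \<mu>
  proof (rule measurable_stage_integral[OF i(1) l])
    have "(p, l - 1) \<in> {p} \<times> {k..<grid (Suc i)}" using l grid(1)[OF i(2)] by auto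
    then show "(p, l - 1) \<in> J" using Suc.prems(2) by blast
  qed
  have step: "discretely_measurable ?M (step ab)" for ab
    unfolding step_def
    by (rule discretely_measurable_map[where G = "\<lambda>a. (a, _)"], rule discretely_measurable_near)
      (intro borel_measurable_add borel_measurable_const borel_measurable_sum int)
  have det: "{x \<in> space ?M. undetected i (snd x)} \<in> sets ?M"
    using measurable_sets[OF measurable_snd measurable_undetected[OF i(2)], of "PiM J (\<lambda>_. borel)"]
    by (rule back_subst[of "\<lambda>A. A \<in> sets ?M"]) (auto simp: space_pair_measure)
  have "discretely_measurable ?M (\<lambda>x. if undetected i (snd x) then (X (Suc i), X (Suc i)) else step (state i (fst x) (snd x)) x)"
    by (intro discretely_measurable_if det discretely_measurable_const discretely_measurable_bind[OF Suc.IH[OF i(2) J] step])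
  then show ?case unfolding state.simps step_def case_prod_unfold .
qed

text \<open>
  Nonanticipation holds since the macro step of the \<open>l\<close>-th interval begins at or
  before the start of that interval.
\<close>
lemma kernel_punish: "kernel p T \<pi> t k punish"
  unfolding kernel_def
proof (intro ballI conjI impI)
  fix l assume l: "l \<in> {k..<length \<pi>}"
  let ?Y = "PiM (info p k l) (\<lambda>_. borel :: real measure)" and ?R = "restrict_space borel {max t (\<pi> ! (l - 1))..\<pi> ! l} :: real measure"
    and ?V = "control_algebra t T :: (real \<Rightarrow> 'v) measure"
  let ?M = "?Y \<Otimes>\<^sub>M ?R \<Otimes>\<^sub>M ?V"
  have us': "(\<lambda>x. us (fst (snd x))) \<in> borel_measurable ?M"
    by (rule measurable_compose[OF measurable_snd measurable_compose[OF measurable_fst measurable_restrict_space1[OF us]]])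
  show "(\<lambda>(y, s, v). punish l y v s) \<in> borel_measurable ?M"
  proof (cases "l \<le> k")
    case True
    then show ?thesis using us' by (simp add: punish_def case_prod_unfold)
  next
    case False
    define i where "i = macro l"
    have i: "i < m" "grid i < l" "l \<le> grid (Suc i)" "i \<le> m" using macro[of l] False l by (auto simp: i_def)
    have J: "{p} \<times> {k..<grid i} \<subseteq> info p k l" using i by (auto simp: info_def)
    have pr: "(\<lambda>x. (fst x, snd (snd x))) \<in> measurable ?M (?Y \<Otimes>\<^sub>M ?V)"
      by (intro measurable_Pair measurable_fst measurable_compose[OF measurable_snd measurable_snd])
    have st: "discretely_measurable ?M (\<lambda>x. state i (fst x) (snd (snd x)))"
      using discretely_measurable_comp[OF pr discretely_measurable_state[OF i(4) J]] by simp
    have dr: "(\<lambda>x. draw \<mu> (fst x (p, l - 1))) \<in> borel_measurable ?M" for \<mu> :: "'u relaxed"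
    proof -
      have "(p, l - 1) \<in> info p k l" by (simp add: info_def)
      then have "(\<lambda>x. draw_index (fst \<mu>) (fst x (p, l - 1))) \<in> measurable ?M (count_space UNIV)"
        by (intro measurable_compose[OF _ measurable_draw_index] measurable_compose[OF measurable_fst measurable_component_singleton])
      from measurable_compose[OF this, of "snd \<mu>"] show ?thesis unfolding draw_def by simp
    qed
    have det: "{x \<in> space ?M. undetected i (snd (snd x))} \<in> sets ?M"
      using measurable_sets[OF measurable_compose[OF measurable_snd measurable_snd] measurable_undetected[OF i(4)], of ?Y ?R]
      by (rule back_subst[of "\<lambda>A. A \<in> sets ?M"]) (auto simp: space_pair_measure)
    have "(\<lambda>x. if undetected i (snd (snd x)) then us (fst (snd x))
        else draw (fst (case_prod aim (state i (fst x) (snd (snd x))))) (fst x (p, l - 1))) \<in> borel_measurable ?M"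
      by (rule measurable_If[OF us' discretely_measurable_compose[OF st dr] det])
    then show ?thesis using False unfolding punish_def i_def[symmetric] by (simp add: case_prod_unfold)
  qed
next
  fix l and v v' :: "real \<Rightarrow> 'v" and y :: "2 \<times> nat \<Rightarrow> real" assume l: "l \<in> {k..<length \<pi>}" and v: "v \<in> controls t T" "v' \<in> controls t T"
    and eq: "AE s in lebesgue_on {t..\<pi> ! (l - 1)}. v s = v' s" and "y \<in> space (PiM (info p k l) (\<lambda>_. borel))"
  have "punish l y v s = punish l y v' s" for s
  proof (cases "l \<le> k")
    case False
    have i: "macro l < m" "grid (macro l) < l" "l \<le> grid (Suc (macro l))" using macro[of l] False l by auto
    have "\<pi> ! grid (macro l) \<le> \<pi> ! (l - 1)" using i l by (intro \<pi>_mono) auto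
    then have eq': "AE s in lebesgue_on {t..\<pi> ! grid (macro l)}. v s = v' s"
      by (intro AE_lebesgue_on_mono[OF eq]) auto
    have "macro l \<le> m" using i by simp
    then show ?thesis
      using undetected_cong[OF _ v eq'] state_cong[OF _ v eq', of y y] by (simp add: punish_def)
  qed (simp add: punish_def)
  then show "AE s in lebesgue_on {max t (\<pi> ! (l - 1))..\<pi> ! l}. punish l y v s = punish l y v' s" by simp
qed

end

section \<open>Pathwise estimates\<close>
lemma avg_set_integral:
  fixes g :: "'a \<Rightarrow> real \<Rightarrow> real"
  assumes "\<And>u. set_integrable lebesgue A (g u)"
  shows "avg \<mu> (\<lambda>u. LINT s:A|lebesgue. g u s) = (LINT s:A|lebesgue. avg \<mu> (\<lambda>u. g u s))"
    and "set_integrable lebesgue A (\<lambda>s. avg \<mu> (\<lambda>u. g u s))"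
proof -
  have int: "integrable lebesgue (\<lambda>s. indicator A s *\<^sub>R g u s)" for u
    using assms by (simp add: set_integrable_def)
  have eq: "indicator A s *\<^sub>R avg \<mu> (\<lambda>u. g u s) = (\<Sum>i\<le>fst \<mu>. indicator A s *\<^sub>R g (snd \<mu> i) s) /\<^sub>R real (Suc (fst \<mu>))" for s
    unfolding avg_def by (simp only: scaleR_sum_right scaleR_left_commute)
  show "set_integrable lebesgue A (\<lambda>s. avg \<mu> (\<lambda>u. g u s))"
    unfolding set_integrable_def eq by (intro integrable_scaleR_right Bochner_Integration.integrable_sum int)
  show "avg \<mu> (\<lambda>u. LINT s:A|lebesgue. g u s) = (LINT s:A|lebesgue. avg \<mu> (\<lambda>u. g u s))"
    unfolding set_lebesgue_integral_def eq
    by (subst integral_scaleR_right) (simp only: Bochner_Integration.integral_sum[OF int] avg_def)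
qed

lemma norm_add3: "norm (a + b + c) \<le> norm a + norm b + norm (c :: 'a::real_normed_vector)"
  by (rule order_trans[OF norm_triangle_ineq add_right_mono[OF norm_triangle_ineq]])

lemma norm_diff3: "norm (a - b - c) \<le> norm a + norm b + norm (c :: 'a::real_normed_vector)"
  by (rule order_trans[OF norm_triangle_ineq4 add_right_mono[OF norm_triangle_ineq4]])

context game
begin

lemma prob_space_law: "prob_space law"
  by (intro prob_space_PiM prob_space_uniform01)

lemma sets_law: "sets law = sets (PiM signals (\<lambda>_. borel))"
  by (rule sets_PiM_cong) auto

lemma space_law: "space law = space (PiM signals (\<lambda>_. borel :: real measure))"
  by (rule sets_eq_imp_space_eq[OF sets_law])

lemma law_update: "z \<in> space law \<Longrightarrow> c \<in> signals \<Longrightarrow> z(c := r) \<in> space law"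
  by (auto simp: space_PiM PiE_def extensional_def)

text \<open>
  Conditioning on all coordinates but \<open>c\<close>, in the form of Fubini's theorem.
\<close>
lemma coordinate_integral_le:
  fixes \<Psi> \<Theta> :: "(2 \<times> nat \<Rightarrow> real) \<Rightarrow> real"
  assumes c: "c \<in> signals"
    and m: "\<Psi> \<in> borel_measurable law" "\<Theta> \<in> borel_measurable law"
    and K: "\<And>z. z \<in> space law \<Longrightarrow> \<bar>\<Psi> z\<bar> \<le> K" "\<And>z. z \<in> space law \<Longrightarrow> \<bar>\<Theta> z\<bar> \<le> K"
    and le: "\<And>z. z \<in> space law \<Longrightarrow> (\<integral>r. \<Psi> (z(c := r)) \<partial>uniform01) \<le> \<Theta> z"
  shows "(\<integral>z. \<Psi> z \<partial>law) \<le> (\<integral>z. \<Theta> z \<partial>law)"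
proof -
  interpret Pr: prob_space law by (rule prob_space_law)
  interpret U: prob_space uniform01 by (rule prob_space_uniform01)
  interpret product_prob_space "\<lambda>_::2 \<times> nat. uniform01" by (rule product_prob_spaceI) (rule prob_space_uniform01)
  let ?I = "signals - {c}"
  interpret Q: prob_space "PiM ?I (\<lambda>_. uniform01)" by (intro prob_space_PiM prob_space_uniform01)
  have I: "signals = insert c ?I" "finite ?I" "c \<notin> ?I" using c by auto
  have int: "integrable law \<Psi>" "integrable law \<Theta>"
    by (intro Pr.integrable_const_bound[of _ K] AE_I2; use m K in simp)+
  have up: "(\<lambda>r. x(c := r)) \<in> measurable uniform01 law" if "x \<in> space (PiM ?I (\<lambda>_. uniform01))" for x
    using measurable_component_update[OF that, of c] I(3) by (simp only: I(1)[symmetric] insert_Diff_single insert_absorb[OF c] not_False_eq_True)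
  have sp: "x(c := r) \<in> space law" if "x \<in> space (PiM ?I (\<lambda>_. uniform01))" for x r
    using measurable_space[OF up[OF that], of r] by simp
  have fold: "integral\<^sup>L law F = (\<integral>x. (\<integral>r. F (x(c := r)) \<partial>uniform01) \<partial>PiM ?I (\<lambda>_. uniform01))"
    "integrable (PiM ?I (\<lambda>_. uniform01)) (\<lambda>x. \<integral>r. F (x(c := r)) \<partial>uniform01)"
    if F: "F \<in> borel_measurable law" "\<And>z. z \<in> space law \<Longrightarrow> \<bar>F z\<bar> \<le> K" for F :: "(2 \<times> nat \<Rightarrow> real) \<Rightarrow> real"
  proof -
    have intF: "integrable law F" by (intro Pr.integrable_const_bound[of _ K] AE_I2) (use F in simp_all)
    show "integral\<^sup>L law F = (\<integral>x. (\<integral>r. F (x(c := r)) \<partial>uniform01) \<partial>PiM ?I (\<lambda>_. uniform01))"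
      using product_integral_insert[OF I(2,3), of F] intF I(1) by simp
    have "(\<lambda>(x, r). x(c := r)) \<in> measurable (PiM ?I (\<lambda>_. uniform01) \<Otimes>\<^sub>M uniform01) law"
      using measurable_add_dim[of c ?I "\<lambda>_. uniform01"] I(1) by simp
    from measurable_compose[OF this F(1)]
    have "(\<lambda>(x, r). F (x(c := r))) \<in> borel_measurable (PiM ?I (\<lambda>_. uniform01) \<Otimes>\<^sub>M uniform01)" by (simp add: case_prod_unfold)
    then have meas: "(\<lambda>x. \<integral>r. F (x(c := r)) \<partial>uniform01) \<in> borel_measurable (PiM ?I (\<lambda>_. uniform01))"
      by (rule U.borel_measurable_lebesgue_integral)
    have "\<bar>\<integral>r. F (x(c := r)) \<partial>uniform01\<bar> \<le> K" if x: "x \<in> space (PiM ?I (\<lambda>_. uniform01))" for x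
    proof -
      have b: "\<bar>F (x(c := r))\<bar> \<le> K" for r using F(2) sp[OF x] by blast
      have "norm (\<integral>r. F (x(c := r)) \<partial>uniform01) \<le> (\<integral>r. K \<partial>uniform01)"
        by (rule Bochner_Integration.integral_norm_bound_integral)
          (use b measurable_compose[OF up[OF x] F(1)] in \<open>auto intro!: U.integrable_const_bound[of _ K]\<close>)
      then show ?thesis using U.prob_space by simp
    qed
    then show "integrable (PiM ?I (\<lambda>_. uniform01)) (\<lambda>x. \<integral>r. F (x(c := r)) \<partial>uniform01)"
      by (intro Q.integrable_const_bound[of _ K] AE_I2) (use meas in auto)
  qed
  have "(\<integral>x. (\<integral>r. \<Psi> (x(c := r)) \<partial>uniform01) \<partial>PiM ?I (\<lambda>_. uniform01)) \<le>
      (\<integral>x. (\<integral>r. \<Theta> (x(c := r)) \<partial>uniform01) \<partial>PiM ?I (\<lambda>_. uniform01))"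
  proof (rule integral_mono)
    show "integrable (PiM ?I (\<lambda>_. uniform01)) (\<lambda>x. \<integral>r. \<Psi> (x(c := r)) \<partial>uniform01)"
      by (rule fold(2)[OF m(1)]) (rule K)
    show "integrable (PiM ?I (\<lambda>_. uniform01)) (\<lambda>x. \<integral>r. \<Theta> (x(c := r)) \<partial>uniform01)"
      by (rule fold(2)[OF m(2)]) (rule K)
    fix x assume x: "x \<in> space (PiM ?I (\<lambda>_. uniform01))"
    have le': "(\<integral>r. \<Psi> (x(c := r)) \<partial>uniform01) \<le> \<Theta> (x(c := s))" for s
      using le[OF sp[OF x, of s]] by simp
    have "(\<integral>r. \<Psi> (x(c := r)) \<partial>uniform01) = (\<integral>s. (\<integral>r. \<Psi> (x(c := r)) \<partial>uniform01) \<partial>uniform01)"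
      using U.prob_space by simp
    also have "\<dots> \<le> (\<integral>s. \<Theta> (x(c := s)) \<partial>uniform01)"
    proof (rule integral_mono)
      show "integrable uniform01 (\<lambda>s. \<Theta> (x(c := s)))"
        by (intro U.integrable_const_bound[of _ K] AE_I2)
          (use K(2) sp[OF x] measurable_compose[OF up[OF x] m(2)] in auto)
    qed (use le' in auto)
    finally show "(\<integral>r. \<Psi> (x(c := r)) \<partial>uniform01) \<le> (\<integral>s. \<Theta> (x(c := s)) \<partial>uniform01)" .
  qed
  moreover have "integral\<^sup>L law \<Psi> = (\<integral>x. (\<integral>r. \<Psi> (x(c := r)) \<partial>uniform01) \<partial>PiM ?I (\<lambda>_. uniform01))"
    by (rule fold(1)[OF m(1)]) (rule K)
  moreover have "integral\<^sup>L law \<Theta> = (\<integral>x. (\<integral>r. \<Theta> (x(c := r)) \<partial>uniform01) \<partial>PiM ?I (\<lambda>_. uniform01))"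
    by (rule fold(1)[OF m(2)]) (rule K)
  ultimately show ?thesis by (simp only:)
qed

end

text \<open>
  The quantitative hypotheses: \<open>aim\<close> is an approximate saddle point for the direction
  from the guide to the position, the function \<open>w\<close>, which stands for the guide value
  of the opponent, does not increase under the response \<open>react\<close> by more than
  \<open>h\<^sup>2\<close>, and on the plan it is bounded by \<open>G\<close>, to be thought of as
  the payoff of the plan.
\<close>
locale punishment_estimate = punishment f C L T t \<pi> k p m h X us vs d aim react
  for f :: "real^'n \<Rightarrow> 'u::metric_space \<Rightarrow> 'v::metric_space \<Rightarrow> real^'n" and C L T t \<pi> k p m h X us vs d aim react +
  fixes q :: 2 and w :: "nat \<Rightarrow> real^'n \<Rightarrow> real" and G c0 :: real
  assumes pq: "p \<noteq> q" and h_le: "h \<le> 1" and fine: "\<And>j. Suc j < length \<pi> \<Longrightarrow> \<pi> ! Suc j - \<pi> ! j \<le> h\<^sup>2"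
    and aim: "\<And>a b u v. avg (fst (aim a b)) (\<lambda>u. (a - b) \<bullet> f a u v) \<le> avg (snd (aim a b)) (\<lambda>v. (a - b) \<bullet> f a u v) + h"
    and X_step: "\<And>i. i < m \<Longrightarrow> norm (X (Suc i) - X i) \<le> C * h"
    and plan: "\<And>i. i \<le> m \<Longrightarrow> norm (trajectory f T t (X 0) us vs (t + real i * h) - X i) \<le> c0 * h" and c0: "c0 \<ge> 0"
    and w_plan: "\<And>i. i \<le> m \<Longrightarrow> w i (X i) \<le> G"
    and w_react: "\<And>i y \<nu>. i < m \<Longrightarrow> w (Suc i) (y + h *\<^sub>R relaxed_field f y (react i y \<nu>) \<nu>) \<le> w i y + h\<^sup>2"
begin

lemma h2_le: "h\<^sup>2 \<le> h"
  using h_pos h_le by (simp add: power2_eq_square mult_left_le)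

lemma grid_upper:
  assumes "i \<le> m"
  shows "\<pi> ! grid i \<le> t + real i * h + h\<^sup>2"
proof (cases "grid i = k")
  case True
  have "\<pi> ! Suc (k - 1) - \<pi> ! (k - 1) \<le> h\<^sup>2" using k by (intro fine) auto
  then have "\<pi> ! k \<le> t + h\<^sup>2" using t k by auto
  moreover have "0 \<le> real i * h" using h_pos by simp
  ultimately show ?thesis using True by simp
next
  case False
  then have l: "k \<le> grid i - 1" "grid i - 1 < grid i" using grid(1)[OF assms] by auto
  have "\<pi> ! (grid i - 1) < t + real i * h"
    using not_less_Least[of "grid i - 1" "\<lambda>l. k \<le> l \<and> t + real i * h \<le> \<pi> ! l"] l unfolding grid_def[symmetric] by auto
  moreover have "\<pi> ! Suc (grid i - 1) - \<pi> ! (grid i - 1) \<le> h\<^sup>2" using l grid(3)[OF assms] by (intro fine) auto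
  moreover have "Suc (grid i - 1) = grid i" using l by auto
  ultimately show ?thesis by simp
qed

lemma grid_step:
  assumes "i < m"
  shows "\<bar>(\<pi> ! grid (Suc i) - \<pi> ! grid i) - h\<bar> \<le> h\<^sup>2" "\<pi> ! grid i \<le> \<pi> ! grid (Suc i)" "\<pi> ! grid (Suc i) - \<pi> ! grid i \<le> 2 * h"
    "t \<le> \<pi> ! grid i" "\<pi> ! grid (Suc i) \<le> T"
proof -
  have "real (Suc i) * h = real i * h + h" by (simp add: algebra_simps)
  then show 1: "\<bar>(\<pi> ! grid (Suc i) - \<pi> ! grid i) - h\<bar> \<le> h\<^sup>2"
    using grid(2)[of i] grid(2)[of "Suc i"] grid_upper[of i] grid_upper[of "Suc i"] assms by auto
  then show "\<pi> ! grid (Suc i) - \<pi> ! grid i \<le> 2 * h" using h2_le by linarith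
  show "\<pi> ! grid i \<le> \<pi> ! grid (Suc i)" using grid_mono[of i "Suc i"] grid(3)[of "Suc i"] assms by (intro \<pi>_mono) auto
  show "t \<le> \<pi> ! grid i" using grid(1,3)[of i] assms t_less_\<pi>[of "grid i"] by auto
  show "\<pi> ! grid (Suc i) \<le> T" using grid(3)[of "Suc i"] assms by (intro \<pi>_le_T) auto
qed

lemma punish_restrict:
  assumes l: "l \<in> {k..<length \<pi>}" and v: "v \<in> controls t T"
  shows "punish l (restrict z (info p k l)) v s = punish l z v s"
proof (cases "l \<le> k")
  case False
  have i: "macro l < m" "grid (macro l) < l" using macro[of l] False l by auto
  have "state (macro l) (restrict z (info p k l)) v = state (macro l) z v"
    by (rule state_cong[OF _ v v]) (use i in \<open>auto simp: info_def\<close>)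
  then show ?thesis by (simp add: punish_def info_def)
qed (simp add: punish_def)

lemma undetected_mono:
  assumes "i \<le> j" "j \<le> m" "v \<in> controls t T" "undetected j v"
  shows "undetected i v"
proof -
  have "\<pi> ! grid i \<le> \<pi> ! grid j" using grid_mono[OF assms(1,2)] grid(3)[OF assms(2)] by (rule \<pi>_mono)
  moreover have "AE s in lebesgue_on {t..\<pi> ! grid j}. v s = vs s" using assms undetected_iff[of j v] by simp
  ultimately have "AE s in lebesgue_on {t..\<pi> ! grid i}. v s = vs s" by (elim AE_lebesgue_on_mono) auto
  then show ?thesis using undetected_iff[of i v] assms by simp
qed

lemma sum_stage_integrals:
  fixes g :: "real \<Rightarrow> real^'n"
  assumes "i0 \<le> i1" "k \<le> i0" "i1 < length \<pi>" and g: "set_integrable lebesgue {t..T} g"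
  shows "(\<Sum>l\<in>{i0<..i1}. LINT r:{\<pi> ! (l - 1)..\<pi> ! l}|lebesgue. g r) = (LINT r:{\<pi> ! i0..\<pi> ! i1}|lebesgue. g r)"
  using assms(1,3)
proof (induction i1 rule: dec_induct)
  case base
  have "(LINT r:{\<pi> ! i0..\<pi> ! i0}|lebesgue. g r) = 0"
    using set_integral_split[of "\<pi> ! i0" "\<pi> ! i0" "\<pi> ! i0" g] set_integrable_subset[OF g, of "{\<pi> ! i0..\<pi> ! i0}"]
      t_less_\<pi>[of i0] \<pi>_le_T[of i0] assms by auto
  then show ?case by simp
next
  case (step n)
  have "{i0<..Suc n} = insert (Suc n) {i0<..n}" using step by auto
  moreover have "(LINT r:{\<pi> ! i0..\<pi> ! Suc n}|lebesgue. g r) = (LINT r:{\<pi> ! i0..\<pi> ! n}|lebesgue. g r) + (LINT r:{\<pi> ! n..\<pi> ! Suc n}|lebesgue. g r)"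
  proof (rule set_integral_split)
    show "\<pi> ! i0 \<le> \<pi> ! n" "\<pi> ! n \<le> \<pi> ! Suc n" using step by (auto intro: \<pi>_mono)
    have "{\<pi> ! i0..\<pi> ! Suc n} \<subseteq> {t..T}" using t_less_\<pi>[of i0] \<pi>_le_T[of "Suc n"] step assms by auto
    then show "set_integrable lebesgue {\<pi> ! i0..\<pi> ! Suc n} g" by (intro set_integrable_subset[OF g]) auto
  qed
  ultimately show ?case using step by (simp add: add.commute)
qed

text \<open>
  Constants that depend neither on the step nor on the partition: \<open>R\<close> bounds the
  distance between estimate and guide, \<open>K1 * h\<close> the error of the estimate, \<open>K2
  * h\<^sup>2\<close> the second order terms in one step of the squared distance, and \<open>K3 *
  h\<^sup>2\<close> all the terms of that step which are not proportional to the squared distance.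
\<close>
definition "R = (T - t) * (3 * C + 1)"
definition "K1 = exp (2 * L * (T - t)) * ((c0 + 4 * C) + (T - t) * (4 * L * C + 1))"
definition "K2 = 9 * C\<^sup>2 + 2 * (R + 3 * C) + 1"
definition "K3 = K2 + 2 * (R * C + 2)"

context
  fixes b z u v
  assumes cons: "consistent p q punish b z u v"
begin

lemma ctrl: "u \<in> controls t T" "v \<in> controls t T"
  using cons by (auto simp: consistent_def)

lemma response:
  assumes "l \<in> {k..<length \<pi>}"
  shows "AE s in lebesgue_on {max t (\<pi> ! (l - 1))..\<pi> ! l}. u s = punish l z v s"
  using cons assms unfolding consistent_def punish_restrict[OF assms ctrl(2)] by (auto simp: punish_restrict[OF _ ctrl(2)])

lemma u_undetected:
  assumes i: "i \<le> m" and U: "undetected i v"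
  shows "AE s in lebesgue_on {t..\<pi> ! grid i}. u s = us s"
proof -
  have "AE s in lebesgue_on {max t (\<pi> ! (l - 1))..\<pi> ! l}. u s = us s" if l: "l \<in> {k..grid i}" for l
  proof -
    have l': "l \<in> {k..<length \<pi>}" using l grid(3)[OF i] by auto
    have "punish l z v s = us s" for s
    proof (cases "l \<le> k")
      case False
      have mac: "macro l < m" "grid (macro l) < l" using macro[of l] False l' by auto
      have "macro l \<le> i"
      proof (rule ccontr)
        assume "\<not> macro l \<le> i"
        then have "grid i \<le> grid (macro l)" using mac by (intro grid_mono) auto
        then show False using l mac by simp
      qed
      then show ?thesis using undetected_mono[OF _ i ctrl(2) U] by (simp add: punish_def)
    qed (simp add: punish_def)
    then show ?thesis using response[OF l'] by simp
  qed
  then have "AE s in lebesgue. \<forall>l\<in>{k..grid i}. s \<in> {max t (\<pi> ! (l - 1))..\<pi> ! l} \<longrightarrow> u s = us s"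
    unfolding AE_lebesgue_on_Icc by (intro AE_finite_allI) auto
  then show ?thesis
    unfolding AE_lebesgue_on_Icc using AE_lebesgue_neq[of "\<pi> ! grid i"]
  proof eventually_elim
    case (elim s)
    show ?case
    proof
      assume "s \<in> {t..\<pi> ! grid i}"
      then have "\<exists>l\<in>{k..grid i}. s \<in> stage l" using elim(2) grid(3)[OF i] by (intro stage_exists) auto
      then obtain l where "l \<in> {k..grid i}" "s \<in> stage l" by blast
      then show "u s = us s" using elim(1)[rule_format, of l] by auto
    qed
  qed
qed

abbreviation "traj \<equiv> trajectory f T t (X 0) u v"
abbreviation "traj_plan \<equiv> trajectory f T t (X 0) us vs"
abbreviation "pos i \<equiv> fst (state i z v)"
abbreviation "gde i \<equiv> snd (state i z v)"

lemma traj_undetected: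
  assumes i: "i \<le> m" and U: "undetected i v"
  shows "traj (\<pi> ! grid i) = traj_plan (\<pi> ! grid i)"
proof (rule trajectory_cong_AE[OF ctrl borel_controls[OF us] borel_controls[OF vs]])
  show "\<pi> ! grid i \<in> {t..T}" using grid[OF i] t_less_\<pi>[of "grid i"] \<pi>_le_T[of "grid i"] by auto
  show "AE r in lebesgue_on {t..\<pi> ! grid i}. u r = us r" by (rule u_undetected[OF i U])
  show "AE r in lebesgue_on {t..\<pi> ! grid i}. v r = vs r" using undetected_iff[OF i ctrl(2)] U by simp
qed

definition "incr i = (LINT r:{\<pi> ! grid i..\<pi> ! grid (Suc i)}|lebesgue. f (pos i) (u r) (v r))"

definition "stage_incr i l = (LINT r:{\<pi> ! (l - 1)..\<pi> ! l}|lebesgue. f (pos i) (draw (fst (aim (pos i) (gde i))) (z (p, l - 1))) (v r))"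

text \<open>
  The increment in \<open>state\<close>, computed with the drawn actions, is the one produced by
  the control actually played.
\<close>
lemma stage_incr_sum:
  assumes i: "i < m" and D: "\<not> undetected i v"
  shows "(\<Sum>l\<in>{grid i<..grid (Suc i)}. stage_incr i l) = incr i"
proof -
  have "stage_incr i l = (LINT r:{\<pi> ! (l - 1)..\<pi> ! l}|lebesgue. f (pos i) (u r) (v r))" if l: "l \<in> {grid i<..grid (Suc i)}" for l
    unfolding stage_incr_def
  proof (rule set_integral_cong_AE_on)
    note si = stage_interval[OF i l]
    have mac: "macro l = i" using i l by (intro macro_eq) auto
    have "AE r in lebesgue_on {\<pi> ! (l - 1)..\<pi> ! l}. u r = draw (fst (aim (pos i) (gde i))) (z (p, l - 1))"
      using response[OF si(1)] si(2) D unfolding si(7) by (simp add: punish_def mac case_prod_unfold)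
    then show "AE r in lebesgue_on {\<pi> ! (l - 1)..\<pi> ! l}.
        f (pos i) (draw (fst (aim (pos i) (gde i))) (z (p, l - 1))) (v r) = f (pos i) (u r) (v r)"
      by eventually_elim simp
    show "set_integrable lebesgue {\<pi> ! (l - 1)..\<pi> ! l} (\<lambda>r. f (pos i) (draw (fst (aim (pos i) (gde i))) (z (p, l - 1))) (v r))"
      by (rule set_integrable_f[OF _ _ ctrl(2) si(4)]) (simp_all add: controls_def)
    show "set_integrable lebesgue {\<pi> ! (l - 1)..\<pi> ! l} (\<lambda>r. f (pos i) (u r) (v r))"
      by (rule set_integrable_f[OF _ ctrl si(4)]) simp
  qed
  then have "(\<Sum>l\<in>{grid i<..grid (Suc i)}. stage_incr i l) =
      (\<Sum>l\<in>{grid i<..grid (Suc i)}. LINT r:{\<pi> ! (l - 1)..\<pi> ! l}|lebesgue. f (pos i) (u r) (v r))"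
    by (rule sum.cong[OF refl])
  also have "\<dots> = incr i" unfolding incr_def
    by (rule sum_stage_integrals[OF grid_mono grid(1) grid(3)])
      (use i in \<open>auto intro: set_integrable_f[OF _ ctrl order_refl]\<close>)
  finally show ?thesis .
qed

lemma norm_incr: "i < m \<Longrightarrow> norm (incr i) \<le> 2 * C * h"
proof -
  assume i: "i < m"
  have "norm (incr i) \<le> (\<pi> ! grid (Suc i) - \<pi> ! grid i) * C"
    unfolding incr_def by (rule norm_set_integral_le[OF grid_step(2)[OF i]]) (rule bounded)
  also have "\<dots> \<le> (2 * h) * C" using grid_step(3)[OF i] C_pos by (intro mult_right_mono) auto
  finally show ?thesis by (simp add: mult_ac)
qed

lemma state_detected:
  assumes i: "i < m" and D: "\<not> undetected i v"
  shows "norm (pos (Suc i) - (pos i + incr i)) \<le> h\<^sup>2"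
    "gde (Suc i) = gde i + h *\<^sub>R relaxed_field f (gde i) (react i (gde i) (snd (aim (pos i) (gde i)))) (snd (aim (pos i) (gde i)))"
proof -
  have "pos (Suc i) = d (near d (h\<^sup>2) (pos i + incr i))"
    using D stage_incr_sum[OF i D] by (simp add: case_prod_unfold stage_incr_def)
  moreover have "h\<^sup>2 > 0" using h_pos by simp
  from dist_near[OF d this, of "pos i + incr i"]
  have "norm (d (near d (h\<^sup>2) (pos i + incr i)) - (pos i + incr i)) < h\<^sup>2" by (simp add: dist_norm norm_minus_commute)
  ultimately show "norm (pos (Suc i) - (pos i + incr i)) \<le> h\<^sup>2" by simp
  show "gde (Suc i) = gde i + h *\<^sub>R relaxed_field f (gde i) (react i (gde i) (snd (aim (pos i) (gde i)))) (snd (aim (pos i) (gde i)))"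
    using D by (simp add: case_prod_unfold)
qed

lemma state_undetected: "undetected i v \<Longrightarrow> pos (Suc i) = X (Suc i) \<and> gde (Suc i) = X (Suc i)"
  by simp

lemma X_dist: "i \<le> m \<Longrightarrow> norm (X i - X 0) \<le> real i * (C * h)"
proof (induction i)
  case (Suc i)
  have "norm (X (Suc i) - X 0) \<le> norm (X (Suc i) - X i) + norm (X i - X 0)"
    using norm_triangle_ineq[of "X (Suc i) - X i" "X i - X 0"] by simp
  then show ?case using Suc X_step[of i] by (simp add: algebra_simps)
qed simp

lemma pos_dist: "i \<le> m \<Longrightarrow> norm (pos i - X 0) \<le> real i * ((2 * C + 1) * h)"
proof (induction i)
  case (Suc i)
  show ?case
  proof (cases "undetected i v")
    case True
    have "norm (X (Suc i) - X 0) \<le> real (Suc i) * (C * h)" using X_dist[of "Suc i"] Suc.prems by simp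
    also have "\<dots> \<le> real (Suc i) * ((2 * C + 1) * h)" using C_pos h_pos by (intro mult_left_mono mult_right_mono) auto
    finally show ?thesis using True by simp
  next
    case False
    have i: "i < m" using Suc by simp
    have "pos (Suc i) - X 0 = (pos (Suc i) - (pos i + incr i)) + incr i + (pos i - X 0)" by simp
    then have "norm (pos (Suc i) - X 0) \<le> norm (pos (Suc i) - (pos i + incr i)) + norm (incr i) + norm (pos i - X 0)"
      by (simp only: norm_add3)
    also have "\<dots> \<le> h + 2 * C * h + real i * ((2 * C + 1) * h)"
      using state_detected(1)[OF i False] norm_incr[OF i] Suc h2_le by (intro add_mono) auto
    finally show ?thesis by (simp add: algebra_simps)
  qed
qed simp

lemma gde_dist: "i \<le> m \<Longrightarrow> norm (gde i - X 0) \<le> real i * (C * h)"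
proof (induction i)
  case (Suc i)
  show ?case
  proof (cases "undetected i v")
    case True
    then show ?thesis using X_dist[of "Suc i"] Suc.prems by simp
  next
    case False
    have i: "i < m" using Suc by simp
    let ?F = "relaxed_field f (gde i) (react i (gde i) (snd (aim (pos i) (gde i)))) (snd (aim (pos i) (gde i)))"
    have "norm (gde (Suc i) - X 0) \<le> norm (gde i - X 0) + norm (h *\<^sub>R ?F)"
      unfolding state_detected(2)[OF i False] using norm_triangle_ineq[of "gde i - X 0" "h *\<^sub>R ?F"] by (simp add: algebra_simps)
    also have "norm (h *\<^sub>R ?F) \<le> h * C" using norm_relaxed_field h_pos by (simp add: mult_left_mono)
    finally show ?thesis using Suc by (simp add: algebra_simps)
  qed
qed simp

lemma gap_bounded:
  assumes "i \<le> m"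
  shows "norm (pos i - gde i) \<le> R"
proof -
  have "norm (pos i - gde i) \<le> norm (pos i - X 0) + norm (gde i - X 0)"
    using norm_triangle_ineq4[of "pos i - X 0" "gde i - X 0"] by simp
  also have "\<dots> \<le> real i * ((2 * C + 1) * h) + real i * (C * h)" by (intro add_mono pos_dist gde_dist assms)
  also have "\<dots> = (real i * h) * (3 * C + 1)" by (simp add: algebra_simps)
  also have "\<dots> \<le> (T - t) * (3 * C + 1)"
  proof (rule mult_right_mono)
    have "real i * h \<le> real m * h" using assms h_pos by (intro mult_right_mono) auto
    then show "real i * h \<le> T - t" using h_T by simp
  qed (use C_pos in simp)
  finally show ?thesis by (simp add: R_def)
qed

text \<open>
  A detection can occur only from a state on the plan, where the value is at most
  \<open>G\<close>; afterwards the guide follows \<open>react\<close>.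
\<close>
lemma guide_value_decreases: "i \<le> m \<Longrightarrow> w i (gde i) \<le> G + real i * h\<^sup>2"
proof (induction i)
  case 0
  then show ?case using w_plan[of 0] by simp
next
  case (Suc i)
  have "0 \<le> real (Suc i) * h\<^sup>2" by simp
  show ?case
  proof (cases "undetected i v")
    case True
    then have "gde (Suc i) = X (Suc i)" by simp
    then show ?thesis using w_plan[OF Suc.prems] \<open>0 \<le> real (Suc i) * h\<^sup>2\<close> by (simp only:)
  next
    case False
    have i: "i < m" using Suc by simp
    have "w (Suc i) (gde (Suc i)) \<le> w i (gde i) + h\<^sup>2"
      unfolding state_detected(2)[OF i False] by (rule w_react[OF i])
    then show ?thesis using Suc by (simp add: algebra_simps)
  qed
qed

text \<open>
  Before detection the estimate is reset to the plan, and the true trajectory, which follows the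
  plan up to the last decision, is within a multiple of \<open>h\<close>. After detection the
  estimate is the Euler scheme for the controls actually played.
\<close>
lemma tracking:
  assumes "i \<le> m"
  shows "norm (pos i - traj (\<pi> ! grid i)) \<le> K1 * h"
proof -
  define e where "e i = norm (pos i - traj (\<pi> ! grid i))" for i
  have T: "t \<le> T" using t_less_T by simp
  have plan_grid: "norm (traj_plan (\<pi> ! grid i) - X i) \<le> (c0 + C) * h" if i: "i \<le> m" for i
  proof -
    have "norm (traj_plan (\<pi> ! grid i) - traj_plan (t + real i * h)) \<le> C * (\<pi> ! grid i - (t + real i * h))"
      using grid[OF i] \<pi>_le_T[of "grid i"] h_pos by (intro trajectory_lipschitz borel_controls us vs) auto
    also have "\<dots> \<le> C * h" using grid_upper[OF i] h2_le C_pos by (intro mult_left_mono) auto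
    finally have "norm (traj_plan (\<pi> ! grid i) - traj_plan (t + real i * h)) \<le> C * h" .
    then show ?thesis
      using plan[OF i] norm_triangle_ineq[of "traj_plan (\<pi> ! grid i) - traj_plan (t + real i * h)" "traj_plan (t + real i * h) - X i"]
      by (simp add: algebra_simps)
  qed
  have step: "e (Suc i) \<le> (c0 + 4 * C) * h \<or> e (Suc i) \<le> (1 + 2 * L * h) * e i + (4 * L * C + 1) * h\<^sup>2" if i: "i < m" for i
  proof -
    note ls = grid_step[OF i]
    have xs: "norm (traj (\<pi> ! grid (Suc i)) - traj (\<pi> ! grid i)) \<le> 2 * C * h"
    proof -
      have "norm (traj (\<pi> ! grid (Suc i)) - traj (\<pi> ! grid i)) \<le> C * (\<pi> ! grid (Suc i) - \<pi> ! grid i)"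
        by (rule trajectory_lipschitz[OF ctrl ls(4,2,5)])
      also have "\<dots> \<le> C * (2 * h)" using ls(3) C_pos by (intro mult_left_mono) auto
      finally show ?thesis by simp
    qed
    show ?thesis
    proof (cases "undetected i v")
      case True
      have "X (Suc i) - traj (\<pi> ! grid (Suc i)) = (X (Suc i) - X i) - (traj_plan (\<pi> ! grid i) - X i) - (traj (\<pi> ! grid (Suc i)) - traj (\<pi> ! grid i))"
        using traj_undetected[OF _ True] i by simp
      then have "e (Suc i) \<le> norm (X (Suc i) - X i) + norm (traj_plan (\<pi> ! grid i) - X i) + norm (traj (\<pi> ! grid (Suc i)) - traj (\<pi> ! grid i))"
        unfolding e_def state_undetected[OF True, THEN conjunct1] by (simp only: norm_diff3)
      also have "\<dots> \<le> C * h + (c0 + C) * h + 2 * C * h" using i by (intro add_mono X_step plan_grid xs) auto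
      finally show ?thesis by (simp add: algebra_simps)
    next
      case False
      have sub: "{\<pi> ! grid i..\<pi> ! grid (Suc i)} \<subseteq> {t..T}" using ls by auto
      have int: "set_integrable lebesgue {\<pi> ! grid i..\<pi> ! grid (Suc i)} (\<lambda>r. f (pos i) (u r) (v r))"
        "set_integrable lebesgue {\<pi> ! grid i..\<pi> ! grid (Suc i)} (\<lambda>r. f (traj r) (u r) (v r))"
        by (rule set_integrable_f[OF _ ctrl sub], simp) (rule set_integrable_f[OF trajectory_unfold(1)[OF ctrl] ctrl sub])
      have eq: "incr i - (traj (\<pi> ! grid (Suc i)) - traj (\<pi> ! grid i)) =
          (LINT r:{\<pi> ! grid i..\<pi> ! grid (Suc i)}|lebesgue. f (pos i) (u r) (v r) - f (traj r) (u r) (v r))"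
        unfolding incr_def trajectory_increment[OF ctrl ls(4,2,5)] by (rule set_integral_diff(2)[OF int, symmetric])
      have "norm (incr i - (traj (\<pi> ! grid (Suc i)) - traj (\<pi> ! grid i))) \<le> (\<pi> ! grid (Suc i) - \<pi> ! grid i) * (L * (e i + 2 * C * h))"
        unfolding eq
      proof (rule norm_set_integral_le[OF ls(2)])
        fix r assume r: "r \<in> {\<pi> ! grid i..\<pi> ! grid (Suc i)}"
        have "norm (traj r - traj (\<pi> ! grid i)) \<le> C * (r - \<pi> ! grid i)"
          by (rule trajectory_lipschitz[OF ctrl]) (use r ls in auto)
        also have "\<dots> \<le> C * (2 * h)" using r ls(3) C_pos by (intro mult_left_mono) auto
        finally have "norm (pos i - traj r) \<le> e i + 2 * C * h"
          using norm_triangle_ineq4[of "pos i - traj (\<pi> ! grid i)" "traj r - traj (\<pi> ! grid i)"] by (simp add: e_def)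
        then show "norm (f (pos i) (u r) (v r) - f (traj r) (u r) (v r)) \<le> L * (e i + 2 * C * h)"
          using L_pos by (intro order_trans[OF lip] mult_left_mono) auto
      qed
      also have "\<dots> \<le> (2 * h) * (L * (e i + 2 * C * h))"
        using ls(3) L_pos C_pos h_pos by (intro mult_right_mono) (auto simp: e_def)
      finally have 1: "norm (incr i - (traj (\<pi> ! grid (Suc i)) - traj (\<pi> ! grid i))) \<le> (2 * h) * (L * (e i + 2 * C * h))" .
      have "pos (Suc i) - traj (\<pi> ! grid (Suc i)) = (pos (Suc i) - (pos i + incr i)) + (pos i - traj (\<pi> ! grid i)) + (incr i - (traj (\<pi> ! grid (Suc i)) - traj (\<pi> ! grid i)))"
        by simp
      then have "e (Suc i) \<le> norm (pos (Suc i) - (pos i + incr i)) + e i + norm (incr i - (traj (\<pi> ! grid (Suc i)) - traj (\<pi> ! grid i)))"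
        unfolding e_def by (simp only: norm_add3)
      also have "\<dots> \<le> h\<^sup>2 + e i + (2 * h) * (L * (e i + 2 * C * h))"
        using state_detected(1)[OF i False] 1 by (intro add_mono) auto
      also have "\<dots> = (1 + 2 * L * h) * e i + (4 * L * C + 1) * h\<^sup>2" by (simp add: algebra_simps power2_eq_square)
      finally show ?thesis by blast
    qed
  qed
  have "e 0 \<le> (c0 + 4 * C) * h"
  proof -
    have "norm (X 0 - traj (\<pi> ! grid 0)) \<le> C * (\<pi> ! grid 0 - t)"
      using trajectory_lipschitz[OF ctrl, of t "\<pi> ! grid 0" "X 0"] trajectory_start[OF ctrl T] grid[of 0] t_less_\<pi>[of "grid 0"] \<pi>_le_T[of "grid 0"]
      by (simp add: norm_minus_commute)
    also have "\<dots> \<le> C * h" using grid_upper[of 0] h2_le C_pos by (intro mult_left_mono) auto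
    also have "\<dots> \<le> (c0 + 4 * C) * h" using c0 C_pos h_pos by (intro mult_right_mono) auto
    finally show ?thesis by (simp add: e_def)
  qed
  then have "e i \<le> exp (2 * L * h * real i) * ((c0 + 4 * C) * h + real i * ((4 * L * C + 1) * h\<^sup>2))"
    using step assms h_pos L_pos C_pos c0
    by (intro discrete_gronwall[of "2 * L * h" "(4 * L * C + 1) * h\<^sup>2" "(c0 + 4 * C) * h" e m i]) auto
  also have "\<dots> \<le> exp (2 * L * (T - t)) * ((c0 + 4 * C) * h + ((T - t) * (4 * L * C + 1)) * h)"
  proof -
    have ih: "h * real i \<le> T - t" "0 \<le> h * real i"
      using assms h_pos h_T mult_left_mono[of "real i" "real m" h] by (auto simp: mult.commute)
    have 1: "exp (2 * L * h * real i) \<le> exp (2 * L * (T - t))" using ih L_pos by (simp add: mult.assoc)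
    have "real i * ((4 * L * C + 1) * h\<^sup>2) = (h * real i) * ((4 * L * C + 1) * h)" by (simp add: power2_eq_square)
    also have "\<dots> \<le> (T - t) * ((4 * L * C + 1) * h)" using ih L_pos C_pos h_pos by (intro mult_right_mono) auto
    finally have 2: "real i * ((4 * L * C + 1) * h\<^sup>2) \<le> ((T - t) * (4 * L * C + 1)) * h" by (simp add: mult.assoc)
    show ?thesis using c0 C_pos h_pos L_pos by (intro mult_mono[OF 1 add_left_mono[OF 2]] add_nonneg_nonneg mult_nonneg_nonneg) auto
  qed
  also have "\<dots> = K1 * h" by (simp add: K1_def algebra_simps)
  finally show ?thesis by (simp add: e_def)
qed

end

end

context punishment_estimate
begin

section \<open>The expected distance from the guide\<close>
text \<open>
  An upper bound for the mean of \<open>(a - b) \<bullet> f a u v\<close> over the relaxed action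
  of the punisher, valid for every action \<open>v\<close> of the opponent. Up to
  \<open>h\<close>, it is the inner product of \<open>a - b\<close> with the velocity of the
  guide, evaluated at \<open>a\<close>.
\<close>
definition \<theta> :: "nat \<Rightarrow> (real^'n) \<times> (real^'n) \<Rightarrow> real" where
  "\<theta> i = (\<lambda>(a, b). (a - b) \<bullet> relaxed_field f a (react i b (snd (aim a b))) (snd (aim a b)) + h)"

definition guide_field :: "nat \<Rightarrow> (real^'n) \<times> (real^'n) \<Rightarrow> real^'n" where
  "guide_field i = (\<lambda>(a, b). relaxed_field f b (react i b (snd (aim a b))) (snd (aim a b)))"

text \<open>
  The saddle property bounds the left-hand side by the mean over the second relaxed action for
  each \<open>u\<close>, hence also for \<open>u\<close> averaged according to
  \<open>react\<close>.
\<close>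
lemma aim_\<theta>: "avg (fst (aim a b)) (\<lambda>u. (a - b) \<bullet> f a u v) \<le> \<theta> i (a, b)"
proof -
  let ?\<mu> = "fst (aim a b)" and ?\<nu> = "snd (aim a b)" and ?r = "react i b (snd (aim a b))"
  have lin: "linear (\<lambda>y. (a - b) \<bullet> y)" by (rule bounded_linear.linear[OF bounded_linear_inner_right])
  have "avg ?r (\<lambda>_. avg ?\<mu> (\<lambda>u. (a - b) \<bullet> f a u v)) \<le> avg ?r (\<lambda>u. avg ?\<nu> (\<lambda>v. (a - b) \<bullet> f a u v) + h)"
    by (intro avg_mono aim)
  then show ?thesis
    unfolding avg_const avg_add by (simp add: \<theta>_def relaxed_field_def avg_linear[OF lin])
qed

lemma R_nonneg: "0 \<le> R" using t_less_T C_pos by (simp add: R_def)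

lemma \<theta>_bound:
  assumes "norm (a - b) \<le> R"
  shows "\<bar>\<theta> i (a, b)\<bar> \<le> R * C + 1"
proof -
  have "\<bar>(a - b) \<bullet> relaxed_field f a \<mu> \<nu>\<bar> \<le> R * C" for \<mu> \<nu>
    using assms norm_relaxed_field[of a \<mu> \<nu>] C_pos R_nonneg
    by (intro order_trans[OF Cauchy_Schwarz_ineq2] mult_mono) auto
  then have "\<bar>(a - b) \<bullet> relaxed_field f a (react i b (snd (aim a b))) (snd (aim a b))\<bar> \<le> R * C" .
  then show ?thesis using h_pos h_le by (simp add: \<theta>_def abs_le_iff)
qed

lemma \<theta>_guide:
  assumes R: "norm (a - b) \<le> R" and \<Delta>: "\<bar>\<Delta> - h\<bar> \<le> h\<^sup>2"
  shows "2 * (\<Delta> * \<theta> i (a, b)) - 2 * h * ((a - b) \<bullet> guide_field i (a, b)) \<le> 2 * L * h * (norm (a - b))\<^sup>2 + 2 * (R * C + 2) * h\<^sup>2"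
proof -
  let ?\<nu> = "snd (aim a b)" and ?r = "react i b (snd (aim a b))"
  have "(\<Delta> - h) * \<theta> i (a, b) \<le> \<bar>\<Delta> - h\<bar> * \<bar>\<theta> i (a, b)\<bar>" by (metis abs_ge_self abs_mult)
  also have "\<dots> \<le> h\<^sup>2 * (R * C + 1)" using \<Delta> \<theta>_bound[OF R] by (intro mult_mono) auto
  finally have 1: "\<Delta> * \<theta> i (a, b) \<le> h * \<theta> i (a, b) + h\<^sup>2 * (R * C + 1)" by (simp add: algebra_simps)
  have "(a - b) \<bullet> (relaxed_field f a ?r ?\<nu> - relaxed_field f b ?r ?\<nu>) \<le> norm (a - b) * (L * norm (a - b))"
    using relaxed_field_lipschitz[of a ?r ?\<nu> b] by (intro order_trans[OF norm_cauchy_schwarz] mult_left_mono) auto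
  then have "\<theta> i (a, b) - (a - b) \<bullet> guide_field i (a, b) \<le> L * (norm (a - b))\<^sup>2 + h"
    by (simp add: \<theta>_def guide_field_def inner_diff_right power2_eq_square algebra_simps)
  then have "h * (\<theta> i (a, b) - (a - b) \<bullet> guide_field i (a, b)) \<le> h * (L * (norm (a - b))\<^sup>2 + h)"
    using h_pos by (intro mult_left_mono) auto
  then have "h * \<theta> i (a, b) - h * ((a - b) \<bullet> guide_field i (a, b)) \<le> L * h * (norm (a - b))\<^sup>2 + h\<^sup>2"
    by (simp add: algebra_simps power2_eq_square)
  with 1 show ?thesis by (simp add: algebra_simps)
qed

text \<open>
  Expand the square of the new distance; the cross term with the increments is kept, since it is
  controlled only in expectation.
\<close>
lemma gap_step:
  assumes cons: "consistent p q punish b z u v" and i: "i < m" and D: "\<not> undetected i v"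
  defines "ab \<equiv> state i z v" and "ab' \<equiv> state (Suc i) z v"
  shows "(norm (fst ab' - snd ab'))\<^sup>2 \<le> (norm (fst ab - snd ab))\<^sup>2
    + 2 * (\<Sum>l\<in>{grid i<..grid (Suc i)}. (fst ab - snd ab) \<bullet> stage_incr z v i l) - 2 * h * ((fst ab - snd ab) \<bullet> guide_field i ab) + K2 * h\<^sup>2"
proof -
  let ?\<xi> = "fst ab - snd ab" and ?F = "guide_field i ab" and ?I = "incr z u v i"
  let ?D = "?I - h *\<^sub>R ?F" and ?\<rho> = "fst ab' - (fst ab + ?I)"
  note sd = state_detected[OF cons i D, folded ab_def ab'_def]
  have b': "snd ab' = snd ab + h *\<^sub>R ?F" using sd(2) by (simp add: guide_field_def case_prod_unfold)
  have \<rho>: "norm ?\<rho> \<le> h\<^sup>2" by (rule sd(1))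
  have \<xi>: "norm ?\<xi> \<le> R" unfolding ab_def using gap_bounded[OF cons, of i] i by simp
  have I: "norm ?I \<le> 2 * C * h" by (rule norm_incr[OF cons i])
  have "norm (h *\<^sub>R ?F) \<le> h * C" using norm_relaxed_field h_pos by (simp add: guide_field_def case_prod_unfold mult_left_mono)
  then have nD: "norm ?D \<le> 3 * C * h" using I norm_triangle_ineq4[of ?I "h *\<^sub>R ?F"] by (simp add: algebra_simps)
  have "3 * C * h \<le> 3 * C" using C_pos h_le by simp
  then have N: "norm (?\<xi> + ?D) \<le> R + 3 * C" using nD \<xi> norm_triangle_ineq[of ?\<xi> ?D] by linarith
  have eq: "fst ab' - snd ab' = (?\<xi> + ?D) + ?\<rho>" unfolding b' by simp
  have "(norm (fst ab' - snd ab'))\<^sup>2 \<le> (norm (?\<xi> + ?D) + norm ?\<rho>)\<^sup>2"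
    unfolding eq by (intro power_mono norm_triangle_ineq) simp
  also have "\<dots> = (norm (?\<xi> + ?D))\<^sup>2 + 2 * (norm (?\<xi> + ?D) * norm ?\<rho>) + (norm ?\<rho>)\<^sup>2" by (simp add: power2_sum)
  also have "\<dots> \<le> (norm (?\<xi> + ?D))\<^sup>2 + 2 * ((R + 3 * C) * h\<^sup>2) + h\<^sup>2"
  proof -
    have "norm (?\<xi> + ?D) * norm ?\<rho> \<le> (R + 3 * C) * h\<^sup>2" using N \<rho> R_nonneg C_pos by (intro mult_mono) auto
    moreover have "(norm ?\<rho>)\<^sup>2 \<le> h\<^sup>2"
      using \<rho> h2_le by (intro power_mono order_trans[OF \<rho>]) auto
    ultimately show ?thesis by linarith
  qed
  also have "(norm (?\<xi> + ?D))\<^sup>2 = (norm ?\<xi>)\<^sup>2 + 2 * (?\<xi> \<bullet> ?D) + (norm ?D)\<^sup>2"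
    by (simp add: power2_norm_eq_inner inner_add_left inner_add_right inner_commute)
  also have "(norm ?D)\<^sup>2 \<le> (3 * C * h)\<^sup>2" using nD by (intro power_mono) auto
  also have "?\<xi> \<bullet> ?D = ?\<xi> \<bullet> ?I - h * (?\<xi> \<bullet> ?F)" by (simp add: inner_diff_right)
  also have "?\<xi> \<bullet> ?I = (\<Sum>l\<in>{grid i<..grid (Suc i)}. ?\<xi> \<bullet> stage_incr z v i l)"
    unfolding stage_incr_sum[OF cons i D, symmetric] by (rule inner_sum_right)
  finally show ?thesis by (simp add: K2_def algebra_simps power2_eq_square)
qed

context
  fixes b :: "nat \<Rightarrow> (2 \<times> nat \<Rightarrow> real) \<Rightarrow> (real \<Rightarrow> 'u) \<Rightarrow> real \<Rightarrow> 'v"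
  assumes b: "kernel q T \<pi> t k b"
begin

abbreviation "uu z \<equiv> fst (play p q punish b full z)"
abbreviation "vv z \<equiv> snd (play p q punish b full z)"
abbreviation "st i z \<equiv> state i z (vv z)"
abbreviation "gap i z \<equiv> fst (st i z) - snd (st i z)"

lemma cons: "z \<in> space law \<Longrightarrow> consistent p q punish b z (uu z) (vv z)"
  unfolding space_law by (rule play_consistent[OF compact_u compact_v kernel_punish b])

lemma integral_affine:
  fixes F :: "(2 \<times> nat \<Rightarrow> real) \<Rightarrow> real" and e :: real
  assumes "integrable law F"
  shows "(\<integral>z. c * F z + e \<partial>law) = c * (\<integral>z. F z \<partial>law) + e"
proof -
  interpret Pr: prob_space law by (rule prob_space_law)
  have "(\<integral>z. c * F z + e \<partial>law) = (\<integral>z. c * F z \<partial>law) + (\<integral>z. e \<partial>law)"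
    by (intro Bochner_Integration.integral_add integrable_mult_right assms Pr.integrable_const)
  then show ?thesis by (simp only: integral_mult_right_zero lebesgue_integral_const Pr.prob_space scaleR_one)
qed

lemma vv_controls: "z \<in> space law \<Longrightarrow> vv z \<in> controls t T"
  unfolding space_law by (rule play_controls(2)[OF compact_u compact_v kernel_punish b order_refl])

lemma measurable_vv: "(\<lambda>z. (z, vv z)) \<in> measurable law (PiM signals (\<lambda>_. borel) \<Otimes>\<^sub>M control_algebra t T)"
  unfolding measurable_cong_sets[OF sets_law refl]
  by (intro measurable_Pair measurable_ident measurable_into_control_algebra[OF compact_v measurable_play(2)[OF compact_u compact_v kernel_punish b order_refl]])
    (simp add: measurable_ident_sets)

lemma discretely_measurable_st: "i \<le> m \<Longrightarrow> discretely_measurable law (st i)"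
proof -
  assume i: "i \<le> m"
  have "{p} \<times> {k..<grid i} \<subseteq> signals" using grid(3)[OF i] by auto
  from discretely_measurable_comp[OF measurable_vv discretely_measurable_state[OF i this]]
  show ?thesis by simp
qed

lemma measurable_st: "i \<le> m \<Longrightarrow> (\<lambda>z. \<phi> (st i z) :: real) \<in> borel_measurable law"
  by (rule discretely_measurable_compose[OF discretely_measurable_st, of i "\<lambda>c _. \<phi> c"]) auto

lemma measurable_detected:
  assumes "i \<le> m"
  shows "{z \<in> space law. undetected i (vv z)} \<in> sets law"
  using measurable_sets[OF measurable_compose[OF measurable_vv measurable_snd] measurable_undetected[OF assms]]
  by (rule back_subst[of "\<lambda>A. A \<in> sets law"]) (use vv_controls in \<open>auto simp: space_control_algebra\<close>)

lemma measurable_stage_incr: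
  assumes i: "i < m" and l: "l \<in> {grid i<..grid (Suc i)}"
  shows "(\<lambda>z. gap i z \<bullet> stage_incr z (vv z) i l) \<in> borel_measurable law"
proof -
  have c: "(p, l - 1) \<in> signals" using stage_interval(1)[OF i l] k by auto
  define F where "F ab z = (fst ab - snd ab) \<bullet> (LINT r:{\<pi> ! (l - 1)..\<pi> ! l}|lebesgue. f (fst ab) (draw (fst (aim (fst ab) (snd ab))) (z (p, l - 1))) (vv z r))"
    for ab z
  have "F ab \<in> borel_measurable law" for ab
    unfolding F_def
    using measurable_compose[OF measurable_vv measurable_stage_integral[OF i l c, of "fst ab" "fst (aim (fst ab) (snd ab))"]]
    by (intro borel_measurable_inner borel_measurable_const) simp
  from discretely_measurable_compose[OF discretely_measurable_st this, of i]
  have "(\<lambda>z. F (st i z) z) \<in> borel_measurable law" using i by simp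
  then show ?thesis
    by (rule measurable_cong[THEN iffD1, rotated]) (simp add: F_def stage_incr_def[OF cons])
qed

lemma stage_length: "i < m \<Longrightarrow> l \<in> {grid i<..grid (Suc i)} \<Longrightarrow> 0 \<le> \<pi> ! l - \<pi> ! (l - 1) \<and> \<pi> ! l - \<pi> ! (l - 1) \<le> T - t"
  using stage_interval[of i l] \<pi>_le_T[of l] by auto

lemma gap_le: "z \<in> space law \<Longrightarrow> i \<le> m \<Longrightarrow> norm (gap i z) \<le> R"
  using gap_bounded[OF cons] by simp

lemma abs_gap_stage_incr_le:
  assumes z: "z \<in> space law" and i: "i < m" and l: "l \<in> {grid i<..grid (Suc i)}"
  shows "\<bar>gap i z \<bullet> stage_incr z (vv z) i l\<bar> \<le> R * ((T - t) * C)"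
proof (rule order_trans[OF Cauchy_Schwarz_ineq2 mult_mono])
  have "norm (stage_incr z (vv z) i l) \<le> (\<pi> ! l - \<pi> ! (l - 1)) * C"
    unfolding stage_incr_def[OF cons[OF z]] by (rule norm_set_integral_le[OF stage_interval(5)[OF i l]]) (rule bounded)
  then show "norm (stage_incr z (vv z) i l) \<le> (T - t) * C"
    using stage_length[OF i l] C_pos by (auto intro: order_trans mult_right_mono)
qed (use gap_le[OF z, of i] i R_nonneg in auto)

lemma abs_stage_\<theta>_le:
  assumes z: "z \<in> space law" and i: "i < m" and l: "l \<in> {grid i<..grid (Suc i)}"
  shows "\<bar>(\<pi> ! l - \<pi> ! (l - 1)) * \<theta> i (st i z)\<bar> \<le> (T - t) * (R * C + 1)"
proof -
  have "\<bar>\<theta> i (st i z)\<bar> \<le> R * C + 1" using \<theta>_bound[of "fst (st i z)" "snd (st i z)" i] gap_le[OF z, of i] i by simp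
  then show ?thesis unfolding abs_mult using stage_length[OF i l] by (intro mult_mono) auto
qed

text \<open>
  Given all signals but \<open>(p, l - 1)\<close>, the state and the opponent's control up to the
  end of the \<open>l\<close>-th interval are fixed, and the action of player \<open>p\<close> on
  this interval is distributed according to the first component of \<open>aim\<close>. This is
  where private randomization replaces the Isaacs condition.
\<close>
lemma independent_stage:
  assumes i: "i < m" and l: "l \<in> {grid i<..grid (Suc i)}"
  shows "(\<integral>z. (if undetected i (vv z) then 0 else gap i z \<bullet> stage_incr z (vv z) i l) \<partial>law)
    \<le> (\<integral>z. (if undetected i (vv z) then 0 else (\<pi> ! l - \<pi> ! (l - 1)) * \<theta> i (st i z)) \<partial>law)"
proof -
  note si = stage_interval[OF i l]
  have im: "i \<le> m" using i by simp
  define c where "c = (p, l - 1)"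
  have c: "c \<in> signals" using si(1) k by (auto simp: c_def)
  show ?thesis
  proof (rule coordinate_integral_le[where c = c and K = "(T - t) * (R * C + 1)"])
    show "c \<in> signals" by (rule c)
    show "(\<lambda>z. if undetected i (vv z) then 0 else gap i z \<bullet> stage_incr z (vv z) i l) \<in> borel_measurable law"
      by (rule measurable_If[OF _ measurable_stage_incr[OF i l] measurable_detected[OF im]]) simp
    show "(\<lambda>z. if undetected i (vv z) then 0 else (\<pi> ! l - \<pi> ! (l - 1)) * \<theta> i (st i z)) \<in> borel_measurable law"
      by (rule measurable_If[OF borel_measurable_const measurable_st[OF im, of "\<lambda>ab. (\<pi> ! l - \<pi> ! (l - 1)) * \<theta> i ab"] measurable_detected[OF im]])
    have K0: "0 \<le> (T - t) * (R * C + 1)" using t_less_T R_nonneg C_pos by simp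
    fix z assume z: "z \<in> space law"
    have "R * ((T - t) * C) \<le> (T - t) * (R * C + 1)" using t_less_T by (simp add: algebra_simps)
    then show "\<bar>if undetected i (vv z) then 0 else gap i z \<bullet> stage_incr z (vv z) i l\<bar> \<le> (T - t) * (R * C + 1)"
      using abs_gap_stage_incr_le[OF z i l] K0 by simp
    show "\<bar>if undetected i (vv z) then 0 else (\<pi> ! l - \<pi> ! (l - 1)) * \<theta> i (st i z)\<bar> \<le> (T - t) * (R * C + 1)"
      using abs_stage_\<theta>_le[OF z i l] K0 by simp
    let ?z = "\<lambda>r. z(c := r)"
    have upd: "?z r \<in> space law" for r by (rule law_update[OF z c])
    \<comment> \<open>The opponent has no access to the signal c before the end of the l-th interval.\<close>
    have veq: "vv (?z r) s = vv z s" if "t \<le> s" "s < \<pi> ! l" for r s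
    proof (rule play_snd_cong[OF si(1) _ that])
      fix j assume "j \<in> info q k l"
      then have "j \<noteq> c" using pq si(2) k by (auto simp: info_def c_def)
      then show "?z r j = z j" by simp
    qed
    have AE: "AE s in lebesgue_on {c'..d'}. vv (?z r) s = vv z s" if "t \<le> c'" "d' \<le> \<pi> ! l" for r c' d'
      by (rule AE_lebesgue_on_Ico) (use veq that in auto)
    have grid_le: "\<pi> ! grid i \<le> \<pi> ! l" using l grid_step(2)[OF i] si(1) by (intro \<pi>_mono) auto
    have und: "undetected i (vv (?z r)) \<longleftrightarrow> undetected i (vv z)" for r
      by (rule undetected_cong[OF im vv_controls[OF upd] vv_controls[OF z] AE]) (use grid_le in auto)
    have st: "st i (?z r) = st i z" for r
      by (rule state_cong[OF im vv_controls[OF upd] vv_controls[OF z] AE]) (use grid_le l in \<open>auto simp: c_def\<close>)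
    show "(\<integral>r. (if undetected i (vv (?z r)) then 0 else gap i (?z r) \<bullet> stage_incr (?z r) (vv (?z r)) i l) \<partial>uniform01)
      \<le> (if undetected i (vv z) then 0 else (\<pi> ! l - \<pi> ! (l - 1)) * \<theta> i (st i z))"
    proof (cases "undetected i (vv z)")
      case False
      obtain a b' where ab: "st i z = (a, b')" by (cases "st i z")
      let ?\<mu> = "fst (aim a b')" and ?\<xi> = "a - b'"
      have int: "set_integrable lebesgue {\<pi> ! (l - 1)..\<pi> ! l} (\<lambda>s. f a u (w s))" if "w \<in> controls t T" for u w
        by (rule set_integrable_f[OF _ _ that si(4)]) (simp_all add: controls_def)
      have inner: "?\<xi> \<bullet> (LINT s:{\<pi> ! (l - 1)..\<pi> ! l}|lebesgue. f a u (vv z s)) = (LINT s:{\<pi> ! (l - 1)..\<pi> ! l}|lebesgue. ?\<xi> \<bullet> f a u (vv z s))"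
        "set_integrable lebesgue {\<pi> ! (l - 1)..\<pi> ! l} (\<lambda>s. ?\<xi> \<bullet> f a u (vv z s))" for u
        using int[OF vv_controls[OF z], of u] by (simp_all add: set_lebesgue_integral_def set_integrable_def inner_scaleR_right[symmetric] del: inner_scaleR_right)
      have "gap i (?z r) \<bullet> stage_incr (?z r) (vv (?z r)) i l = (\<lambda>u. LINT s:{\<pi> ! (l - 1)..\<pi> ! l}|lebesgue. ?\<xi> \<bullet> f a u (vv z s)) (draw ?\<mu> r)" for r
      proof -
        have "AE s in lebesgue_on {\<pi> ! (l - 1)..\<pi> ! l}. f a (draw ?\<mu> r) (vv (?z r) s) = f a (draw ?\<mu> r) (vv z s)"
          using AE[of "\<pi> ! (l - 1)" "\<pi> ! l" r] si(3) by (auto elim: eventually_mono)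
        from set_integral_cong_AE_on[OF this int[OF vv_controls[OF upd]] int[OF vv_controls[OF z]]]
        moreover have "?z r (p, l - 1) = r" by (simp add: c_def)
        ultimately show ?thesis unfolding stage_incr_def[OF cons[OF upd]] st ab inner(1)[symmetric] by simp
      qed
      then have "(\<integral>r. (if undetected i (vv (?z r)) then 0 else gap i (?z r) \<bullet> stage_incr (?z r) (vv (?z r)) i l) \<partial>uniform01)
          = avg ?\<mu> (\<lambda>u. LINT s:{\<pi> ! (l - 1)..\<pi> ! l}|lebesgue. ?\<xi> \<bullet> f a u (vv z s))"
        using False integral_draw[of "\<lambda>u. LINT s:{\<pi> ! (l - 1)..\<pi> ! l}|lebesgue. ?\<xi> \<bullet> f a u (vv z s)" ?\<mu>] by (simp add: und)
      also have "\<dots> = (LINT s:{\<pi> ! (l - 1)..\<pi> ! l}|lebesgue. avg ?\<mu> (\<lambda>u. ?\<xi> \<bullet> f a u (vv z s)))"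
        by (rule avg_set_integral(1)[OF inner(2)])
      also have "\<dots> \<le> (LINT s:{\<pi> ! (l - 1)..\<pi> ! l}|lebesgue. \<theta> i (a, b'))"
        by (rule set_integral_mono[OF avg_set_integral(2)[OF inner(2)]])
          (auto intro: aim_\<theta> set_integrable_bounded[of _ "\<pi> ! (l - 1)" "\<pi> ! l"])
      also have "\<dots> = (\<pi> ! l - \<pi> ! (l - 1)) * \<theta> i (st i z)"
        using set_integral_const[OF si(5), of "\<theta> i (a, b')"] ab by simp
      finally show ?thesis using False by simp
    qed (simp add: und)
  qed
qed

text \<open>
  Squared distances are used because the cross term is linear in the increments, so that stagewise
  expectations suffice, although the increments themselves do not have small expectation.
\<close>
lemma expected_gap_step:
  assumes i: "i < m"
  shows "(\<integral>z. (norm (gap (Suc i) z))\<^sup>2 \<partial>law) \<le> (1 + 2 * L * h) * (\<integral>z. (norm (gap i z))\<^sup>2 \<partial>law) + K3 * h\<^sup>2"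
proof -
  interpret Pr: prob_space law by (rule prob_space_law)
  have im: "i \<le> m" "Suc i \<le> m" using i by auto
  let ?und = "\<lambda>z. undetected i (vv z)" and ?ls = "{grid i<..grid (Suc i)}"
  let ?\<Delta> = "\<pi> ! grid (Suc i) - \<pi> ! grid i"
  define \<phi> where "\<phi> ab = (norm (fst ab - snd ab))\<^sup>2 - 2 * h * ((fst ab - snd ab) \<bullet> guide_field i ab) + K2 * h\<^sup>2" for ab :: "(real^'n) \<times> (real^'n)"
  let ?\<Psi> = "\<lambda>l z. if ?und z then 0 else gap i z \<bullet> stage_incr z (vv z) i l"
  let ?\<Theta> = "\<lambda>l z. if ?und z then 0 else (\<pi> ! l - \<pi> ! (l - 1)) * \<theta> i (st i z)"
  let ?\<phi> = "\<lambda>z. if ?und z then 0 else \<phi> (st i z)"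
  have C0: "0 \<le> C" "0 \<le> L" "0 \<le> h" using C_pos L_pos h_pos by auto
  have gap2: "(norm (gap j z))\<^sup>2 \<le> R\<^sup>2" if "z \<in> space law" "j \<le> m" for j z
    using gap_le[OF that] by (intro power_mono) auto
  have intZ: "integrable law (\<lambda>z. (norm (gap j z))\<^sup>2)" if "j \<le> m" for j
    using measurable_st[OF that, of "\<lambda>ab. (norm (fst ab - snd ab))\<^sup>2"] gap2[OF _ that]
    by (intro Pr.integrable_const_bound[of _ "R\<^sup>2"] AE_I2) auto
  have int\<Psi>: "integrable law (?\<Psi> l)" if l: "l \<in> ?ls" for l
  proof (intro Pr.integrable_const_bound[of _ "R * ((T - t) * C)"] AE_I2)
    show "?\<Psi> l \<in> borel_measurable law"
      by (rule measurable_If[OF _ measurable_stage_incr[OF i l] measurable_detected[OF im(1)]]) simp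
    fix z assume z: "z \<in> space law"
    have "\<bar>gap i z \<bullet> stage_incr z (vv z) i l\<bar> \<le> R * ((T - t) * C)" by (rule abs_gap_stage_incr_le[OF z i l])
    then show "norm (?\<Psi> l z) \<le> R * ((T - t) * C)" using R_nonneg t_less_T C0 by simp
  qed
  have int\<Theta>: "integrable law (?\<Theta> l)" if l: "l \<in> ?ls" for l
  proof (intro Pr.integrable_const_bound[of _ "(T - t) * (R * C + 1)"] AE_I2)
    show "?\<Theta> l \<in> borel_measurable law"
      by (rule measurable_If[OF borel_measurable_const measurable_st[OF im(1), of "\<lambda>ab. (\<pi> ! l - \<pi> ! (l - 1)) * \<theta> i ab"] measurable_detected[OF im(1)]])
    fix z assume z: "z \<in> space law"
    have "\<bar>(\<pi> ! l - \<pi> ! (l - 1)) * \<theta> i (st i z)\<bar> \<le> (T - t) * (R * C + 1)" by (rule abs_stage_\<theta>_le[OF z i l])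
    then show "norm (?\<Theta> l z) \<le> (T - t) * (R * C + 1)" using R_nonneg t_less_T C0 by simp
  qed
  have int\<phi>: "integrable law ?\<phi>"
  proof (intro Pr.integrable_const_bound[of _ "R\<^sup>2 + 2 * h * (R * C) + \<bar>K2 * h\<^sup>2\<bar>"] AE_I2)
    show "?\<phi> \<in> borel_measurable law"
      by (rule measurable_If[OF borel_measurable_const measurable_st[OF im(1), of \<phi>] measurable_detected[OF im(1)]])
    fix z assume z: "z \<in> space law"
    have "\<bar>gap i z \<bullet> guide_field i (st i z)\<bar> \<le> R * C"
      using gap_le[OF z im(1)] norm_relaxed_field C0 R_nonneg
      by (intro order_trans[OF Cauchy_Schwarz_ineq2] mult_mono) (auto simp: guide_field_def case_prod_unfold)
    then have "\<bar>2 * h * (gap i z \<bullet> guide_field i (st i z))\<bar> \<le> 2 * h * (R * C)"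
      using C0 by (simp add: abs_mult mult_left_mono)
    then have "\<bar>\<phi> (st i z)\<bar> \<le> R\<^sup>2 + 2 * h * (R * C) + \<bar>K2 * h\<^sup>2\<bar>"
      using gap2[OF z im(1)] zero_le_power2[of "norm (gap i z)"] unfolding \<phi>_def by linarith
    then show "norm (?\<phi> z) \<le> R\<^sup>2 + 2 * h * (R * C) + \<bar>K2 * h\<^sup>2\<bar>" using C0 R_nonneg by simp
  qed
  have "(\<integral>z. (norm (gap (Suc i) z))\<^sup>2 \<partial>law) \<le> (\<integral>z. ?\<phi> z + 2 * (\<Sum>l\<in>?ls. ?\<Psi> l z) \<partial>law)"
  proof (rule integral_mono[OF intZ[OF im(2)]])
    show "integrable law (\<lambda>z. ?\<phi> z + 2 * (\<Sum>l\<in>?ls. ?\<Psi> l z))"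
      by (intro Bochner_Integration.integrable_add integrable_mult_right Bochner_Integration.integrable_sum int\<phi> int\<Psi>)
    fix z assume z: "z \<in> space law"
    show "(norm (gap (Suc i) z))\<^sup>2 \<le> ?\<phi> z + 2 * (\<Sum>l\<in>?ls. ?\<Psi> l z)"
    proof (cases "?und z")
      case False
      then show ?thesis using gap_step[OF cons[OF z] i False] by (simp only: \<phi>_def if_False)
    qed simp
  qed
  also have "\<dots> = (\<integral>z. ?\<phi> z \<partial>law) + 2 * (\<Sum>l\<in>?ls. \<integral>z. ?\<Psi> l z \<partial>law)"
    using int\<phi> int\<Psi> by (subst Bochner_Integration.integral_add)
      (auto intro!: integrable_mult_right Bochner_Integration.integrable_sum simp only: integral_mult_right_zero Bochner_Integration.integral_sum)
  also have "\<dots> \<le> (\<integral>z. ?\<phi> z \<partial>law) + 2 * (\<Sum>l\<in>?ls. \<integral>z. ?\<Theta> l z \<partial>law)"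
    by (intro add_left_mono mult_left_mono sum_mono independent_stage[OF i]) auto
  also have "\<dots> = (\<integral>z. ?\<phi> z + 2 * (\<Sum>l\<in>?ls. ?\<Theta> l z) \<partial>law)"
    using int\<phi> int\<Theta> by (subst Bochner_Integration.integral_add)
      (auto intro!: integrable_mult_right Bochner_Integration.integrable_sum simp only: integral_mult_right_zero Bochner_Integration.integral_sum)
  also have "\<dots> \<le> (\<integral>z. (1 + 2 * L * h) * (norm (gap i z))\<^sup>2 + K3 * h\<^sup>2 \<partial>law)"
  proof (rule integral_mono)
    show "integrable law (\<lambda>z. ?\<phi> z + 2 * (\<Sum>l\<in>?ls. ?\<Theta> l z))"
      by (intro Bochner_Integration.integrable_add integrable_mult_right Bochner_Integration.integrable_sum int\<phi> int\<Theta>)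
    show "integrable law (\<lambda>z. (1 + 2 * L * h) * (norm (gap i z))\<^sup>2 + K3 * h\<^sup>2)"
      by (intro Bochner_Integration.integrable_add integrable_mult_right intZ im Pr.integrable_const)
    fix z assume z: "z \<in> space law"
    have K: "0 \<le> K3" using R_nonneg C0 by (simp add: K3_def K2_def)
    show "?\<phi> z + 2 * (\<Sum>l\<in>?ls. ?\<Theta> l z) \<le> (1 + 2 * L * h) * (norm (gap i z))\<^sup>2 + K3 * h\<^sup>2"
    proof (cases "?und z")
      case True
      then show ?thesis using K C0 by simp
    next
      case False
      have tel: "(\<Sum>l\<in>{n<..n'}. \<pi> ! l - \<pi> ! (l - 1)) = \<pi> ! n' - \<pi> ! n" if "n \<le> n'" for n n'
        using that
      proof (induction n' rule: dec_induct)
        case (step n')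
        have "{n<..Suc n'} = insert (Suc n') {n<..n'}" using step by auto
        then show ?case using step by simp
      qed simp
      have "(\<Sum>l\<in>?ls. ?\<Theta> l z) = ?\<Delta> * \<theta> i (st i z)"
        using False tel[OF grid_mono[of i "Suc i"]] im by (simp add: sum_distrib_right[symmetric])
      then have "?\<phi> z + 2 * (\<Sum>l\<in>?ls. ?\<Theta> l z) = \<phi> (st i z) + 2 * (?\<Delta> * \<theta> i (st i z))" using False by simp
      also have "\<dots> \<le> (norm (gap i z))\<^sup>2 + K2 * h\<^sup>2 + (2 * L * h * (norm (gap i z))\<^sup>2 + 2 * (R * C + 2) * h\<^sup>2)"
        using \<theta>_guide[OF gap_le[OF z im(1)] grid_step(1)[OF i], of i] by (simp add: \<phi>_def)
      also have "\<dots> = (1 + 2 * L * h) * (norm (gap i z))\<^sup>2 + K3 * h\<^sup>2" by (simp add: K3_def algebra_simps)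
      finally show ?thesis .
    qed
  qed
  also have "\<dots> = (1 + 2 * L * h) * (\<integral>z. (norm (gap i z))\<^sup>2 \<partial>law) + K3 * h\<^sup>2"
    by (rule integral_affine[OF intZ[OF im(1)]])
  finally show ?thesis .
qed

definition "K4 = exp (2 * L * (T - t)) * ((T - t) * K3)"

lemma expected_gap: "(\<integral>z. (norm (gap m z))\<^sup>2 \<partial>law) \<le> K4 * h"
proof -
  have K: "0 \<le> K3" using R_nonneg C_pos by (simp add: K3_def K2_def)
  have "(\<integral>z. (norm (gap m z))\<^sup>2 \<partial>law) \<le> exp (2 * L * h * real m) * (0 + real m * (K3 * h\<^sup>2))"
    using expected_gap_step L_pos h_pos K by (intro discrete_gronwall[of "2 * L * h" "K3 * h\<^sup>2" 0 _ m m]) auto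
  also have "\<dots> = exp (2 * L * (real m * h)) * ((real m * h) * K3) * h" by (simp add: power2_eq_square mult_ac)
  also have "real m * h = T - t" using h_T by simp
  finally show ?thesis by (simp add: K4_def)
qed

text \<open>
  At the terminal time the value of the guide is the payoff at the guide. The expected distance
  from the guide, of order \<open>sqrt h\<close>, is obtained from the second moment by the
  inequality of arithmetic and geometric means.
\<close>
lemma punishment_payoff:
  assumes g: "\<And>x y. \<bar>g x - g y\<bar> \<le> Lg * norm (x - y)" "\<And>x. \<bar>g x\<bar> \<le> Kg" and Lg: "0 \<le> Lg" and w: "w m = g"
  shows "(\<integral>z. g (trajectory f T t (X 0) (uu z) (vv z) T) \<partial>law)
    \<le> G + ((T - t) + Lg * K1) * h + Lg * (1 + K4) / 2 * sqrt h"
proof -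
  interpret Pr: prob_space law by (rule prob_space_law)
  let ?x = "\<lambda>z. trajectory f T t (X 0) (uu z) (vv z) T"
  have T: "\<pi> ! grid m = T" using grid_m \<pi>_last by simp
  have g_cont: "g \<in> borel_measurable borel"
    using g(1) Lg by (intro borel_measurable_continuous_onI lipschitz_on_continuous_on[of Lg] lipschitz_onI)
      (auto simp: dist_norm)
  have "T \<in> {t..T}" using t_less_T by simp
  note mt = measurable_trajectory[OF measurable_play[OF compact_u compact_v kernel_punish b order_refl] this, of "X 0"]
  have m1: "(\<lambda>z. g (?x z)) \<in> borel_measurable law"
    unfolding measurable_cong_sets[OF sets_law refl] by (rule measurable_compose[OF mt g_cont])
  have sh: "sqrt h > 0" "sqrt h * sqrt h = h" using h_pos by auto
  have le: "g (?x z) \<le> (G + (T - t) * h) + Lg * (K1 * h + (sqrt h + (norm (gap m z))\<^sup>2 / sqrt h) / 2)" if z: "z \<in> space law" for z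
  proof -
    have "g (snd (st m z)) \<le> G + real m * h\<^sup>2" using guide_value_decreases[OF cons[OF z], of m] w by simp
    also have "real m * h\<^sup>2 = (real m * h) * h" by (simp add: power2_eq_square)
    also have "real m * h = T - t" using h_T by simp
    finally have 1: "g (snd (st m z)) \<le> G + (T - t) * h" .
    have 2: "norm (?x z - fst (st m z)) \<le> K1 * h" using tracking[OF cons[OF z], of m] by (simp add: T norm_minus_commute)
    have "0 \<le> (norm (gap m z) - sqrt h)\<^sup>2" by simp
    then have "2 * norm (gap m z) * sqrt h \<le> h + (norm (gap m z))\<^sup>2" using h_pos by (simp add: power2_diff)
    then have 3: "norm (gap m z) \<le> (sqrt h + (norm (gap m z))\<^sup>2 / sqrt h) / 2"
      using sh by (simp add: field_simps)
    have "norm (?x z - snd (st m z)) \<le> norm (?x z - fst (st m z)) + norm (gap m z)"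
      using norm_triangle_ineq[of "?x z - fst (st m z)" "gap m z"] by simp
    then have "norm (?x z - snd (st m z)) \<le> K1 * h + (sqrt h + (norm (gap m z))\<^sup>2 / sqrt h) / 2" using 2 3 by linarith
    then have "Lg * norm (?x z - snd (st m z)) \<le> Lg * (K1 * h + (sqrt h + (norm (gap m z))\<^sup>2 / sqrt h) / 2)"
      using Lg by (rule mult_left_mono)
    then show ?thesis using g(1)[of "?x z" "snd (st m z)"] 1 by linarith
  qed
  have gap2: "(norm (gap m z))\<^sup>2 \<le> R\<^sup>2" if "z \<in> space law" for z
    using gap_le[OF that] by (intro power_mono) auto
  have intZ: "integrable law (\<lambda>z. (norm (gap m z))\<^sup>2)"
    using measurable_st[OF order_refl, of "\<lambda>ab. (norm (fst ab - snd ab))\<^sup>2"] gap2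
    by (intro Pr.integrable_const_bound[of _ "R\<^sup>2"] AE_I2) auto
  let ?c = "G + (T - t) * h + Lg * (K1 * h + sqrt h / 2)"
  have "(\<integral>z. g (?x z) \<partial>law) \<le> (\<integral>z. ?c + (Lg / (2 * sqrt h)) * (norm (gap m z))\<^sup>2 \<partial>law)"
  proof (rule integral_mono)
    show "integrable law (\<lambda>z. g (?x z))"
      using m1 g(2) by (intro Pr.integrable_const_bound[of _ Kg] AE_I2) auto
    show "integrable law (\<lambda>z. ?c + (Lg / (2 * sqrt h)) * (norm (gap m z))\<^sup>2)"
      by (intro Bochner_Integration.integrable_add integrable_mult_right intZ Pr.integrable_const)
    show "g (?x z) \<le> ?c + (Lg / (2 * sqrt h)) * (norm (gap m z))\<^sup>2" if "z \<in> space law" for z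
      using le[OF that] by (simp add: algebra_simps add_divide_distrib)
  qed
  also have "\<dots> = ?c + (Lg / (2 * sqrt h)) * (\<integral>z. (norm (gap m z))\<^sup>2 \<partial>law)"
    using integral_affine[OF intZ, of "Lg / (2 * sqrt h)" ?c] by (simp only: add.commute)
  also have "\<dots> \<le> ?c + (Lg / (2 * sqrt h)) * (K4 * h)"
    using expected_gap Lg sh by (intro add_left_mono mult_left_mono) auto
  also have "(Lg / (2 * sqrt h)) * (K4 * h) = Lg * K4 / 2 * sqrt h"
    using sh by (simp add: field_simps)
  finally show ?thesis by (simp add: algebra_simps add_divide_distrib)
qed

end

end

section \<open>Nash equilibrium payoffs\<close>

context dynamics
begin

text \<open>
  Uniform continuity and compactness of the second action space supply the finite net from which
  \<open>approximate_saddle\<close> works, with accuracy \<open>h / 5\<close>.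
\<close>
lemma aim_exists:
  assumes "h > 0"
  shows "\<exists>\<mu> \<nu>. \<forall>u v. avg \<mu> (\<lambda>u. (a - b) \<bullet> f a u v) \<le> avg \<nu> (\<lambda>v. (a - b) \<bullet> f a u v) + h"
proof -
  define A where "A u v = (a - b) \<bullet> f a u v" for u v
  have "continuous_on UNIV (\<lambda>(u, v). A u v)"
    using cont[of a] unfolding A_def case_prod_unfold by (intro continuous_on_inner continuous_on_const)
  moreover have "compact (UNIV :: ('u \<times> 'v) set)"
    using compact_Times[OF compact_u compact_v] by simp
  ultimately have "uniformly_continuous_on UNIV (\<lambda>(u, v). A u v)" by (rule compact_uniformly_continuous)
  then have "\<exists>\<delta>>0. \<forall>z\<in>UNIV. \<forall>z'\<in>UNIV. dist z' z < \<delta> \<longrightarrow> dist ((\<lambda>(u, v). A u v) z') ((\<lambda>(u, v). A u v) z) < h / 5"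
    using assms unfolding uniformly_continuous_on_def by (elim allE[of _ "h / 5"]) simp
  then obtain \<delta> where \<delta>: "\<delta> > 0" "\<forall>z\<in>UNIV. \<forall>z'\<in>UNIV. dist z' z < \<delta> \<longrightarrow> dist ((\<lambda>(u, v). A u v) z') ((\<lambda>(u, v). A u v) z) < h / 5"
    by (elim exE conjE)
  obtain V where V: "finite V" "(UNIV :: 'v set) \<subseteq> (\<Union>v\<in>V. ball v \<delta>)"
    using seq_compact_imp_totally_bounded[of "UNIV :: 'v set"] compact_v \<delta>(1) compact_imp_seq_compact by blast
  have "\<exists>v'\<in>V. \<forall>u. \<bar>A u v - A u v'\<bar> \<le> h / 5" for v
  proof -
    obtain v' where v': "v' \<in> V" "v \<in> ball v' \<delta>" using V(2) by blast
    have "\<bar>A u v - A u v'\<bar> \<le> h / 5" for u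
      using \<delta>(2)[rule_format, of "(u, v')" "(u, v)"] v'(2) by (simp add: dist_Pair_Pair dist_real_def dist_commute)
    then show ?thesis using v'(1) by blast
  qed
  moreover have "\<bar>A u v\<bar> \<le> norm (a - b) * C" for u v
    unfolding A_def by (intro order_trans[OF Cauchy_Schwarz_ineq2] mult_left_mono bounded) simp
  ultimately have "\<exists>\<mu> \<nu>. \<forall>u v. avg \<mu> (\<lambda>u. A u v) \<le> avg \<nu> (A u) + 5 * (h / 5)"
    using V(1) assms by (intro approximate_saddle[where V = V]) auto
  then show ?thesis by (simp add: A_def[abs_def])
qed

end

context game
begin

text \<open>
  The threat, with the two features that an equilibrium needs: it does not disturb the plan as
  long as the opponent complies, and it makes deviations unprofitable. The selections
  \<open>aim\<close> and \<open>react\<close> of the punishing strategy are supplied by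
  \<open>aim_exists\<close> and \<open>guide_value_stable\<close>.
\<close>
lemma security:
  fixes X :: "nat \<Rightarrow> real^'n"
  assumes pq: "p \<noteq> q" and m: "m > 0" and h: "h > 0" "h \<le> 1" "t + real m * h = T"
    and fine: "\<And>j. Suc j < length \<pi> \<Longrightarrow> \<pi> ! Suc j - \<pi> ! j \<le> h\<^sup>2"
    and us: "us \<in> borel_measurable borel" and vs: "vs \<in> borel_measurable borel"
    and X: "\<And>i. i < m \<Longrightarrow> norm (X (Suc i) - X i) \<le> C * h"
    and plan: "\<And>i. i \<le> m \<Longrightarrow> norm (trajectory f T t (X 0) us vs (t + real i * h) - X i) \<le> c0 * h" and c0: "c0 \<ge> 0"
    and val: "\<And>i. i \<le> m \<Longrightarrow> guide_value f h g (m - i) (X i) \<le> g (X m) + (T - t) * h"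
    and g: "\<And>x y. \<bar>g x - g y\<bar> \<le> Lg * norm (x - y)" "\<And>x. \<bar>g x\<bar> \<le> Kg" "0 \<le> Lg"
  shows "\<exists>a. kernel p T \<pi> t k a \<and> (\<forall>l y s. a l y vs s = us s) \<and>
    (\<forall>b. kernel q T \<pi> t k b \<longrightarrow>
      (\<integral>z. g (trajectory f T t (X 0) (fst (play p q a b full z)) (snd (play p q a b full z)) T) \<partial>law)
        \<le> g (X m) + (2 * (T - t) + Lg * punishment_estimate.K1 C L T t c0) * h
          + Lg * (1 + punishment_estimate.K4 C L T t) / 2 * sqrt h)"
proof -
  obtain d :: "nat \<Rightarrow> real^'n" where d: "dense_seq d" using second_countable_dense_seq by blast
  have "\<forall>ab. \<exists>\<mu>\<nu>. \<forall>u v. avg (fst \<mu>\<nu>) (\<lambda>u. (fst ab - snd ab) \<bullet> f (fst ab) u v)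
      \<le> avg (snd \<mu>\<nu>) (\<lambda>v. (fst ab - snd ab) \<bullet> f (fst ab) u v) + h"
  proof
    fix ab :: "(real^'n) \<times> (real^'n)"
    obtain \<mu> \<nu> where "\<forall>u v. avg \<mu> (\<lambda>u. (fst ab - snd ab) \<bullet> f (fst ab) u v) \<le> avg \<nu> (\<lambda>v. (fst ab - snd ab) \<bullet> f (fst ab) u v) + h"
      using aim_exists[OF h(1), of "fst ab" "snd ab"] by blast
    then show "\<exists>\<mu>\<nu>. \<forall>u v. avg (fst \<mu>\<nu>) (\<lambda>u. (fst ab - snd ab) \<bullet> f (fst ab) u v)
        \<le> avg (snd \<mu>\<nu>) (\<lambda>v. (fst ab - snd ab) \<bullet> f (fst ab) u v) + h"
      by (intro exI[of _ "(\<mu>, \<nu>)"]) simp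
  qed
  from choice[OF this] obtain aim' where aim': "\<forall>ab. \<forall>u v. avg (fst (aim' ab)) (\<lambda>u. (fst ab - snd ab) \<bullet> f (fst ab) u v)
      \<le> avg (snd (aim' ab)) (\<lambda>v. (fst ab - snd ab) \<bullet> f (fst ab) u v) + h" by (elim exE)
  define w where "w i = guide_value f h g (m - i)" for i
  have "\<forall>iy\<nu>. \<exists>\<mu>. fst iy\<nu> < m \<longrightarrow>
      w (Suc (fst iy\<nu>)) (fst (snd iy\<nu>) + h *\<^sub>R relaxed_field f (fst (snd iy\<nu>)) \<mu> (snd (snd iy\<nu>))) \<le> w (fst iy\<nu>) (fst (snd iy\<nu>)) + h\<^sup>2"
  proof (intro allI)
    fix iy\<nu> :: "nat \<times> (real^'n) \<times> 'v relaxed"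
    obtain i y \<nu> where eq: "iy\<nu> = (i, y, \<nu>)" by (cases iy\<nu>)
    have "h\<^sup>2 > 0" using h by simp
    from guide_value_stable[of g Kg, OF g(2) this, of f h "m - Suc i" y \<nu>]
    obtain \<mu> where "guide_value f h g (m - Suc i) (y + h *\<^sub>R relaxed_field f y \<mu> \<nu>) \<le> guide_value f h g (Suc (m - Suc i)) y + h\<^sup>2"
      by blast
    then have "i < m \<Longrightarrow> guide_value f h g (m - Suc i) (y + h *\<^sub>R relaxed_field f y \<mu> \<nu>) \<le> guide_value f h g (m - i) y + h\<^sup>2"
      by (simp only: Suc_diff_Suc)
    then show "\<exists>\<mu>. fst iy\<nu> < m \<longrightarrow>
      w (Suc (fst iy\<nu>)) (fst (snd iy\<nu>) + h *\<^sub>R relaxed_field f (fst (snd iy\<nu>)) \<mu> (snd (snd iy\<nu>))) \<le> w (fst iy\<nu>) (fst (snd iy\<nu>)) + h\<^sup>2"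
      unfolding eq fst_conv snd_conv w_def by (intro exI[of _ \<mu>] impI)
  qed
  from choice[OF this] obtain react' where react': "\<forall>iy\<nu>. fst iy\<nu> < m \<longrightarrow>
      w (Suc (fst iy\<nu>)) (fst (snd iy\<nu>) + h *\<^sub>R relaxed_field f (fst (snd iy\<nu>)) (react' iy\<nu>) (snd (snd iy\<nu>))) \<le> w (fst iy\<nu>) (fst (snd iy\<nu>)) + h\<^sup>2"
    by (elim exE)
  interpret punishment_estimate f C L T t \<pi> k p m h X us vs d "\<lambda>a b. aim' (a, b)" "\<lambda>i y \<nu>. react' (i, y, \<nu>)" q w "g (X m) + (T - t) * h" c0
  proof unfold_locales
    show "avg (fst (aim' (a, b))) (\<lambda>u. (a - b) \<bullet> f a u v) \<le> avg (snd (aim' (a, b))) (\<lambda>v. (a - b) \<bullet> f a u v) + h" for a b u v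
      using aim'[rule_format, of "(a, b)"] by simp
    show "w i (X i) \<le> g (X m) + (T - t) * h" if "i \<le> m" for i using val[OF that] by (simp add: w_def)
    show "w (Suc i) (y + h *\<^sub>R relaxed_field f y (react' (i, y, \<nu>)) \<nu>) \<le> w i y + h\<^sup>2" if "i < m" for i y \<nu>
      using react'[rule_format, of "(i, y, \<nu>)"] that by simp
  qed (fact pq m h fine us vs X plan c0 d)+
  have wm: "w m = g" by (auto simp: w_def)
  \<comment> \<open>No deviation of vs from itself is ever detected.\<close>
  have on_plan: "punish l y vs s = us s" for l y s
    by (simp add: punish_def undetected_def set_lebesgue_integral_def)
  have "(\<integral>z. g (trajectory f T t (X 0) (fst (play p q punish b full z)) (snd (play p q punish b full z)) T) \<partial>law)
        \<le> g (X m) + (2 * (T - t) + Lg * K1) * h + Lg * (1 + K4) / 2 * sqrt h" if b: "kernel q T \<pi> t k b" for b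
    using punishment_payoff[OF b g wm] by (simp add: algebra_simps)
  then show ?thesis using kernel_punish on_plan by blast
qed

end

context dynamics
begin

text \<open>
  Each player chooses at each step the relaxed action that secures the own guide value. Then
  neither guide value decreases along the plan, so at each step both are at most the payoff that
  the plan finally yields.
\<close>
lemma plan_exists:
  fixes g1 g2 :: "real^'n \<Rightarrow> real"
  assumes h: "h > 0" and g1: "\<And>x. \<bar>g1 x\<bar> \<le> Kg" and g2: "\<And>x. \<bar>g2 x\<bar> \<le> Kg"
  shows "\<exists>X \<mu> \<nu>. X 0 = x \<and> (\<forall>i<m. X (Suc i) = X i + h *\<^sub>R relaxed_field f (X i) (\<mu> i) (\<nu> i)) \<and>
    (\<forall>i\<le>m. guide_value f h g2 (m - i) (X i) \<le> g2 (X m) + real (m - i) * h\<^sup>2) \<and>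
    (\<forall>i\<le>m. guide_value (\<lambda>x v u. f x u v) h g1 (m - i) (X i) \<le> g1 (X m) + real (m - i) * h\<^sup>2)"
proof -
  let ?f = "\<lambda>x v u. f x u v"
  have h2: "h\<^sup>2 > 0" using h by simp
  have "\<forall>jy. \<exists>\<nu>. \<forall>\<mu>. guide_value f h g2 (Suc (fst jy)) (snd jy) \<le> guide_value f h g2 (fst jy) (snd jy + h *\<^sub>R relaxed_field f (snd jy) \<mu> \<nu>) + h\<^sup>2"
    by (intro allI guide_value_secure[OF g2 h2])
  from choice[OF this] obtain N where N: "\<forall>jy. \<forall>\<mu>. guide_value f h g2 (Suc (fst jy)) (snd jy)
      \<le> guide_value f h g2 (fst jy) (snd jy + h *\<^sub>R relaxed_field f (snd jy) \<mu> (N jy)) + h\<^sup>2" by (elim exE)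
  have "\<forall>jy. \<exists>\<mu>. \<forall>\<nu>. guide_value ?f h g1 (Suc (fst jy)) (snd jy) \<le> guide_value ?f h g1 (fst jy) (snd jy + h *\<^sub>R relaxed_field ?f (snd jy) \<nu> \<mu>) + h\<^sup>2"
    by (intro allI guide_value_secure[OF g1 h2])
  from choice[OF this] obtain M where M: "\<forall>jy. \<forall>\<nu>. guide_value ?f h g1 (Suc (fst jy)) (snd jy)
      \<le> guide_value ?f h g1 (fst jy) (snd jy + h *\<^sub>R relaxed_field ?f (snd jy) \<nu> (M jy)) + h\<^sup>2" by (elim exE)
  define X where "X = rec_nat x (\<lambda>i y. y + h *\<^sub>R relaxed_field f y (M (m - Suc i, y)) (N (m - Suc i, y)))"
  define \<mu> \<nu> where "\<mu> i = M (m - Suc i, X i)" and "\<nu> i = N (m - Suc i, X i)" for i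
  have X: "X 0 = x" "X (Suc i) = X i + h *\<^sub>R relaxed_field f (X i) (\<mu> i) (\<nu> i)" for i
    by (simp_all add: X_def \<mu>_def \<nu>_def)
  have "guide_value f h g2 j (X (m - j)) \<le> g2 (X m) + real j * h\<^sup>2 \<and> guide_value ?f h g1 j (X (m - j)) \<le> g1 (X m) + real j * h\<^sup>2"
    if "j \<le> m" for j
    using that
  proof (induction j)
    case (Suc j)
    define i where "i = m - Suc j"
    have i: "m - Suc i = j" "m - j = Suc i" using Suc.prems by (auto simp: i_def)
    have 2: "guide_value f h g2 (Suc j) (X i) \<le> guide_value f h g2 j (X (Suc i)) + h\<^sup>2"
      using N[rule_format, of "(j, X i)" "\<mu> i"] by (simp add: X(2) \<nu>_def i)
    have 1: "guide_value ?f h g1 (Suc j) (X i) \<le> guide_value ?f h g1 j (X (Suc i)) + h\<^sup>2"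
      using M[rule_format, of "(j, X i)" "\<nu> i"] by (simp add: X(2) \<mu>_def i relaxed_field_swap[of f])
    have "guide_value f h g2 j (X (Suc i)) \<le> g2 (X m) + real j * h\<^sup>2" "guide_value ?f h g1 j (X (Suc i)) \<le> g1 (X m) + real j * h\<^sup>2"
      using Suc i(2) by auto
    then show ?case using 1 2 unfolding i_def[symmetric] by (simp add: algebra_simps del: guide_value.simps)
  qed simp
  note * = this
  have "guide_value f h g2 (m - i) (X i) \<le> g2 (X m) + real (m - i) * h\<^sup>2" "guide_value ?f h g1 (m - i) (X i) \<le> g1 (X m) + real (m - i) * h\<^sup>2"
    if "i \<le> m" for i
    using *[of "m - i"] that by auto
  then show ?thesis using X by blast
qed

end

lemma (in dynamics) dynamics_swap: "dynamics (\<lambda>x v u. f x u v) C L"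
proof
  have c: "continuous_on UNIV (\<lambda>z::'v \<times> 'u. (snd z, fst z))" by (intro continuous_intros)
  show "continuous_on UNIV (\<lambda>(v, u). f x u v)" for x
    using continuous_on_compose2[OF cont[of x] c] by (simp add: case_prod_unfold)
qed (use compact_u compact_v bounded lip C_pos L_pos in auto)

context game
begin

text \<open>
  At time \<open>T\<close>, which belongs to no \<open>stage\<close>, the value is arbitrary.
\<close>
definition strategy_of :: "2 \<Rightarrow> (nat \<Rightarrow> (2 \<times> nat \<Rightarrow> real) \<Rightarrow> (real \<Rightarrow> 'b) \<Rightarrow> real \<Rightarrow> 'a) \<Rightarrow> sample \<Rightarrow> (real \<Rightarrow> 'b) \<Rightarrow> real \<Rightarrow> 'a" where
  "strategy_of p a \<omega> v s = (let l = (THE l. l \<in> {k..<length \<pi>} \<and> s \<in> stage l) in a l (\<lambda>(i, j)\<in>info p k l. \<zeta> \<pi> i j \<omega>) v s)"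

lemma strategy_of:
  assumes "l \<in> {k..<length \<pi>}" "s \<in> stage l"
  shows "strategy_of p a \<omega> v s = a l (\<lambda>(i, j)\<in>info p k l. \<zeta> \<pi> i j \<omega>) v s"
proof -
  have "(THE l. l \<in> {k..<length \<pi>} \<and> s \<in> stage l) = l"
  proof (rule the_equality)
    fix l' assume "l' \<in> {k..<length \<pi>} \<and> s \<in> stage l'"
    then show "l' = l" using assms by (intro stage_disjoint[of s l' l]) auto
  qed (use assms in blast)
  then show ?thesis by (simp add: strategy_of_def)
qed

text \<open>
  The pair \<open>us\<close>, \<open>vs\<close> is consistent with the two strategies for every
  realization of the signals, hence is the outcome.
\<close>
lemma payoff_on_plan:
  assumes a: "kernel 1 T \<pi> t k a" and b: "kernel 2 T \<pi> t k b"
    and plan: "\<And>l y s. a l y vs s = us s" "\<And>l y s. b l y us s = vs s"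
    and us: "us \<in> borel_measurable borel" and vs: "vs \<in> borel_measurable borel"
  shows "(\<integral>z. g (trajectory f T t x (fst (play 1 2 a b full z)) (snd (play 1 2 a b full z)) T) \<partial>law) = (g (trajectory f T t x us vs T) :: real)"
proof -
  interpret Pr: prob_space law by (rule prob_space_law)
  have "trajectory f T t x (fst (play 1 2 a b full z)) (snd (play 1 2 a b full z)) T = trajectory f T t x us vs T"
    if z: "z \<in> space law" for z
  proof -
    have z': "z \<in> space (PiM signals (\<lambda>_. borel))" using z by (simp only: space_law)
    have "consistent 1 2 a b z us vs"
      using borel_controls[OF us] borel_controls[OF vs] by (simp add: consistent_def plan)
    from consistent_unique[OF a b play_consistent[OF compact_u compact_v a b z'] this]
    show ?thesis
      using t_less_T by (intro trajectory_cong_AE play_controls[OF compact_u compact_v a b order_refl z'] borel_controls us vs)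
        (auto elim: eventually_mono)
  qed
  then have "(\<integral>z. g (trajectory f T t x (fst (play 1 2 a b full z)) (snd (play 1 2 a b full z)) T) \<partial>law) =
      (\<integral>z. g (trajectory f T t x us vs T) \<partial>law)"
    by (intro Bochner_Integration.integral_cong) auto
  then show ?thesis by (simp only: lebesgue_integral_const Pr.prob_space scaleR_one)
qed

text \<open>
  The strategies of \<open>security\<close> for the two players, the second with exchanged roles.
\<close>
lemma equilibrium_on_partition:
  fixes X :: "nat \<Rightarrow> real^'n"
  assumes W: "wiener_measure T W" and m: "m > 0" and h: "h > 0" "h \<le> 1" "t + real m * h = T"
    and fine: "\<And>j. Suc j < length \<pi> \<Longrightarrow> \<pi> ! Suc j - \<pi> ! j \<le> h\<^sup>2"
    and us: "us \<in> borel_measurable borel" and vs: "vs \<in> borel_measurable borel"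
    and X: "X 0 = x" "\<And>i. i < m \<Longrightarrow> norm (X (Suc i) - X i) \<le> C * h"
    and plan: "\<And>i. i \<le> m \<Longrightarrow> norm (trajectory f T t x us vs (t + real i * h) - X i) \<le> c0 * h" and c0: "c0 \<ge> 0"
    and val2: "\<And>i. i \<le> m \<Longrightarrow> guide_value f h g2 (m - i) (X i) \<le> g2 (X m) + (T - t) * h"
    and val1: "\<And>i. i \<le> m \<Longrightarrow> guide_value (\<lambda>x v u. f x u v) h g1 (m - i) (X i) \<le> g1 (X m) + (T - t) * h"
    and g1: "\<And>x y. \<bar>g1 x - g1 y\<bar> \<le> Lg * norm (x - y)" "\<And>x. \<bar>g1 x\<bar> \<le> Kg"
    and g2: "\<And>x y. \<bar>g2 x - g2 y\<bar> \<le> Lg * norm (x - y)" "\<And>x. \<bar>g2 x\<bar> \<le> Kg" and Lg: "0 \<le> Lg"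
  defines "E \<equiv> (2 * (T - t) + Lg * punishment_estimate.K1 C L T t c0 + Lg * c0) * h + Lg * (1 + punishment_estimate.K4 C L T t) / 2 * sqrt h"
    and "y \<equiv> trajectory f T t x us vs T"
  shows "\<exists>\<alpha>\<^sub>0\<in>strategies 1 (enlarged W) T \<pi> t. \<exists>\<beta>\<^sub>0\<in>strategies 2 (enlarged W) T \<pi> t.
    (\<forall>\<alpha>\<in>strategies 1 (enlarged W) T \<pi> t. payoff f g1 (enlarged W) T t x \<alpha> \<beta>\<^sub>0 \<le> g1 y + E) \<and>
    (\<forall>\<beta>\<in>strategies 2 (enlarged W) T \<pi> t. payoff f g2 (enlarged W) T t x \<alpha>\<^sub>0 \<beta> \<le> g2 y + E) \<and>
    payoff f g1 (enlarged W) T t x \<alpha>\<^sub>0 \<beta>\<^sub>0 = g1 y \<and> payoff f g2 (enlarged W) T t x \<alpha>\<^sub>0 \<beta>\<^sub>0 = g2 y"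
proof -
  interpret swap: game "\<lambda>x v u. f x u v" C L T t \<pi> k
    by (intro game.intro dynamics_swap partitioned_axioms)
  let ?e = "(2 * (T - t) + Lg * punishment_estimate.K1 C L T t c0) * h + Lg * (1 + punishment_estimate.K4 C L T t) / 2 * sqrt h"
  have lip_meas: "g \<in> borel_measurable borel" if "\<And>x y. \<bar>g x - g y\<bar> \<le> Lg * norm (x - y)" for g :: "real^'n \<Rightarrow> real"
    using that Lg by (intro borel_measurable_continuous_onI lipschitz_on_continuous_on[of Lg] lipschitz_onI) (auto simp: dist_norm)
  have "\<exists>a. kernel 1 T \<pi> t k a \<and> (\<forall>l y s. a l y vs s = us s) \<and>
    (\<forall>b. kernel 2 T \<pi> t k b \<longrightarrow>
      (\<integral>z. g2 (trajectory f T t (X 0) (fst (play 1 2 a b full z)) (snd (play 1 2 a b full z)) T) \<partial>law) \<le> g2 (X m) +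
        (2 * (T - t) + Lg * punishment_estimate.K1 C L T t c0) * h + Lg * (1 + punishment_estimate.K4 C L T t) / 2 * sqrt h)"
    by (rule security[OF _ m h fine us vs X(2) _ c0 val2 g2 Lg]) (use plan X(1) in auto)
  then obtain a where a: "kernel 1 T \<pi> t k a" "\<And>l y s. a l y vs s = us s"
    "\<And>b. kernel 2 T \<pi> t k b \<Longrightarrow> (\<integral>z. g2 (trajectory f T t x (fst (play 1 2 a b full z)) (snd (play 1 2 a b full z)) T) \<partial>law) \<le> g2 (X m) + ?e"
    unfolding X(1) by (auto simp: add.assoc)
  have "\<exists>b. kernel 2 T \<pi> t k b \<and> (\<forall>l y s. b l y us s = vs s) \<and>
    (\<forall>a. kernel 1 T \<pi> t k a \<longrightarrow>
      (\<integral>z. g1 (trajectory (\<lambda>x v u. f x u v) T t (X 0) (fst (play 2 1 b a full z)) (snd (play 2 1 b a full z)) T) \<partial>law) \<le> g1 (X m) +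
        (2 * (T - t) + Lg * punishment_estimate.K1 C L T t c0) * h + Lg * (1 + punishment_estimate.K4 C L T t) / 2 * sqrt h)"
    by (rule swap.security[OF _ m h fine vs us X(2) _ c0 val1 g1 Lg]) (use plan X(1) in \<open>auto simp: trajectory_swap[of f]\<close>)
  then obtain b where b: "kernel 2 T \<pi> t k b" "\<And>l y s. b l y us s = vs s"
    "\<And>a. kernel 1 T \<pi> t k a \<Longrightarrow> (\<integral>z. g1 (trajectory f T t x (fst (play 1 2 a b full z)) (snd (play 1 2 a b full z)) T) \<partial>law) \<le> g1 (X m) + ?e"
    unfolding X(1) trajectory_swap[of f] play_swap[where p = 1 and q = 2] by (auto simp: add.assoc)
  have y: "norm (X m - y) \<le> c0 * h" using plan[of m] h(3) by (simp add: y_def norm_minus_commute)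
  have gX: "g (X m) + ?e \<le> g y + E" if "\<And>x y. \<bar>g x - g y\<bar> \<le> Lg * norm (x - y)" for g
  proof -
    have "g (X m) - g y \<le> Lg * (c0 * h)"
      using that[of "X m" y] mult_left_mono[OF y Lg] by linarith
    then show ?thesis by (simp add: E_def algebra_simps)
  qed
  have \<alpha>: "\<forall>l\<in>{k..<length \<pi>}. \<forall>\<omega>\<in>space (enlarged W). \<forall>v\<in>controls t T. \<forall>s\<in>stage l.
           strategy_of 1 a \<omega> v s = a l (\<lambda>(i, j)\<in>info 1 k l. \<zeta> \<pi> i j \<omega>) v s"
    by (intro ballI strategy_of)
  have \<beta>: "\<forall>l\<in>{k..<length \<pi>}. \<forall>\<omega>\<in>space (enlarged W). \<forall>v\<in>controls t T. \<forall>s\<in>stage l.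
           strategy_of 2 b \<omega> v s = b l (\<lambda>(i, j)\<in>info 2 k l. \<zeta> \<pi> i j \<omega>) v s"
    by (intro ballI strategy_of)
  show ?thesis
  proof (intro bexI[of _ "strategy_of 1 a"] bexI[of _ "strategy_of 2 b"] conjI ballI)
    show "strategy_of 1 a \<in> strategies 1 (enlarged W) T \<pi> t" unfolding strategies_iff using a(1) \<alpha> by blast
    show "strategy_of 2 b \<in> strategies 2 (enlarged W) T \<pi> t" unfolding strategies_iff using b(1) \<beta> by blast
    show "payoff f g1 (enlarged W) T t x (strategy_of 1 a) (strategy_of 2 b) = g1 y"
      unfolding payoff_eq[OF W lip_meas[OF g1(1)] a(1) b(1) \<alpha> \<beta>] y_def by (rule payoff_on_plan[OF a(1) b(1) a(2) b(2) us vs])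
    show "payoff f g2 (enlarged W) T t x (strategy_of 1 a) (strategy_of 2 b) = g2 y"
      unfolding payoff_eq[OF W lip_meas[OF g2(1)] a(1) b(1) \<alpha> \<beta>] y_def by (rule payoff_on_plan[OF a(1) b(1) a(2) b(2) us vs])
    fix \<alpha>' :: "sample \<Rightarrow> (real \<Rightarrow> 'v) \<Rightarrow> real \<Rightarrow> 'u" assume "\<alpha>' \<in> strategies 1 (enlarged W) T \<pi> t"
    then obtain a' where a': "kernel 1 T \<pi> t k a'" "\<forall>l\<in>{k..<length \<pi>}. \<forall>\<omega>\<in>space (enlarged W). \<forall>v\<in>controls t T. \<forall>s\<in>stage l.
           \<alpha>' \<omega> v s = a' l (\<lambda>(i, j)\<in>info 1 k l. \<zeta> \<pi> i j \<omega>) v s" unfolding strategies_iff by blast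
    show "payoff f g1 (enlarged W) T t x \<alpha>' (strategy_of 2 b) \<le> g1 y + E"
      unfolding payoff_eq[OF W lip_meas[OF g1(1)] a'(1) b(1) a'(2) \<beta>] by (rule order_trans[OF b(3)[OF a'(1)] gX[OF g1(1)]])
  next
    fix \<beta>' :: "sample \<Rightarrow> (real \<Rightarrow> 'u) \<Rightarrow> real \<Rightarrow> 'v" assume "\<beta>' \<in> strategies 2 (enlarged W) T \<pi> t"
    then obtain b' where b': "kernel 2 T \<pi> t k b'" "\<forall>l\<in>{k..<length \<pi>}. \<forall>\<omega>\<in>space (enlarged W). \<forall>v\<in>controls t T. \<forall>s\<in>stage l.
           \<beta>' \<omega> v s = b' l (\<lambda>(i, j)\<in>info 2 k l. \<zeta> \<pi> i j \<omega>) v s" unfolding strategies_iff by blast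
    show "payoff f g2 (enlarged W) T t x (strategy_of 1 a) \<beta>' \<le> g2 y + E"
      unfolding payoff_eq[OF W lip_meas[OF g2(1)] a(1) b'(1) \<alpha> b'(2)] by (rule order_trans[OF a(3)[OF b'(1)] gX[OF g2(1)]])
  qed
qed

end

lemma partition_index_exists:
  assumes "is_partition T \<pi>" "0 \<le> t" "t < T"
  shows "\<exists>k\<in>{1..<length \<pi>}. t \<in> {\<pi> ! (k - 1)..<\<pi> ! k}"
proof -
  have ends: "\<pi> ! 0 = 0" "\<pi> ! (length \<pi> - 1) = T" "\<pi> \<noteq> []"
    using assms(1) by (auto simp: is_partition_def hd_conv_nth last_conv_nth)
  define k where "k = (LEAST l. t < \<pi> ! l)"
  have last: "t < \<pi> ! (length \<pi> - 1)" using ends assms by simp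
  then have k: "t < \<pi> ! k" unfolding k_def by (rule LeastI)
  have "k \<le> length \<pi> - 1" unfolding k_def using last by (rule Least_le)
  then have "k < length \<pi>" using ends(3) by (cases \<pi>) auto
  moreover have "k \<noteq> 0" using k ends assms by (intro notI) simp
  moreover have "\<pi> ! (k - 1) \<le> t"
    using not_less_Least[of "k - 1" "\<lambda>l. t < \<pi> ! l"] \<open>k \<noteq> 0\<close> unfolding k_def by simp
  ultimately show ?thesis using k by (intro bexI[of _ k]) auto
qed

lemma mesh_step:
  assumes "Suc j < length \<pi>"
  shows "\<pi> ! Suc j - \<pi> ! j \<le> mesh \<pi>"
proof -
  have "(\<lambda>j. \<pi> ! j - \<pi> ! (j - 1)) (Suc j) \<in> (\<lambda>j. \<pi> ! j - \<pi> ! (j - 1)) ` {1..<length \<pi>}"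
    using assms by (intro imageI) auto
  then show ?thesis unfolding mesh_def by (intro Max_ge) auto
qed

context dynamics
begin

text \<open>
  The payoffs of plans with \<open>n + 1\<close> macro steps form a bounded sequence in the plane,
  and any cluster point is an equilibrium payoff: the plan depends on \<open>\<epsilon>\<close>
  but not on the partition, which only has to be finer than \<open>h\<^sup>2\<close>.
\<close>
lemma nash_payoff_exists:
  assumes W: "wiener_measure T W" and t: "0 \<le> t" "t < T"
    and g1: "\<And>x y. \<bar>g1 x - g1 y\<bar> \<le> Lg * norm (x - y)" "\<And>x. \<bar>g1 x\<bar> \<le> Kg"
    and g2: "\<And>x y. \<bar>g2 x - g2 y\<bar> \<le> Lg * norm (x - y)" "\<And>x. \<bar>g2 x\<bar> \<le> Kg" and Lg: "0 \<le> Lg"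
  shows "\<exists>e. nash_payoff f g1 g2 (enlarged W) T t x e"
proof -
  define h where "h n = (T - t) / real (Suc n)" for n
  have h: "h n > 0" "t + real (Suc n) * h n = T" for n using t by (simp_all add: h_def del: of_nat_Suc)
  define c0 where "c0 = exp (L * (T - t)) * (T - t) * L * C"
  have c0: "c0 \<ge> 0" using t L_pos C_pos by (simp add: c0_def)
  define good where "good n P \<longleftrightarrow> fst P 0 = x \<and>
      (\<forall>i<Suc n. fst P (Suc i) = fst P i + h n *\<^sub>R relaxed_field f (fst P i) (fst (snd P) i) (snd (snd P) i)) \<and>
      (\<forall>i\<le>Suc n. guide_value f (h n) g2 (Suc n - i) (fst P i) \<le> g2 (fst P (Suc n)) + real (Suc n - i) * (h n)\<^sup>2) \<and>
      (\<forall>i\<le>Suc n. guide_value (\<lambda>x v u. f x u v) (h n) g1 (Suc n - i) (fst P i) \<le> g1 (fst P (Suc n)) + real (Suc n - i) * (h n)\<^sup>2)"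
    for n and P :: "(nat \<Rightarrow> real^'n) \<times> (nat \<Rightarrow> 'u relaxed) \<times> (nat \<Rightarrow> 'v relaxed)"
  have "\<forall>n. \<exists>P. good n P"
  proof
    fix n
    from plan_exists[of "h n" g1 Kg g2 x "Suc n", OF h(1) g1(2) g2(2)] obtain X \<mu> \<nu> where "good n (X, \<mu>, \<nu>)"
      unfolding good_def fst_conv snd_conv by (elim exE)
    then show "\<exists>P. good n P" by (rule exI)
  qed
  from choice[OF this] obtain P where P: "\<forall>n. good n (P n)" by (elim exE)
  define X where "X n = fst (P n)" for n
  define us where "us n = plan_u t (h n) (fst (snd (P n))) (snd (snd (P n)))" for n
  define vs where "vs n = plan_v t (h n) (fst (snd (P n))) (snd (snd (P n)))" for n
  define y where "y n = trajectory f T t x (us n) (vs n) T" for n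
  have X0: "X n 0 = x" for n using P by (simp add: X_def good_def)
  have XS: "X n (Suc i) = X n i + h n *\<^sub>R relaxed_field f (X n i) (fst (snd (P n)) i) (snd (snd (P n)) i)" if "i < Suc n" for n i
    unfolding X_def using P[rule_format, of n] that unfolding good_def by blast
  have budget: "real (Suc n - i) * (h n)\<^sup>2 \<le> (T - t) * h n" for n i
  proof -
    have "real (Suc n - i) * (h n)\<^sup>2 \<le> real (Suc n) * (h n)\<^sup>2" by (intro mult_right_mono) auto
    also have "\<dots> = (real (Suc n) * h n) * h n" by (simp add: power2_eq_square del: of_nat_Suc)
    also have "real (Suc n) * h n = T - t" using h(2)[of n] by linarith
    finally show ?thesis .
  qed
  have val2: "guide_value f (h n) g2 (Suc n - i) (X n i) \<le> g2 (X n (Suc n)) + (T - t) * h n" if "i \<le> Suc n" for n i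
    using P[rule_format, of n, unfolded good_def] that budget[of n i] unfolding X_def by (meson add_left_mono order_trans)
  have val1: "guide_value (\<lambda>x v u. f x u v) (h n) g1 (Suc n - i) (X n i) \<le> g1 (X n (Suc n)) + (T - t) * h n" if "i \<le> Suc n" for n i
    using P[rule_format, of n, unfolded good_def] that budget[of n i] unfolding X_def by (meson add_left_mono order_trans)
  have Xstep: "norm (X n (Suc i) - X n i) \<le> C * h n" if "i < Suc n" for n i
    unfolding XS[OF that] using norm_relaxed_field[of "X n i"] h(1)[of n] by (simp add: mult.commute[of C] mult_left_mono)
  have plan: "norm (trajectory f T t x (us n) (vs n) (t + real i * h n) - X n i) \<le> c0 * h n" if "i \<le> Suc n" for n i
    unfolding us_def vs_def c0_def by (rule plan_trajectory[OF h(1) h(2) X0 XS that])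
  have um: "us n \<in> borel_measurable borel" "vs n \<in> borel_measurable borel" for n
    unfolding us_def vs_def plan_u_def plan_v_def by (rule measurable_chatter)+
  have "Elementary_Metric_Spaces.bounded (range (\<lambda>n. (g1 (y n), g2 (y n))))"
  proof (rule bounded_subset)
    show "Elementary_Metric_Spaces.bounded ({- Kg..Kg} \<times> {- Kg..Kg})" by (intro bounded_Times bounded_closed_interval)
    show "range (\<lambda>n. (g1 (y n), g2 (y n))) \<subseteq> {- Kg..Kg} \<times> {- Kg..Kg}"
      using g1(2) g2(2) by (auto simp: abs_le_iff minus_le_iff)
  qed
  then obtain e r where r: "strict_mono (r :: nat \<Rightarrow> nat)" and e: "((\<lambda>n. (g1 (y n), g2 (y n))) \<circ> r) \<longlonglongrightarrow> e"
    using bounded_imp_convergent_subsequence by blast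
  define E where "E n = (2 * (T - t) + Lg * punishment_estimate.K1 C L T t c0 + Lg * c0) * h n + Lg * (1 + punishment_estimate.K4 C L T t) / 2 * sqrt (h n)" for n
  have h0: "h \<longlonglongrightarrow> 0" unfolding h_def using LIMSEQ_Suc[OF lim_const_over_n[of "T - t"]] .
  have E0: "E \<longlonglongrightarrow> 0"
  proof -
    have lim: "(\<lambda>n. c1 * h n + c2 * sqrt (h n)) \<longlonglongrightarrow> 0" for c1 c2
      using tendsto_add[OF tendsto_mult[OF tendsto_const h0] tendsto_mult[OF tendsto_const tendsto_real_sqrt[OF h0]], of c1 c2] by simp
    show ?thesis unfolding E_def by (rule lim)
  qed
  have "nash_payoff f g1 g2 (enlarged W) T t x e"
    unfolding nash_payoff_def
  proof (intro allI impI)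
    fix \<epsilon> :: real assume \<epsilon>: "\<epsilon> > 0"
    have "\<forall>\<^sub>F n in sequentially. E (r n) < \<epsilon>"
      using order_tendstoD(2)[OF LIMSEQ_subseq_LIMSEQ[OF E0 r] \<epsilon>] by (simp add: o_def)
    moreover have "\<forall>\<^sub>F n in sequentially. h (r n) < 1"
      using order_tendstoD(2)[OF LIMSEQ_subseq_LIMSEQ[OF h0 r] zero_less_one] by (simp add: o_def)
    moreover have "\<forall>\<^sub>F n in sequentially. dist (g1 (y (r n)), g2 (y (r n))) e < \<epsilon>"
      using e \<epsilon> by (simp add: tendsto_iff)
    ultimately have "\<forall>\<^sub>F n in sequentially. E (r n) < \<epsilon> \<and> h (r n) < 1 \<and> dist (g1 (y (r n)), g2 (y (r n))) e < \<epsilon>"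
      by (intro eventually_conj)
    then obtain n0 where "E (r n0) < \<epsilon> \<and> h (r n0) < 1 \<and> dist (g1 (y (r n0)), g2 (y (r n0))) e < \<epsilon>"
      using eventually_happens'[OF sequentially_bot] by blast
    then obtain n where n: "E n < \<epsilon>" "h n < 1" "dist (g1 (y n), g2 (y n)) e < \<epsilon>" by blast
    show "\<exists>\<delta>>0. \<forall>\<pi>. is_partition T \<pi> \<and> mesh \<pi> \<le> \<delta> \<longrightarrow>
        (\<exists>\<alpha>\<^sub>\<epsilon> \<in> strategies 1 (enlarged W) T \<pi> t. \<exists>\<beta>\<^sub>\<epsilon> \<in> strategies 2 (enlarged W) T \<pi> t.
           (\<forall>\<alpha> \<in> strategies 1 (enlarged W) T \<pi> t. \<forall>\<beta> \<in> strategies 2 (enlarged W) T \<pi> t.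
              payoff f g1 (enlarged W) T t x \<alpha>\<^sub>\<epsilon> \<beta>\<^sub>\<epsilon> \<ge> payoff f g1 (enlarged W) T t x \<alpha> \<beta>\<^sub>\<epsilon> - \<epsilon> \<and>
              payoff f g2 (enlarged W) T t x \<alpha>\<^sub>\<epsilon> \<beta>\<^sub>\<epsilon> \<ge> payoff f g2 (enlarged W) T t x \<alpha>\<^sub>\<epsilon> \<beta> - \<epsilon>) \<and>
           \<bar>payoff f g1 (enlarged W) T t x \<alpha>\<^sub>\<epsilon> \<beta>\<^sub>\<epsilon> - fst e\<bar> \<le> \<epsilon> \<and>
           \<bar>payoff f g2 (enlarged W) T t x \<alpha>\<^sub>\<epsilon> \<beta>\<^sub>\<epsilon> - snd e\<bar> \<le> \<epsilon>)"
      (is "\<exists>\<delta>>0. \<forall>\<pi>. _ \<longrightarrow> ?Q \<pi>")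
    proof (intro exI[of _ "(h n)\<^sup>2"] conjI allI impI)
      show "0 < (h n)\<^sup>2" using h(1)[of n] by simp
      fix \<pi> assume \<pi>: "is_partition T \<pi> \<and> mesh \<pi> \<le> (h n)\<^sup>2"
      obtain k where k: "k \<in> {1..<length \<pi>}" "t \<in> {\<pi> ! (k - 1)..<\<pi> ! k}"
        using partition_index_exists[of T \<pi> t] \<pi> t by blast
      interpret game f C L T t \<pi> k by unfold_locales (use \<pi> k in auto)
      have fine: "\<pi> ! Suc j - \<pi> ! j \<le> (h n)\<^sup>2" if "Suc j < length \<pi>" for j
        using mesh_step[OF that] \<pi> by linarith
      have h1: "h n \<le> 1" using n(2) by simp
      obtain \<alpha>0 \<beta>0 where eq: "\<alpha>0 \<in> strategies 1 (enlarged W) T \<pi> t" "\<beta>0 \<in> strategies 2 (enlarged W) T \<pi> t"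
        "\<And>\<alpha>. \<alpha> \<in> strategies 1 (enlarged W) T \<pi> t \<Longrightarrow> payoff f g1 (enlarged W) T t x \<alpha> \<beta>0 \<le> g1 (y n) + E n"
        "\<And>\<beta>. \<beta> \<in> strategies 2 (enlarged W) T \<pi> t \<Longrightarrow> payoff f g2 (enlarged W) T t x \<alpha>0 \<beta> \<le> g2 (y n) + E n"
        "payoff f g1 (enlarged W) T t x \<alpha>0 \<beta>0 = g1 (y n)" "payoff f g2 (enlarged W) T t x \<alpha>0 \<beta>0 = g2 (y n)"
        using equilibrium_on_partition[where X = "X n" and m = "Suc n" and h = "h n" and us = "us n" and vs = "vs n" and ?c0.0 = c0
            and x = x and ?g1.0 = g1 and ?g2.0 = g2 and Lg = Lg and Kg = Kg and W = W,
            OF W zero_less_Suc h(1) h1 h(2) fine um X0 Xstep plan c0 val2 val1 g1 g2 Lg]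
        unfolding E_def y_def by blast
      have "\<bar>g1 (y n) - fst e\<bar> \<le> \<epsilon>" "\<bar>g2 (y n) - snd e\<bar> \<le> \<epsilon>"
        using n(3) dist_fst_le[of "(g1 (y n), g2 (y n))" e] dist_snd_le[of "(g1 (y n), g2 (y n))" e]
        by (auto simp: dist_real_def)
      then show "?Q \<pi>"
      proof (intro bexI[OF _ eq(1)] bexI[OF _ eq(2)] conjI ballI)
        fix \<alpha> :: "sample \<Rightarrow> (real \<Rightarrow> 'v) \<Rightarrow> real \<Rightarrow> 'u" and \<beta> :: "sample \<Rightarrow> (real \<Rightarrow> 'u) \<Rightarrow> real \<Rightarrow> 'v"
        assume *: "\<alpha> \<in> strategies 1 (enlarged W) T \<pi> t" "\<beta> \<in> strategies 2 (enlarged W) T \<pi> t"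
        show "payoff f g1 (enlarged W) T t x \<alpha> \<beta>0 - \<epsilon> \<le> payoff f g1 (enlarged W) T t x \<alpha>0 \<beta>0"
          using eq(3)[OF *(1)] eq(5) n(1) by linarith
        show "payoff f g2 (enlarged W) T t x \<alpha>0 \<beta> - \<epsilon> \<le> payoff f g2 (enlarged W) T t x \<alpha>0 \<beta>0"
          using eq(4)[OF *(2)] eq(6) n(1) by linarith
      qed (simp_all add: eq(5,6))
    qed
  qed
  then show ?thesis by blast
qed

end

text \<open>
  No partition interval \<open>[t\<^sub>k\<^sub>-\<^sub>1, t\<^sub>k)\<close> contains
  \<open>T\<close>, so that the defining condition is void.
\<close>
lemma strategies_at_end:
  assumes "is_partition T \<pi>"
  shows "strategies p M T \<pi> T = UNIV"
proof -
  have "\<pi> ! k \<le> T" if "k < length \<pi>" for k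
  proof -
    have "\<pi> ! k \<le> \<pi> ! (length \<pi> - 1)"
      using assms that by (cases "k = length \<pi> - 1") (auto simp: is_partition_def sorted_wrt_iff_nth_less intro!: less_imp_le)
    moreover have "\<pi> ! (length \<pi> - 1) = T"
      using assms last_conv_nth[of \<pi>] by (auto simp: is_partition_def)
    ultimately show ?thesis by simp
  qed
  then have no: "\<not> (T \<in> {\<pi> ! (k - 1)..<\<pi> ! k})" if "k \<in> {1..<length \<pi>}" for k using that by force
  show ?thesis unfolding strategies_def set_eq_iff using no by (intro allI iffI UNIV_I CollectI ballI impI) blast
qed

theorem theorem4p2:
  fixes f :: "real^'n \<Rightarrow> 'u::metric_space \<Rightarrow> 'v::metric_space \<Rightarrow> real^'n"
    and g\<^sub>1 g\<^sub>2 :: "real^'n \<Rightarrow> real"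
    and T t :: real and x :: "real^'n"
    and W :: "(real \<Rightarrow> real^2) measure"
  assumes "T > 0"
    and "compact (UNIV :: 'u set)" and "compact (UNIV :: 'v set)"
    and "bounded (range (\<lambda>(x, u, v). f x u v))"
    and "\<And>x. continuous_on UNIV (\<lambda>(u, v). f x u v)"
    and "\<exists>L. \<forall>u v. L-lipschitz_on UNIV (\<lambda>x. f x u v)"
    and "bounded (range g\<^sub>1)" and "\<exists>L. L-lipschitz_on UNIV g\<^sub>1"
    and "bounded (range g\<^sub>2)" and "\<exists>L. L-lipschitz_on UNIV g\<^sub>2"
    and "wiener_measure T W"
    and "t \<in> {0..T}"
  shows "\<exists>e. nash_payoff f g\<^sub>1 g\<^sub>2 (enlarged W) T t x e"
proof (cases "t = T")
  case True
  have "nash_payoff f g\<^sub>1 g\<^sub>2 (enlarged W) T t x (g\<^sub>1 x, g\<^sub>2 x)"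
    unfolding nash_payoff_def
  proof (intro allI impI exI[of _ 1] conjI)
    fix \<epsilon> :: real and \<pi> assume "\<epsilon> > 0" "is_partition T \<pi> \<and> mesh \<pi> \<le> 1"
    then show "\<exists>\<alpha>\<^sub>\<epsilon> \<in> strategies 1 (enlarged W) T \<pi> t. \<exists>\<beta>\<^sub>\<epsilon> \<in> strategies 2 (enlarged W) T \<pi> t.
           (\<forall>\<alpha> \<in> strategies 1 (enlarged W) T \<pi> t. \<forall>\<beta> \<in> strategies 2 (enlarged W) T \<pi> t.
              payoff f g\<^sub>1 (enlarged W) T t x \<alpha>\<^sub>\<epsilon> \<beta>\<^sub>\<epsilon> \<ge> payoff f g\<^sub>1 (enlarged W) T t x \<alpha> \<beta>\<^sub>\<epsilon> - \<epsilon> \<and>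
              payoff f g\<^sub>2 (enlarged W) T t x \<alpha>\<^sub>\<epsilon> \<beta>\<^sub>\<epsilon> \<ge> payoff f g\<^sub>2 (enlarged W) T t x \<alpha>\<^sub>\<epsilon> \<beta> - \<epsilon>) \<and>
           \<bar>payoff f g\<^sub>1 (enlarged W) T t x \<alpha>\<^sub>\<epsilon> \<beta>\<^sub>\<epsilon> - fst (g\<^sub>1 x, g\<^sub>2 x)\<bar> \<le> \<epsilon> \<and>
           \<bar>payoff f g\<^sub>2 (enlarged W) T t x \<alpha>\<^sub>\<epsilon> \<beta>\<^sub>\<epsilon> - snd (g\<^sub>1 x, g\<^sub>2 x)\<bar> \<le> \<epsilon>"
      unfolding payoff_def using True by (simp add: strategies_at_end)
  qed simp
  then show ?thesis by blast
next
  case False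
  then have t: "0 \<le> t" "t < T" using assms(12) by auto
  obtain C where C: "C > 0" "\<And>z. z \<in> range (\<lambda>(x, u, v). f x u v) \<Longrightarrow> norm z \<le> C"
    using assms(4) unfolding bounded_pos by blast
  have Cf: "norm (f x u v) \<le> C" for x u v
    by (rule C(2)) (rule image_eqI[of _ _ "(x, u, v)"], auto)
  obtain L where L: "\<And>u v. L-lipschitz_on UNIV (\<lambda>x. f x u v)" using assms(6) by blast
  have Lf: "norm (f x u v - f y u v) \<le> max L 1 * norm (x - y)" for x y u v
    using lipschitz_onD[OF L[of u v], of x y] mult_right_mono[of L "max L 1" "norm (x - y)"] by (simp add: dist_norm)
  interpret dynamics f C "max L 1"
    by unfold_locales (use assms(2,3,5) Cf Lf C(1) in auto)
  obtain K1 where K1: "\<And>x. \<bar>g\<^sub>1 x\<bar> \<le> K1" using assms(7) unfolding bounded_iff by auto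
  obtain K2 where K2: "\<And>x. \<bar>g\<^sub>2 x\<bar> \<le> K2" using assms(9) unfolding bounded_iff by auto
  obtain L1 where L1: "L1-lipschitz_on UNIV g\<^sub>1" using assms(8) by blast
  obtain L2 where L2: "L2-lipschitz_on UNIV g\<^sub>2" using assms(10) by blast
  show ?thesis
  proof (rule nash_payoff_exists[OF assms(11) t])
    show "\<bar>g\<^sub>1 x - g\<^sub>1 y\<bar> \<le> max L1 L2 * norm (x - y)" for x y
      using lipschitz_onD[OF L1, of x y] mult_right_mono[of L1 "max L1 L2" "norm (x - y)"] by (simp add: dist_norm)
    show "\<bar>g\<^sub>2 x - g\<^sub>2 y\<bar> \<le> max L1 L2 * norm (x - y)" for x y
      using lipschitz_onD[OF L2, of x y] mult_right_mono[of L2 "max L1 L2" "norm (x - y)"] by (simp add: dist_norm)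
    show "\<bar>g\<^sub>1 x\<bar> \<le> max K1 K2" for x using K1[of x] by simp
    show "\<bar>g\<^sub>2 x\<bar> \<le> max K1 K2" for x using K2[of x] by simp
    show "0 \<le> max L1 L2" using lipschitz_on_nonneg[OF L1] by simp
  qed
qed

end
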